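(* Let $T$ be a complete first-order theory in which Conant-independence is symmetric. Then $T$ is $\mathrm{NSOP}_4$. Consequently, $n=4$ is the greatest $n$ such that there are strictly $\mathrm{NSOP}_n$ theories (i.e. $\mathrm{NSOP}_n$ but $\mathrm{SOP}_{n-1}$) with symmetric Conant-independence.
   Context: Work in a monster model. A global type $p$ is $M$-invariant if membership of $\varphi(x,b)$ depends only on $\mathrm{tp}(b/M)$; an invariant Morley sequence over $M$ in $p$ is $(b_i)$ with $b_i\models p|_{Mb_{<i}}$. $\varphi(x,b)$ Conant-divides over a model $M$ if for every invariant Morley sequence $(b_i)_{i<\omega}$ over $M$ with $b_0=b$, $\{\varphi(x,b_i)\}$ is inconsistent; it Conant-forks if it implies a finite disjunction of formulas Conant-dividing over $M$; $a\perp^{K^*}_M b$ (Conant-independence) iff $\mathrm{tp}(a/Mb)$ contains no formula Conant-forking over $M$. Symmetric: $a\perp^{K^*}_M b\iff b\perp^{K^*}_M a$ for all models $M$ and sets $a,b$. For $n\geq3$, $T$ has $\mathrm{SOP}_n$ if there is a definable relation $R(x_1,x_2)$ with no $n$-cycles and a sequence $(a_i)_{i<\omega}$ with $R(a_i,a_j)$ for all $i<j$; $\mathrm{NSOP}_n$ is the negation. *)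

theory Defs
  imports Main
begin

unbundle cardinal_syntax

section \<open>First-order logic\<close>

text \<open>Symbols are given by sets rather than by whole types, so that a language may lack
  function symbols or relation symbols. Constants are function symbols of arity 0.\<close>

record ('f, 'r) language =
  funs :: "'f set"
  rels :: "'r set"
  farity :: "'f \<Rightarrow> nat"
  rarity :: "'r \<Rightarrow> nat"

datatype 'f tm = Var nat | Fn 'f "'f tm list"

text \<open>Variables are de Bruijn indices: in \<open>Ex \<phi>\<close> the bound variable is number 0 of \<open>\<phi>\<close>.\<close>

datatype ('f, 'r) fm =
    Eq "'f tm" "'f tm"
  | Rel 'r "'f tm list"
  | Neg "('f, 'r) fm"
  | Conj "('f, 'r) fm" "('f, 'r) fm"
  | Ex "('f, 'r) fm"

fun wf_tm :: "('f, 'r) language \<Rightarrow> nat \<Rightarrow> 'f tm \<Rightarrow> bool" where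
  "wf_tm L n (Var i) \<longleftrightarrow> i < n"
| "wf_tm L n (Fn g ts) \<longleftrightarrow>
     g \<in> funs L \<and> length ts = farity L g \<and> (\<forall>t\<in>set ts. wf_tm L n t)"

text \<open>\<open>wf_fm L n \<phi>\<close>: \<open>\<phi>\<close> is an \<open>L\<close>-formula whose free variables are among \<open>0, \<dots>, n - 1\<close>.\<close>

fun wf_fm :: "('f, 'r) language \<Rightarrow> nat \<Rightarrow> ('f, 'r) fm \<Rightarrow> bool" where
  "wf_fm L n (Eq s t) \<longleftrightarrow> wf_tm L n s \<and> wf_tm L n t"
| "wf_fm L n (Rel P ts) \<longleftrightarrow>
     P \<in> rels L \<and> length ts = rarity L P \<and> (\<forall>t\<in>set ts. wf_tm L n t)"
| "wf_fm L n (Neg \<phi>) \<longleftrightarrow> wf_fm L n \<phi>"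
| "wf_fm L n (Conj \<phi> \<psi>) \<longleftrightarrow> wf_fm L n \<phi> \<and> wf_fm L n \<psi>"
| "wf_fm L n (Ex \<phi>) \<longleftrightarrow> wf_fm L (Suc n) \<phi>"

record ('m, 'f, 'r) struct =
  dom :: "'m set"
  fn :: "'f \<Rightarrow> 'm list \<Rightarrow> 'm"
  rel :: "'r \<Rightarrow> 'm list \<Rightarrow> bool"

definition tuples :: "'m set \<Rightarrow> nat \<Rightarrow> 'm list set" where
  "tuples A n = {a. set a \<subseteq> A \<and> length a = n}"

definition is_struct :: "('f, 'r) language \<Rightarrow> ('m, 'f, 'r) struct \<Rightarrow> bool" where
  "is_struct L N \<longleftrightarrow> dom N \<noteq> {} \<and>
     (\<forall>g\<in>funs L. \<forall>a\<in>tuples (dom N) (farity L g). fn N g a \<in> dom N)"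

fun val :: "('m, 'f, 'r) struct \<Rightarrow> 'm list \<Rightarrow> 'f tm \<Rightarrow> 'm" where
  "val N e (Var i) = e ! i"
| "val N e (Fn g ts) = fn N g (map (val N e) ts)"

text \<open>The list \<open>e\<close> assigns \<open>e ! i\<close> to the variable \<open>i\<close>.\<close>

fun sat :: "('m, 'f, 'r) struct \<Rightarrow> 'm list \<Rightarrow> ('f, 'r) fm \<Rightarrow> bool" where
  "sat N e (Eq s t) \<longleftrightarrow> val N e s = val N e t"
| "sat N e (Rel P ts) \<longleftrightarrow> rel N P (map (val N e) ts)"
| "sat N e (Neg \<phi>) \<longleftrightarrow> \<not> sat N e \<phi>"
| "sat N e (Conj \<phi> \<psi>) \<longleftrightarrow> sat N e \<phi> \<and> sat N e \<psi>"
| "sat N e (Ex \<phi>) \<longleftrightarrow> (\<exists>u\<in>dom N. sat N (u # e) \<phi>)"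

definition is_model :: "('f, 'r) language \<Rightarrow> ('f, 'r) fm set \<Rightarrow> ('m, 'f, 'r) struct \<Rightarrow> bool" where
  "is_model L T N \<longleftrightarrow> is_struct L N \<and> (\<forall>\<phi>\<in>T. sat N [] \<phi>)"

text \<open>A complete theory is a satisfiable set of sentences that decides every sentence. By the
  downward Loewenheim-Skolem theorem, satisfiability and logical consequence over \<open>L\<close> can be
  tested on structures whose universe lies in the type of formulas, because that type is
  infinite and has at least as many elements as there are \<open>L\<close>-formulas.\<close>

definition complete_theory :: "('f, 'r) language \<Rightarrow> ('f, 'r) fm set \<Rightarrow> bool" where
  "complete_theory L T \<longleftrightarrow>
     (\<forall>\<phi>\<in>T. wf_fm L 0 \<phi>) \<and>
     (\<exists>N :: (('f, 'r) fm, 'f, 'r) struct. is_model L T N) \<and>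
     (\<forall>\<phi>. wf_fm L 0 \<phi> \<longrightarrow>
        (\<forall>N :: (('f, 'r) fm, 'f, 'r) struct. is_model L T N \<longrightarrow> sat N [] \<phi>) \<or>
        (\<forall>N :: (('f, 'r) fm, 'f, 'r) struct. is_model L T N \<longrightarrow> sat N [] (Neg \<phi>)))"


section \<open>Formulas with parameters and types\<close>

text \<open>A pair \<open>(\<phi>, c)\<close> in \<open>forms L A k\<close> is the formula \<open>\<phi>(x, c)\<close> over \<open>A\<close> in the \<open>k\<close>-tuple \<open>x\<close>:
  the variables \<open>0, \<dots>, k - 1\<close> are \<open>x\<close>, and the following ones are replaced by the entries of \<open>c\<close>.\<close>

definition forms :: "('f, 'r) language \<Rightarrow> 'm set \<Rightarrow> nat \<Rightarrow> (('f, 'r) fm \<times> 'm list) set" where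
  "forms L A k = {(\<phi>, c). set c \<subseteq> A \<and> wf_fm L (k + length c) \<phi>}"

definition holds :: "('m, 'f, 'r) struct \<Rightarrow> 'm list \<Rightarrow> ('f, 'r) fm \<times> 'm list \<Rightarrow> bool" where
  "holds N a F \<longleftrightarrow> sat N (a @ snd F) (fst F)"

definition realizes :: "('m, 'f, 'r) struct \<Rightarrow> 'm list \<Rightarrow> (('f, 'r) fm \<times> 'm list) set \<Rightarrow> bool" where
  "realizes N a \<Sigma> \<longleftrightarrow> (\<forall>F\<in>\<Sigma>. holds N a F)"

text \<open>Consistency with the elementary diagram of \<open>N\<close>, for formulas with parameters in \<open>N\<close>.\<close>

definition consistent :: "('m, 'f, 'r) struct \<Rightarrow> nat \<Rightarrow> (('f, 'r) fm \<times> 'm list) set \<Rightarrow> bool" where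
  "consistent N k \<Sigma> \<longleftrightarrow>
     (\<forall>\<Sigma>0 \<subseteq> \<Sigma>. finite \<Sigma>0 \<longrightarrow> (\<exists>a\<in>tuples (dom N) k. realizes N a \<Sigma>0))"

definition tp :: "('f, 'r) language \<Rightarrow> ('m, 'f, 'r) struct \<Rightarrow> 'm set \<Rightarrow> 'm list \<Rightarrow>
    (('f, 'r) fm \<times> 'm list) set" where
  "tp L N A a = {F \<in> forms L A (length a). holds N a F}"

definition global_type :: "('f, 'r) language \<Rightarrow> ('m, 'f, 'r) struct \<Rightarrow> nat \<Rightarrow>
    (('f, 'r) fm \<times> 'm list) set \<Rightarrow> bool" where
  "global_type L N k p \<longleftrightarrow>
     p \<subseteq> forms L (dom N) k \<and> consistent N k p \<and>
     (\<forall>(\<phi>, c) \<in> forms L (dom N) k. (\<phi>, c) \<in> p \<or> (Neg \<phi>, c) \<in> p)"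


section \<open>The monster model\<close>

definition saturated :: "('f, 'r) language \<Rightarrow> 'k rel \<Rightarrow> ('m, 'f, 'r) struct \<Rightarrow> bool" where
  "saturated L \<kappa> N \<longleftrightarrow>
     (\<forall>A \<subseteq> dom N. |A| <o \<kappa> \<longrightarrow>
        (\<forall>k. \<forall>\<Sigma> \<subseteq> forms L A k. consistent N k \<Sigma> \<longrightarrow>
           (\<exists>a\<in>tuples (dom N) k. realizes N a \<Sigma>)))"

definition partial_elementary :: "('f, 'r) language \<Rightarrow> ('m, 'f, 'r) struct \<Rightarrow> 'm set \<Rightarrow>
    ('m \<Rightarrow> 'm) \<Rightarrow> bool" where
  "partial_elementary L N A h \<longleftrightarrow>
     A \<subseteq> dom N \<and> h ` A \<subseteq> dom N \<and>
     (\<forall>n \<phi>. wf_fm L n \<phi> \<longrightarrow> (\<forall>e\<in>tuples A n. sat N e \<phi> \<longleftrightarrow> sat N (map h e) \<phi>))"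

definition automorphism :: "('f, 'r) language \<Rightarrow> ('m, 'f, 'r) struct \<Rightarrow> ('m \<Rightarrow> 'm) \<Rightarrow> bool" where
  "automorphism L N h \<longleftrightarrow>
     bij_betw h (dom N) (dom N) \<and>
     (\<forall>g\<in>funs L. \<forall>e\<in>tuples (dom N) (farity L g). h (fn N g e) = fn N g (map h e)) \<and>
     (\<forall>P\<in>rels L. \<forall>e\<in>tuples (dom N) (rarity L P). rel N P e \<longleftrightarrow> rel N P (map h e))"

definition strongly_homogeneous :: "('f, 'r) language \<Rightarrow> 'k rel \<Rightarrow> ('m, 'f, 'r) struct \<Rightarrow> bool" where
  "strongly_homogeneous L \<kappa> N \<longleftrightarrow>
     (\<forall>A h. partial_elementary L N A h \<and> |A| <o \<kappa> \<longrightarrow>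
        (\<exists>h'. automorphism L N h' \<and> (\<forall>u\<in>A. h' u = h u)))"

text \<open>A monster model is \<open>\<kappa>\<close>-saturated and strongly \<open>\<kappa>\<close>-homogeneous for a cardinal \<open>\<kappa>\<close> that is
  large with respect to \<open>L\<close>, namely greater than 2 to the power \<open>|L| + \<aleph>\<^sub>0\<close>; small means of
  cardinality less than \<open>\<kappa>\<close>.\<close>

definition monster :: "('f, 'r) language \<Rightarrow> ('f, 'r) fm set \<Rightarrow> 'k rel \<Rightarrow>
    ('m, 'f, 'r) struct \<Rightarrow> bool" where
  "monster L T \<kappa> N \<longleftrightarrow>
     is_model L T N \<and> Card_order \<kappa> \<and> |Pow {\<phi>. \<exists>n. wf_fm L n \<phi>}| <o \<kappa> \<and>
     saturated L \<kappa> N \<and> strongly_homogeneous L \<kappa> N"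

definition elementary_submodel :: "('f, 'r) language \<Rightarrow> ('m, 'f, 'r) struct \<Rightarrow> 'm set \<Rightarrow> bool" where
  "elementary_submodel L N M \<longleftrightarrow>
     M \<subseteq> dom N \<and> is_struct L (N\<lparr>dom := M\<rparr>) \<and>
     (\<forall>n \<phi>. wf_fm L n \<phi> \<longrightarrow> (\<forall>e\<in>tuples M n. sat (N\<lparr>dom := M\<rparr>) e \<phi> \<longleftrightarrow> sat N e \<phi>))"


section \<open>Conant-independence\<close>

text \<open>From here on \<open>N\<close> is meant to be a monster model and \<open>M\<close> a small model.\<close>

definition invariant_type :: "('f, 'r) language \<Rightarrow> ('m, 'f, 'r) struct \<Rightarrow> 'm set \<Rightarrow> nat \<Rightarrow>
    (('f, 'r) fm \<times> 'm list) set \<Rightarrow> bool" where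
  "invariant_type L N M k p \<longleftrightarrow>
     global_type L N k p \<and>
     (\<forall>\<phi> b b'. set b \<subseteq> dom N \<and> set b' \<subseteq> dom N \<and> length b = length b' \<and>
        tp L N M b = tp L N M b' \<longrightarrow> ((\<phi>, b) \<in> p \<longleftrightarrow> (\<phi>, b') \<in> p))"

text \<open>Every \<open>s i\<close> realizes the restriction of \<open>p\<close> to \<open>M\<close> together with the earlier \<open>s j\<close>.\<close>

definition morley_sequence :: "('f, 'r) language \<Rightarrow> ('m, 'f, 'r) struct \<Rightarrow> 'm set \<Rightarrow> nat \<Rightarrow>
    (('f, 'r) fm \<times> 'm list) set \<Rightarrow> (nat \<Rightarrow> 'm list) \<Rightarrow> bool" where
  "morley_sequence L N M k p s \<longleftrightarrow>
     (\<forall>i. s i \<in> tuples (dom N) k \<and>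
          realizes N (s i) (p \<inter> forms L (M \<union> (\<Union>j<i. set (s j))) k))"

text \<open>In the following two definitions \<open>k\<close> is the length of the tuple \<open>x\<close> in \<open>\<phi>(x, b)\<close>.\<close>

definition conant_divides :: "('f, 'r) language \<Rightarrow> ('m, 'f, 'r) struct \<Rightarrow> 'm set \<Rightarrow> nat \<Rightarrow>
    ('f, 'r) fm \<times> 'm list \<Rightarrow> bool" where
  "conant_divides L N M k F \<longleftrightarrow> F \<in> forms L (dom N) k \<and>
     (\<forall>p s. invariant_type L N M (length (snd F)) p \<and>
            morley_sequence L N M (length (snd F)) p s \<and> s 0 = snd F \<longrightarrow>
        \<not> consistent N k {(fst F, s i) | i. True})"

definition conant_forks :: "('f, 'r) language \<Rightarrow> ('m, 'f, 'r) struct \<Rightarrow> 'm set \<Rightarrow> nat \<Rightarrow>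
    ('f, 'r) fm \<times> 'm list \<Rightarrow> bool" where
  "conant_forks L N M k F \<longleftrightarrow> F \<in> forms L (dom N) k \<and>
     (\<exists>D. finite D \<and> (\<forall>G\<in>D. conant_divides L N M k G) \<and>
        (\<forall>a\<in>tuples (dom N) k. holds N a F \<longrightarrow> (\<exists>G\<in>D. holds N a G)))"

text \<open>The sets \<open>A\<close> and \<open>B\<close> may be infinite; a formula in the type of \<open>A\<close> over \<open>M \<union> B\<close> only
  involves a finite tuple from \<open>A\<close>.\<close>

definition conant_indep :: "('f, 'r) language \<Rightarrow> ('m, 'f, 'r) struct \<Rightarrow> 'm set \<Rightarrow> 'm set \<Rightarrow>
    'm set \<Rightarrow> bool" where
  "conant_indep L N M A B \<longleftrightarrow>
     (\<forall>a\<in>lists A. \<forall>F \<in> tp L N (M \<union> B) a. \<not> conant_forks L N M (length a) F)"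

definition conant_symmetric :: "('f, 'r) language \<Rightarrow> 'k rel \<Rightarrow> ('m, 'f, 'r) struct \<Rightarrow> bool" where
  "conant_symmetric L \<kappa> N \<longleftrightarrow>
     (\<forall>M A B. elementary_submodel L N M \<and> |M| <o \<kappa> \<and>
        A \<subseteq> dom N \<and> |A| <o \<kappa> \<and> B \<subseteq> dom N \<and> |B| <o \<kappa> \<longrightarrow>
        (conant_indep L N M A B \<longleftrightarrow> conant_indep L N M B A))"


section \<open>Strong order properties\<close>

text \<open>Only meant for \<open>n \<ge> 3\<close>. The relation \<open>R\<close> on \<open>k\<close>-tuples is definable with parameters \<open>c\<close>;
  the entries of an \<open>n\<close>-cycle need not be distinct.\<close>

definition SOP :: "('f, 'r) language \<Rightarrow> ('m, 'f, 'r) struct \<Rightarrow> nat \<Rightarrow> bool" where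
  "SOP L N n \<longleftrightarrow>
     (\<exists>k \<phi> c R. wf_fm L (k + k + length c) \<phi> \<and> set c \<subseteq> dom N \<and>
        R = (\<lambda>x y. sat N (x @ y @ c) \<phi>) \<and>
        \<not> (\<exists>x :: nat \<Rightarrow> 'm list. \<forall>i<n. x i \<in> tuples (dom N) k \<and> R (x i) (x (Suc i mod n))) \<and>
        (\<exists>a :: nat \<Rightarrow> 'm list. (\<forall>i. a i \<in> tuples (dom N) k) \<and> (\<forall>i j. i < j \<longrightarrow> R (a i) (a j))))"

abbreviation NSOP :: "('f, 'r) language \<Rightarrow> ('m, 'f, 'r) struct \<Rightarrow> nat \<Rightarrow> bool" where
  "NSOP L N n \<equiv> \<not> SOP L N n"

text \<open>Since \<open>SOP\<close> is used from 3 on, the strict notion starts at \<open>n = 4\<close>.\<close>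

definition strictly_NSOP :: "('f, 'r) language \<Rightarrow> ('m, 'f, 'r) struct \<Rightarrow> nat \<Rightarrow> bool" where
  "strictly_NSOP L N n \<longleftrightarrow> n \<ge> 4 \<and> NSOP L N n \<and> SOP L N (n - 1)"

end

(*
  Let R witness SOP_4 through a chain (a_i). Taking a coheir p over an ultrafilter limit of the a_i
  and realizing it repeatedly in an increasing chain of small sets gives a model M and c_i in M with
  a_i -> u -> c_j for every u |= p|M, such that both the a_i and the c_i approximate p|M. Let
  (e, e') realize a limit of the pairs (a_i, c_i) over M. Every invariant type around (e, e') that
  is a limit of such pairs has Morley sequences (e_n, e'_n) with a common solution of
  b0 -> e_n -> b1 -> e'_n -> b2, namely (a_i, u, c_j). So some such b0, b1, b2 realizing p|M are
  Conant-independent from (e, e'), and by symmetry (e, e') is Conant-independent from (b0, b1, b2).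
  This gives an invariant type r and a Morley sequence (b0^n, b1^n, b2^n) in r with a common
  solution (e, e'). Then b0^0 -> e -> b1^1; since r is invariant and b0^0, b2^0 have the same type
  over M, also b2^0 -> x -> b1^1 for some x; together with b1^1 -> e' -> b2^0 this is a 4-cycle.

  SOP_m implies SOP_4 for m >= 4, so only a theory with SOP_3 is missing. The generic digraph
  without directed triangles is one. Its monster model, of size 2^c with c the continuum, is built in
  c^+ stages, each of which extends every current partial isomorphism by free amalgamation.
  There A is Conant-independent from B over M iff A and B meet only in M: the Morley sequence
  of pairwise free copies of a tuple shows that no other formula Conant-divides.
*)

theory Submission
  imports Defs "HOL-Library.Countable" "HOL-Library.Infinite_Set"
begin

section \<open>Ultrafilters\<close>

text \<open>Conant-dividing quantifies over all invariant Morley sequences, so a single sequence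
  with a common solution refutes it. Before symmetry is applied this sequence can be chosen;
  afterwards nothing is known about the invariant type except its invariance over \<open>M\<close>.
  This dictates the configuration: the ends \<open>b0\<close> and \<open>b2\<close> of the path need
  the same type over \<open>M\<close>, so that the unknown type cannot tell them apart. Hence the
  \<open>a i\<close> and the \<open>c j\<close> have to approximate one type, although the
  \<open>c j\<close> run backwards. Moreover, independence means avoiding finite disjunctions of
  Conant-dividing formulas, whose parameters are arbitrary; they are therefore carried along in the
  Morley sequence. In the example, the definition of a monster asks for more than continuum many
  elements, so \<open>\<kappa>\<close> is the successor of the continuum: small means of size at
  most continuum, and by regularity every small set lies in one stage. Saturation is not built in.
  It follows from homogeneity and from a first stage that contains every triangle-free digraph on a
  set of size continuum.\<close>

definition ultrafilter :: "'a set set \<Rightarrow> bool" where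
  "ultrafilter W \<longleftrightarrow> {} \<notin> W \<and> (\<forall>A B. A \<in> W \<and> A \<subseteq> B \<longrightarrow> B \<in> W) \<and>
     (\<forall>A\<in>W. \<forall>B\<in>W. A \<inter> B \<in> W) \<and> (\<forall>A. A \<in> W \<or> - A \<in> W)"

lemma ultrafilterD:
  assumes "ultrafilter W"
  shows "{} \<notin> W" "\<And>A B. A \<in> W \<Longrightarrow> A \<subseteq> B \<Longrightarrow> B \<in> W"
    "\<And>A B. A \<in> W \<Longrightarrow> B \<in> W \<Longrightarrow> A \<inter> B \<in> W" "\<And>A. A \<in> W \<or> - A \<in> W" "UNIV \<in> W"
  using assms unfolding ultrafilter_def
  by (blast, blast, blast, blast, metis Compl_empty_eq)

lemma ultrafilter_Inter:
  assumes "ultrafilter W" "finite \<F>" "\<F> \<subseteq> W"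
  shows "\<Inter>\<F> \<in> W"
  using assms(2,3)
  by (induction) (auto simp: ultrafilterD[OF assms(1)])

lemma ultrafilter_ball:
  assumes "ultrafilter W" "finite I" "\<And>i. i \<in> I \<Longrightarrow> {t. P i t} \<in> W"
  shows "{t. \<forall>i\<in>I. P i t} \<in> W"
proof -
  have "\<Inter>((\<lambda>i. {t. P i t}) ` I) \<in> W"
    using assms by (intro ultrafilter_Inter) auto
  moreover have "\<Inter>((\<lambda>i. {t. P i t}) ` I) = {t. \<forall>i\<in>I. P i t}" by auto
  ultimately show ?thesis by simp
qed

lemma ultrafilter_nonempty: "ultrafilter W \<Longrightarrow> A \<in> W \<Longrightarrow> A \<noteq> {}"
  using ultrafilterD(1) by blast

lemma ultrafilter_Compl: "ultrafilter W \<Longrightarrow> - A \<in> W \<longleftrightarrow> A \<notin> W"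
  using ultrafilterD(3)[of W A "-A"] ultrafilterD(1,4)[of W] by auto

text \<open>Zorn's lemma is applied to families with the finite intersection property instead of
  filters: chains of such families have good unions at once, and maximality alone makes the family
  an ultrafilter.\<close>

lemma ultrafilter_extend:
  assumes fip: "\<And>\<F>. finite \<F> \<Longrightarrow> \<F> \<subseteq> \<B> \<Longrightarrow> \<Inter>\<F> \<noteq> {}"
  shows "\<exists>W. ultrafilter W \<and> \<B> \<subseteq> W"
proof -
  define fp where "fp = (\<lambda>\<C> :: 'a set set. \<forall>\<F>. finite \<F> \<longrightarrow> \<F> \<subseteq> \<C> \<longrightarrow> \<Inter>\<F> \<noteq> {})"
  let ?A = "{\<C>. \<B> \<subseteq> \<C> \<and> fp \<C>}"
  have "\<exists>M\<in>?A. \<forall>X\<in>?A. M \<subseteq> X \<longrightarrow> X = M"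
  proof (rule subset_Zorn_nonempty)
    show "?A \<noteq> {}" using fip by (auto simp: fp_def)
    fix \<C> assume ne: "\<C> \<noteq> {}" and ch: "subset.chain ?A \<C>"
    have "fp (\<Union>\<C>)" unfolding fp_def
    proof (intro allI impI)
      fix \<F> assume "finite \<F>" "\<F> \<subseteq> \<Union>\<C>"
      then obtain c where "c \<in> \<C>" "\<F> \<subseteq> c"
        using finite_subset_Union_chain[OF _ _ ne ch] by blast
      moreover from this have "fp c" using ch by (auto simp: subset.chain_def)
      ultimately show "\<Inter>\<F> \<noteq> {}" using \<open>finite \<F>\<close> by (auto simp: fp_def)
    qed
    moreover have "\<B> \<subseteq> \<Union>\<C>" using ne ch unfolding subset.chain_def by blast
    ultimately show "\<Union>\<C> \<in> ?A" by simp
  qed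
  then obtain W where W: "\<B> \<subseteq> W" "fp W" and max: "\<And>X. \<B> \<subseteq> X \<Longrightarrow> fp X \<Longrightarrow> W \<subseteq> X \<Longrightarrow> X = W"
    by auto
  \<comment> \<open>A set that cannot be added misses a finite intersection of members. Upward
    closure, closure under intersection and the dichotomy are all derived from this.\<close>
  have key: "\<exists>\<F>. finite \<F> \<and> \<F> \<subseteq> W \<and> \<Inter>\<F> \<inter> A = {}" if "A \<notin> W" for A
  proof (rule ccontr)
    assume no: "\<not> ?thesis"
    have "fp (insert A W)" unfolding fp_def
    proof (intro allI impI)
      fix \<F> assume "finite \<F>" "\<F> \<subseteq> insert A W"
      then have "finite (\<F> - {A})" "\<F> - {A} \<subseteq> W" by auto
      then have "\<Inter>(\<F> - {A}) \<inter> A \<noteq> {}" using no by metis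
      moreover have "\<Inter>(\<F> - {A}) \<inter> A \<subseteq> \<Inter>\<F>" by auto
      ultimately show "\<Inter>\<F> \<noteq> {}" by (metis subset_empty)
    qed
    then have "insert A W = W" using max W(1) by blast
    then show False using that by blast
  qed
  have fpW: "\<Inter>\<F> \<noteq> {}" if "finite \<F>" "\<F> \<subseteq> W" for \<F> using W(2) that by (simp add: fp_def)
  have 1: "{} \<notin> W" using fpW[of "{{}}"] by auto
  have 2: "B \<in> W" if "A \<in> W" "A \<subseteq> B" for A B
  proof (rule ccontr)
    assume "B \<notin> W"
    from key[OF this] obtain \<F> where F: "finite \<F>" "\<F> \<subseteq> W" "\<Inter>\<F> \<inter> B = {}" by (elim exE conjE)
    have "\<Inter>(insert A \<F>) \<subseteq> \<Inter>\<F> \<inter> B" using that by auto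
    then have "\<Inter>(insert A \<F>) = {}" using F(3) by simp
    then show False using fpW[of "insert A \<F>"] F that by simp
  qed
  have 3: "A \<inter> B \<in> W" if "A \<in> W" "B \<in> W" for A B
  proof (rule ccontr)
    assume "A \<inter> B \<notin> W"
    from key[OF this] obtain \<F> where F: "finite \<F>" "\<F> \<subseteq> W" "\<Inter>\<F> \<inter> (A \<inter> B) = {}" by (elim exE conjE)
    have "\<Inter>(insert A (insert B \<F>)) \<subseteq> \<Inter>\<F> \<inter> (A \<inter> B)" by auto
    then have "\<Inter>(insert A (insert B \<F>)) = {}" using F(3) by simp
    then show False using fpW[of "insert A (insert B \<F>)"] F that by simp
  qed
  have 4: "A \<in> W \<or> - A \<in> W" for A
  proof (rule ccontr)
    assume "\<not> ?thesis"
    then have "A \<notin> W" "- A \<notin> W" by auto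
    from key[OF this(1)] key[OF this(2)]
    obtain \<F> \<G> where F: "finite \<F>" "\<F> \<subseteq> W" "\<Inter>\<F> \<inter> A = {}"
      "finite \<G>" "\<G> \<subseteq> W" "\<Inter>\<G> \<inter> - A = {}" by (elim exE conjE)
    have "\<Inter>(\<F> \<union> \<G>) \<subseteq> (\<Inter>\<F> \<inter> A) \<union> (\<Inter>\<G> \<inter> - A)" by auto
    then have "\<Inter>(\<F> \<union> \<G>) = {}" using F(3,6) by simp
    then show False using fpW[of "\<F> \<union> \<G>"] F by simp
  qed
  have "ultrafilter W" unfolding ultrafilter_def using 1 2 3 4 by blast
  then show ?thesis using W(1) by blast
qed

lemma ultrafilter_image:
  assumes "ultrafilter W"
  shows "ultrafilter {B. f -` B \<in> W}"
  unfolding ultrafilter_def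
proof (intro conjI allI ballI impI)
  show "{} \<notin> {B. f -` B \<in> W}" using ultrafilterD(1)[OF assms] by simp
  fix A B
  show "A \<in> {B. f -` B \<in> W} \<and> A \<subseteq> B \<Longrightarrow> B \<in> {B. f -` B \<in> W}"
    using ultrafilterD(2)[OF assms, of "f -` A" "f -` B"] by auto
next
  fix A B assume "A \<in> {B. f -` B \<in> W}" "B \<in> {B. f -` B \<in> W}"
  then show "A \<inter> B \<in> {B. f -` B \<in> W}"
    using ultrafilterD(3)[OF assms, of "f -` A" "f -` B"] by simp
next
  fix A show "A \<in> {B. f -` B \<in> W} \<or> - A \<in> {B. f -` B \<in> W}"
    using ultrafilterD(4)[OF assms, of "f -` A"] by (simp add: vimage_Compl)
qed

lemma nonprincipal_ultrafilter:
  "\<exists>U :: nat set set. ultrafilter U \<and> (\<forall>n. {n<..} \<in> U)"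
proof -
  have "\<Inter>\<F> \<noteq> {}" if "finite \<F>" "\<F> \<subseteq> range (\<lambda>n::nat. {n<..})" for \<F>
  proof -
    from that obtain I where I: "finite I" "\<F> = (\<lambda>n::nat. {n<..}) ` I"
      by (elim finite_subset_image[THEN exE]) blast+
    have "Suc (Max (insert 0 I)) \<in> \<Inter>\<F>"
      using I by (auto simp: less_Suc_eq_le)
    then show ?thesis by blast
  qed
  from ultrafilter_extend[of "range (\<lambda>n::nat. {n<..})", OF this] show ?thesis by auto
qed


section \<open>Renaming of variables\<close>

lemma tuples_app: "a \<in> tuples A m \<Longrightarrow> b \<in> tuples A n \<Longrightarrow> a @ b \<in> tuples A (m + n)"
  by (auto simp: tuples_def)

lemma tuples_split:
  assumes "t \<in> tuples A (m + n)"
  obtains a b where "t = a @ b" "a \<in> tuples A m" "b \<in> tuples A n"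
proof
  show "t = take m t @ drop m t" by simp
  show "take m t \<in> tuples A m" using assms by (auto simp: tuples_def dest: in_set_takeD)
  show "drop m t \<in> tuples A n" using assms by (auto simp: tuples_def dest: in_set_dropD)
qed

fun lift :: "(nat \<Rightarrow> nat) \<Rightarrow> nat \<Rightarrow> nat" where
  "lift f 0 = 0"
| "lift f (Suc i) = Suc (f i)"

primrec rent :: "(nat \<Rightarrow> nat) \<Rightarrow> 'f tm \<Rightarrow> 'f tm" where
  "rent f (Var i) = Var (f i)"
| "rent f (Fn g ts) = Fn g (map (rent f) ts)"

primrec ren :: "(nat \<Rightarrow> nat) \<Rightarrow> ('f, 'r) fm \<Rightarrow> ('f, 'r) fm" where
  "ren f (Eq s t) = Eq (rent f s) (rent f t)"
| "ren f (Rel P ts) = Rel P (map (rent f) ts)"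
| "ren f (Neg \<phi>) = Neg (ren f \<phi>)"
| "ren f (Conj \<phi> \<psi>) = Conj (ren f \<phi>) (ren f \<psi>)"
| "ren f (Ex \<phi>) = Ex (ren (lift f) \<phi>)"

lemma wf_rent: "wf_tm L m t \<Longrightarrow> \<forall>i<m. f i < n \<Longrightarrow> wf_tm L n (rent f t)"
  by (induction t) auto

lemma val_rent: "wf_tm L m t \<Longrightarrow> \<forall>i<m. e ! f i = e' ! i \<Longrightarrow> val N e (rent f t) = val N e' t"
proof (induction t)
  case (Fn g ts)
  then have "map (\<lambda>t. val N e (rent f t)) ts = map (val N e') ts" by (intro map_cong) auto
  then show ?case by (simp only: rent.simps val.simps map_map comp_def)
qed auto

lemma wf_ren: "wf_fm L m \<phi> \<Longrightarrow> \<forall>i<m. f i < n \<Longrightarrow> wf_fm L n (ren f \<phi>)"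
proof (induction \<phi> arbitrary: m n f)
  case (Ex \<phi>)
  have "\<forall>i<Suc m. lift f i < Suc n"
  proof (intro allI impI)
    fix i assume "i < Suc m" then show "lift f i < Suc n" using Ex.prems(2) by (cases i) auto
  qed
  then show ?case using Ex.IH[of "Suc m" "lift f" "Suc n"] Ex.prems by auto
qed (auto simp: wf_rent)

text \<open>The renaming need be neither injective nor monotone, so this covers permuting, repeating
  and dropping entries of an assignment.\<close>

lemma sat_ren:
  "wf_fm L m \<phi> \<Longrightarrow> \<forall>i<m. e ! f i = e' ! i \<Longrightarrow> sat N e (ren f \<phi>) = sat N e' \<phi>"
proof (induction \<phi> arbitrary: m f e e')
  case (Rel P ts)
  then have "map (\<lambda>t. val N e (rent f t)) ts = map (val N e') ts"
    by (intro map_cong) (auto simp: val_rent)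
  then show ?case by (simp only: ren.simps sat.simps map_map comp_def)
next
  case (Ex \<phi>)
  have "sat N (u # e) (ren (lift f) \<phi>) = sat N (u # e') \<phi>" for u
  proof (rule Ex.IH)
    show "wf_fm L (Suc m) \<phi>" using Ex.prems by simp
    show "\<forall>i<Suc m. (u # e) ! lift f i = (u # e') ! i"
    proof (intro allI impI)
      fix i assume "i < Suc m" then show "(u # e) ! lift f i = (u # e') ! i" using Ex.prems(2) by (cases i) auto
    qed
  qed
  then show ?case by simp
next
  case (Conj \<phi> \<psi>)
  then show ?case using Conj.IH(1)[of m e f e'] Conj.IH(2)[of m e f e'] by simp
next
  case (Eq s t)
  then show ?case by (simp add: val_rent[of L m _ e f e'])
next
  case (Neg \<phi>)
  then show ?case using Neg.IH[of m e f e'] by simp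
qed

lemma Ex_power:
  shows "wf_fm L (l + n) \<phi> \<Longrightarrow> wf_fm L n ((Ex ^^ l) \<phi>)"
    and "sat N e ((Ex ^^ l) \<phi>) \<longleftrightarrow> (\<exists>z\<in>tuples (dom N) l. sat N (z @ e) \<phi>)"
proof -
  show "wf_fm L (l + n) \<phi> \<Longrightarrow> wf_fm L n ((Ex ^^ l) \<phi>)"
    by (induction l arbitrary: n) auto
  show "sat N e ((Ex ^^ l) \<phi>) \<longleftrightarrow> (\<exists>z\<in>tuples (dom N) l. sat N (z @ e) \<phi>)"
  proof (induction l arbitrary: e)
    case 0 then show ?case by (auto simp: tuples_def)
  next
    case (Suc l)
    \<comment> \<open>The outermost quantifier supplies the last entry of the block, because inner
      quantifiers put their values in front.\<close>
    have "sat N e ((Ex ^^ Suc l) \<phi>) \<longleftrightarrow> (\<exists>u\<in>dom N. \<exists>z\<in>tuples (dom N) l. sat N ((z @ [u]) @ e) \<phi>)"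
      using Suc by simp
    also have "\<dots> \<longleftrightarrow> (\<exists>z\<in>tuples (dom N) (Suc l). sat N (z @ e) \<phi>)"
    proof
      assume "\<exists>u\<in>dom N. \<exists>z\<in>tuples (dom N) l. sat N ((z @ [u]) @ e) \<phi>"
      then obtain u z where "u \<in> dom N" "z \<in> tuples (dom N) l" "sat N ((z @ [u]) @ e) \<phi>" by blast
      moreover from this have "z @ [u] \<in> tuples (dom N) (Suc l)" by (auto simp: tuples_def)
      ultimately show "\<exists>z\<in>tuples (dom N) (Suc l). sat N (z @ e) \<phi>" by blast
    next
      assume "\<exists>z\<in>tuples (dom N) (Suc l). sat N (z @ e) \<phi>"
      then obtain z where z: "z \<in> tuples (dom N) (Suc l)" "sat N (z @ e) \<phi>" by blast
      then have "z \<noteq> []" by (auto simp: tuples_def)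
      then obtain z' u where "z = z' @ [u]" by (metis append_butlast_last_id)
      then show "\<exists>u\<in>dom N. \<exists>z\<in>tuples (dom N) l. sat N ((z @ [u]) @ e) \<phi>"
        using z by (intro bexI[of _ u] bexI[of _ z']) (auto simp: tuples_def)
    qed
    finally show ?case .
  qed
qed


section \<open>Formulas with parameters\<close>

lemma forms_mono: "A \<subseteq> B \<Longrightarrow> forms L A k \<subseteq> forms L B k"
  by (auto simp: forms_def)

text \<open>The substitution of variable \<open>ix ! i\<close> for variable \<open>i\<close>; the
  places of the parameters move from \<open>length ix\<close> to \<open>m\<close>. It turns a
  formula about a subtuple into one about the whole tuple.\<close>

definition reindex :: "nat list \<Rightarrow> nat \<Rightarrow> ('f, 'r) fm \<Rightarrow> ('f, 'r) fm" where
  "reindex ix m = ren (\<lambda>i. if i < length ix then ix ! i else m + (i - length ix))"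

lemma reindex_forms:
  assumes "(\<phi>, c) \<in> forms L A (length ix)" "set ix \<subseteq> {..<m}"
  shows "(reindex ix m \<phi>, c) \<in> forms L A m"
    and "length t = m \<Longrightarrow> holds N t (reindex ix m \<phi>, c) = holds N (map ((!) t) ix) (\<phi>, c)"
proof -
  let ?f = "\<lambda>i. if i < length ix then ix ! i else m + (i - length ix)"
  have wf: "wf_fm L (length ix + length c) \<phi>" using assms by (auto simp: forms_def)
  have lt: "ix ! i < m" if "i < length ix" for i using assms(2) that nth_mem[of i ix] by blast
  have "?f i < m + length c" if "i < length ix + length c" for i
    using lt[of i] that by (cases "i < length ix") (simp_all add: less_diff_conv2)
  then have "wf_fm L (m + length c) (ren ?f \<phi>)" by (intro wf_ren[OF wf]) simp
  then show "(reindex ix m \<phi>, c) \<in> forms L A m" using assms by (auto simp: forms_def reindex_def)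
  have "sat N (t @ c) (ren ?f \<phi>) = sat N (map ((!) t) ix @ c) \<phi>" if "length t = m"
    by (rule sat_ren[OF wf]) (use that lt assms in \<open>auto simp: nth_append\<close>)
  then show "length t = m \<Longrightarrow> holds N t (reindex ix m \<phi>, c) = holds N (map ((!) t) ix) (\<phi>, c)"
    by (simp add: holds_def reindex_def)
qed

lemma ren_list:
  assumes "wf_fm L (length pos) \<phi>"
  shows "set pos \<subseteq> {..<n} \<Longrightarrow> wf_fm L n (ren ((!) pos) \<phi>)"
    and "sat N e (ren ((!) pos) \<phi>) = sat N (map ((!) e) pos) \<phi>"
proof -
  show "wf_fm L n (ren ((!) pos) \<phi>)" if "set pos \<subseteq> {..<n}"
    by (rule wf_ren[OF assms]) (use that nth_mem in blast)
  show "sat N e (ren ((!) pos) \<phi>) = sat N (map ((!) e) pos) \<phi>"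
    by (rule sat_ren[OF assms]) simp
qed

lemma forms_true:
  assumes "dom N \<noteq> {}"
  shows "\<exists>\<phi>. (\<phi>, []) \<in> forms L A m \<and> (\<forall>t. holds N t (\<phi>, []))"
  using assms by (intro exI[of _ "Ex (Eq (Var 0) (Var 0))"]) (auto simp: forms_def holds_def)

lemma forms_Neg:
  "(\<phi>, c) \<in> forms L A m \<Longrightarrow> (Neg \<phi>, c) \<in> forms L A m"
  "holds N t (Neg \<phi>, c) \<longleftrightarrow> \<not> holds N t (\<phi>, c)"
  by (auto simp: forms_def holds_def)

lemma forms_conj:
  assumes "F \<in> forms L A m" "G \<in> forms L A m"
  shows "\<exists>H\<in>forms L A m. \<forall>t. length t = m \<longrightarrow> holds N t H \<longleftrightarrow> holds N t F \<and> holds N t G"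
proof -
  obtain \<phi> c \<psi> d where FG: "F = (\<phi>, c)" "G = (\<psi>, d)" by (metis surj_pair)
  have wf: "wf_fm L (m + length c) \<phi>" "wf_fm L (m + length d) \<psi>" and ss: "set c \<subseteq> A" "set d \<subseteq> A"
    using assms FG by (auto simp: forms_def)
  \<comment> \<open>In the joint parameter list \<open>c @ d\<close> the entries of \<open>d\<close>
    start \<open>length c\<close> places later.\<close>
  let ?f = "\<lambda>i. if i < m then i else i + length c"
  have w1: "wf_fm L (m + length (c @ d)) (ren id \<phi>)" by (rule wf_ren[OF wf(1)]) auto
  have w2: "wf_fm L (m + length (c @ d)) (ren ?f \<psi>)" by (rule wf_ren[OF wf(2)]) auto
  have "sat N (t @ c @ d) (ren id \<phi>) = sat N (t @ c) \<phi>" if "length t = m" for t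
    by (rule sat_ren[OF wf(1)]) (use that in \<open>auto simp: nth_append\<close>)
  moreover have "sat N (t @ c @ d) (ren ?f \<psi>) = sat N (t @ d) \<psi>" if "length t = m" for t
    by (rule sat_ren[OF wf(2)]) (use that in \<open>auto simp: nth_append\<close>)
  ultimately show ?thesis
    using w1 w2 ss FG by (intro bexI[of _ "(Conj (ren id \<phi>) (ren ?f \<psi>), c @ d)"]) (auto simp: forms_def holds_def)
qed

lemma forms_Conj:
  assumes "finite \<F>" "\<F> \<subseteq> forms L A m" "dom N \<noteq> {}"
  shows "\<exists>H\<in>forms L A m. \<forall>t. length t = m \<longrightarrow> holds N t H \<longleftrightarrow> (\<forall>F\<in>\<F>. holds N t F)"
  using assms(1,2)
proof (induction)
  case empty
  then show ?case using forms_true[OF assms(3), of L A m] by auto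
next
  case (insert F \<F>)
  then obtain H where "H \<in> forms L A m" "\<forall>t. length t = m \<longrightarrow> holds N t H \<longleftrightarrow> (\<forall>F\<in>\<F>. holds N t F)"
    by auto
  then show ?case using forms_conj[of F L A m H N] insert.prems by auto
qed

lemma elementary_submodel_sat:
  assumes "elementary_submodel L N M" "wf_fm L n \<phi>" "e \<in> tuples M n"
  shows "sat (N\<lparr>dom := M\<rparr>) e \<phi> \<longleftrightarrow> sat N e \<phi>"
  using assms by (auto simp: elementary_submodel_def)

text \<open>Once the whole tuple is quantified out, only the parameters from \<open>M\<close> are
  left in the assignment, and elementarity applies.\<close>

lemma elementary_ex:
  assumes M: "elementary_submodel L N M" and F: "F \<in> forms L M m" and t: "t \<in> tuples (dom N) m" "holds N t F"
  shows "\<exists>t\<in>tuples M m. holds N t F"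
proof -
  obtain \<phi> c where Fc: "F = (\<phi>, c)" by (metis surj_pair)
  have wf: "wf_fm L (m + length c) \<phi>" and ss: "c \<in> tuples M (length c)" using F Fc by (auto simp: forms_def tuples_def)
  have "sat N c ((Ex ^^ m) \<phi>)" using t Fc by (auto simp: Ex_power holds_def)
  then have "sat (N\<lparr>dom := M\<rparr>) c ((Ex ^^ m) \<phi>)"
    using elementary_submodel_sat[OF M Ex_power(1)[OF wf] ss] by simp
  then obtain z where z: "z \<in> tuples M m" "sat (N\<lparr>dom := M\<rparr>) (z @ c) \<phi>" by (auto simp: Ex_power)
  then have "sat N (z @ c) \<phi>" using elementary_submodel_sat[OF M wf tuples_app[OF z(1) ss]] by simp
  then show ?thesis using z Fc by (auto simp: holds_def)
qed


section \<open>Automorphisms and types\<close>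

lemma automorphism_val:
  assumes "is_struct L N" "automorphism L N \<sigma>" "wf_tm L n t" "e \<in> tuples (dom N) n"
  shows "val N e t \<in> dom N \<and> val N (map \<sigma> e) t = \<sigma> (val N e t)"
  using assms(3)
proof (induction t)
  case (Var i)
  then show ?case using assms(4) by (auto simp: tuples_def)
next
  case (Fn g ts)
  let ?a = "map (val N e) ts"
  have a: "?a \<in> tuples (dom N) (farity L g)" using Fn by (auto simp: tuples_def)
  have "map (val N (map \<sigma> e)) ts = map \<sigma> ?a" using Fn by auto
  moreover have "fn N g ?a \<in> dom N" "\<sigma> (fn N g ?a) = fn N g (map \<sigma> ?a)"
    using a Fn.prems assms(1,2) by (auto simp: automorphism_def is_struct_def)
  ultimately show ?case by (simp only: val.simps)
qed

lemma automorphism_sat: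
  assumes "is_struct L N" "automorphism L N \<sigma>" "wf_fm L n \<phi>" "e \<in> tuples (dom N) n"
  shows "sat N (map \<sigma> e) \<phi> = sat N e \<phi>"
  using assms(3,4)
proof (induction \<phi> arbitrary: n e)
  case (Eq s t)
  have "inj_on \<sigma> (dom N)" using assms(2) by (auto simp: automorphism_def bij_betw_def)
  then show ?case using Eq automorphism_val[OF assms(1,2)] by (metis inj_onD sat.simps(1) wf_fm.simps(1))
next
  case (Rel P ts)
  let ?a = "map (val N e) ts"
  have v: "val N e t \<in> dom N \<and> val N (map \<sigma> e) t = \<sigma> (val N e t)" if "t \<in> set ts" for t
    using Rel that automorphism_val[OF assms(1,2)] by auto
  then have a: "?a \<in> tuples (dom N) (rarity L P)" using Rel by (auto simp: tuples_def)
  have "map (val N (map \<sigma> e)) ts = map \<sigma> ?a" using v by auto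
  moreover have "rel N P ?a = rel N P (map \<sigma> ?a)" using a Rel.prems assms(2) by (auto simp: automorphism_def)
  ultimately show ?case by (simp only: sat.simps)
next
  case (Ex \<phi>)
  have bij: "\<sigma> ` dom N = dom N" using assms(2) by (auto simp: automorphism_def bij_betw_def)
  have *: "sat N (\<sigma> u # map \<sigma> e) \<phi> = sat N (u # e) \<phi>" if "u \<in> dom N" for u
  proof -
    have "u # e \<in> tuples (dom N) (Suc n)" using that Ex.prems by (auto simp: tuples_def)
    then show ?thesis using Ex.IH[of "Suc n" "u # e"] Ex.prems by simp
  qed
  have "sat N (map \<sigma> e) (Ex \<phi>) \<longleftrightarrow> (\<exists>u\<in>\<sigma> ` dom N. sat N (u # map \<sigma> e) \<phi>)" using bij by simp
  also have "\<dots> \<longleftrightarrow> sat N e (Ex \<phi>)" using * by auto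
  finally show ?case .
next
  case (Conj \<phi> \<psi>)
  then show ?case using Conj.IH(1)[of n e] Conj.IH(2)[of n e] by simp
qed auto

lemma automorphism_holds:
  assumes "is_struct L N" "automorphism L N \<sigma>" "F \<in> forms L (dom N) n" "t \<in> tuples (dom N) n"
  shows "holds N (map \<sigma> t) (fst F, map \<sigma> (snd F)) = holds N t F"
proof -
  have "wf_fm L (n + length (snd F)) (fst F)" "t @ snd F \<in> tuples (dom N) (n + length (snd F))"
    using assms by (auto simp: forms_def tuples_def)
  from automorphism_sat[OF assms(1,2) this] show ?thesis by (simp add: holds_def)
qed

lemma automorphism_dom: "automorphism L N \<sigma> \<Longrightarrow> u \<in> dom N \<Longrightarrow> \<sigma> u \<in> dom N"
  by (auto simp: automorphism_def bij_betw_def)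

lemma automorphism_tuples: "automorphism L N \<sigma> \<Longrightarrow> t \<in> tuples (dom N) n \<Longrightarrow> map \<sigma> t \<in> tuples (dom N) n"
  using automorphism_dom by (fastforce simp: tuples_def)

lemma tp_eq_iff:
  assumes "length b = length b'"
  shows "tp L N M b = tp L N M b' \<longleftrightarrow>
    (\<forall>\<phi> c. (\<phi>, c) \<in> forms L M (length b) \<longrightarrow> sat N (b @ c) \<phi> = sat N (b' @ c) \<phi>)"
  using assms unfolding tp_def holds_def set_eq_iff by (auto simp del: length_append)

text \<open>Types of tuples are complete: a formula missing from the smaller one is present there as
  its negation.\<close>

lemma tp_subset_eq:
  assumes "length b = length b'" "tp L N M b \<subseteq> tp L N M b'"
  shows "tp L N M b = tp L N M b'"
proof (subst tp_eq_iff[OF assms(1)], intro allI impI)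
  fix \<phi> c assume f: "(\<phi>, c) \<in> forms L M (length b)"
  show "sat N (b @ c) \<phi> = sat N (b' @ c) \<phi>"
  proof (cases "sat N (b @ c) \<phi>")
    case True
    then show ?thesis using f assms(2) by (auto simp: tp_def holds_def)
  next
    case False
    then have "(Neg \<phi>, c) \<in> tp L N M b" using forms_Neg(1)[OF f] by (auto simp: tp_def holds_def)
    then show ?thesis using False assms by (auto simp: tp_def holds_def)
  qed
qed

lemma automorphism_tp:
  assumes "is_struct L N" "automorphism L N \<sigma>" "\<forall>u\<in>M. \<sigma> u = u" "M \<subseteq> dom N" "set b \<subseteq> dom N"
  shows "tp L N M (map \<sigma> b) = tp L N M b"
proof (subst tp_eq_iff, simp, intro allI impI)
  fix \<phi> c assume f: "(\<phi>, c) \<in> forms L M (length (map \<sigma> b))"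
  have "b \<in> tuples (dom N) (length b)" using assms by (simp add: tuples_def)
  moreover have "map \<sigma> c = c" using f assms(3) by (auto simp: forms_def intro!: map_idI)
  moreover have "(\<phi>, c) \<in> forms L (dom N) (length b)" using f assms(4) by (auto simp: forms_def)
  ultimately show "sat N (map \<sigma> b @ c) \<phi> = sat N (b @ c) \<phi>"
    using automorphism_holds[OF assms(1,2), of "(\<phi>, c)"] by (simp add: holds_def)
qed

lemma tp_automorphism:
  assumes "strongly_homogeneous L \<kappa> N" "M \<subseteq> dom N" "|M \<union> set b| <o \<kappa>" "set b \<subseteq> dom N" "set b' \<subseteq> dom N"
    "length b = length b'" "tp L N M b = tp L N M b'"
  shows "\<exists>\<sigma>. automorphism L N \<sigma> \<and> (\<forall>u\<in>M. \<sigma> u = u) \<and> map \<sigma> b = b'"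
proof -
  \<comment> \<open>\<open>b\<close> may repeat entries or meet \<open>M\<close>. That
    \<open>h\<close> is nevertheless well defined and fixes \<open>M\<close> is forced by the
    equalities recorded in the type.\<close>
  define h where "h = (\<lambda>u. if u \<in> set b then b' ! (SOME i. i < length b \<and> b ! i = u) else u)"
  have same: "sat N (b @ c) \<phi> = sat N (b' @ c) \<phi>" if "wf_fm L (length b + length c) \<phi>" "set c \<subseteq> M" for c \<phi>
    using assms(7) that unfolding tp_eq_iff[OF assms(6)] by (auto simp: forms_def)
  have hb: "h (b ! i) = b' ! i" if "i < length b" for i
  proof -
    let ?j = "SOME j. j < length b \<and> b ! j = b ! i"
    have j: "?j < length b \<and> b ! ?j = b ! i" by (rule someI[of _ i]) (use that in simp)
    then have "sat N (b @ []) (Eq (Var ?j) (Var i))" using that by simp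
    then have "sat N (b' @ []) (Eq (Var ?j) (Var i))" using same[of "[]" "Eq (Var ?j) (Var i)"] j that by simp
    then show ?thesis using that by (simp add: h_def)
  qed
  have hM: "h u = u" if "u \<in> M" for u
  proof (cases "u \<in> set b")
    case True
    then obtain i where i: "i < length b" "b ! i = u" by (meson in_set_conv_nth)
    have "sat N (b @ [u]) (Eq (Var i) (Var (length b)))" using i by (simp add: nth_append)
    then have "sat N (b' @ [u]) (Eq (Var i) (Var (length b)))"
      using same[of "[u]" "Eq (Var i) (Var (length b))"] i that by simp
    then have "b' ! i = u" using i assms(6) by (simp add: nth_append)
    then show ?thesis using hb[OF i(1)] i by simp
  qed (simp add: h_def)
  have "partial_elementary L N (M \<union> set b) h" unfolding partial_elementary_def
  proof (intro conjI allI impI ballI)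
    show "M \<union> set b \<subseteq> dom N" using assms by auto
    show "h ` (M \<union> set b) \<subseteq> dom N"
    proof
      fix v assume "v \<in> h ` (M \<union> set b)"
      then obtain u where u: "v = h u" "u \<in> M \<or> u \<in> set b" by auto
      show "v \<in> dom N"
      proof (cases "u \<in> M")
        case False
        then obtain i where "i < length b" "b ! i = u" using u by (meson in_set_conv_nth)
        then show ?thesis using hb u assms(5,6) by (metis nth_mem subsetD)
      qed (use u hM assms(2) in auto)
    qed
    fix n \<phi> e assume wf: "wf_fm L n \<phi>" and e: "e \<in> tuples (M \<union> set b) n"
    \<comment> \<open>Each entry of \<open>e\<close> occurs in \<open>b\<close> or among these
      elements of \<open>M\<close>, so a formula about \<open>e\<close> is a renamed formula about
      \<open>b\<close> with parameters \<open>c\<close>.\<close>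
    define c where "c = filter (\<lambda>u. u \<in> M) e"
    have "\<exists>j < length b + length c. (b @ c) ! j = e ! i \<and> (b' @ c) ! j = h (e ! i)" if i: "i < n" for i
    proof (cases "e ! i \<in> M")
      case True
      then have "e ! i \<in> set c" using i e by (auto simp: c_def tuples_def)
      then obtain l where "l < length c" "c ! l = e ! i" by (meson in_set_conv_nth)
      then show ?thesis using True hM assms(6) by (intro exI[of _ "length b + l"]) (auto simp: nth_append)
    next
      case False
      then have "e ! i \<in> set b" using i e by (auto simp: tuples_def dest!: nth_mem)
      then obtain l where "l < length b" "b ! l = e ! i" by (meson in_set_conv_nth)
      then show ?thesis using hb[of l] assms(6) by (intro exI[of _ l]) (auto simp: nth_append)
    qed
    then obtain f where f: "\<And>i. i < n \<Longrightarrow> f i < length b + length c \<and> (b @ c) ! f i = e ! i \<and> (b' @ c) ! f i = h (e ! i)"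
      by metis
    have "sat N e \<phi> = sat N (b @ c) (ren f \<phi>)" using sat_ren[OF wf, of "b @ c" f e N] f by simp
    also have "\<dots> = sat N (b' @ c) (ren f \<phi>)"
      by (rule same) (use wf_ren[OF wf] f in \<open>auto simp: c_def\<close>)
    also have "\<dots> = sat N (map h e) \<phi>"
      by (rule sat_ren[OF wf]) (use f e in \<open>auto simp: tuples_def\<close>)
    finally show "sat N e \<phi> = sat N (map h e) \<phi>" .
  qed
  then obtain \<sigma> where s: "automorphism L N \<sigma>" "\<forall>u\<in>M \<union> set b. \<sigma> u = h u"
    using assms(1,3) unfolding strongly_homogeneous_def by blast
  have "map \<sigma> b = b'"
    by (rule nth_equalityI) (use s hb assms(6) in auto)
  then show ?thesis using s hM by auto
qed

section \<open>Elementary hulls\<close>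

definition flas :: "('f, 'r) language \<Rightarrow> ('f, 'r) fm set" where
  "flas L = {\<phi>. \<exists>n. wf_fm L n \<phi>}"

lemma infinite_flas: "infinite (flas L)"
proof -
  have "inj (\<lambda>i. Eq (Var i) (Var i) :: ('f, 'r) fm)" by (rule injI) simp
  moreover have "range (\<lambda>i. Eq (Var i) (Var i)) \<subseteq> flas L" by (auto simp: flas_def)
  ultimately show ?thesis using infinite_iff_countable_subset by blast
qed

lemma card_of_lists_bound:
  assumes "infinite B" "|A| \<le>o |B|"
  shows "|lists A| \<le>o |B|"
proof -
  have "|tuples A n| \<le>o |B|" for n
  proof (induction n)
    case 0
    have "tuples A 0 = {[]}" by (auto simp: tuples_def)
    then show ?case using assms(1) by (metis card_of_singl_ordLeq finite.emptyI)
  next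
    case (Suc n)
    have "tuples A (Suc n) \<subseteq> (\<lambda>(u, e). u # e) ` (A \<times> tuples A n)"
      by (auto simp: tuples_def image_def length_Suc_conv)
    then have "|tuples A (Suc n)| \<le>o |A \<times> tuples A n|"
      by (rule ordLeq_transitive[OF card_of_mono1 card_of_image])
    moreover have "|A \<times> tuples A n| \<le>o |B|"
      by (rule card_of_Times_ordLeq_infinite_Field) (simp_all add: assms Suc Field_card_of card_of_card_order_on)
    ultimately show ?case by (rule ordLeq_transitive)
  qed
  moreover have "lists A = (\<Union>n. tuples A n)" by (auto simp: tuples_def)
  moreover have "|UNIV :: nat set| \<le>o |B|" using assms(1) by (simp add: infinite_iff_card_of_nat)
  ultimately show ?thesis using card_of_UNION_ordLeq_infinite[OF assms(1), of UNIV "tuples A"] by auto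
qed

lemma val_dom [simp]: "val (N\<lparr>dom := M\<rparr>) e t = val N e t"
  by (induction t) (auto cong: map_cong)

lemma Tarski_Vaught:
  assumes N: "is_struct L N" and M: "M \<subseteq> dom N"
    and TV: "\<And>n \<phi> e. wf_fm L (Suc n) \<phi> \<Longrightarrow> e \<in> tuples M n \<Longrightarrow> \<exists>u\<in>dom N. sat N (u # e) \<phi> \<Longrightarrow> \<exists>u\<in>M. sat N (u # e) \<phi>"
  shows "elementary_submodel L N M"
proof -
  obtain u where u: "u \<in> dom N" using N by (auto simp: is_struct_def)
  have "M \<noteq> {}" using TV[of 0 "Eq (Var 0) (Var 0)" "[]"] u by (auto simp: tuples_def)
  moreover have "fn N g a \<in> M" if g: "g \<in> funs L" "a \<in> tuples M (farity L g)" for g a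
  proof -
    \<comment> \<open>A witness in \<open>M\<close> for this formula is the value of
      \<open>g\<close>, so closure under function symbols is an instance of
      \<open>TV\<close>.\<close>
    let ?\<phi> = "Eq (Var 0) (Fn g (map Var [1..<Suc (farity L g)]))"
    have "wf_fm L (Suc (farity L g)) ?\<phi>" using g by auto
    moreover have v: "map (\<lambda>i. (u # a) ! i) [1..<Suc (farity L g)] = a" for u
      by (rule nth_equalityI) (use g in \<open>auto simp: tuples_def simp del: upt_Suc\<close>)
    moreover have "fn N g a \<in> dom N" using N M g by (auto simp: is_struct_def tuples_def)
    ultimately obtain u where "u \<in> M" "sat N (u # a) ?\<phi>"
      using TV[of "farity L g" ?\<phi> a] g by (auto simp: comp_def simp del: upt_Suc)
    then show ?thesis using v[of u] by (simp add: comp_def del: upt_Suc)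
  qed
  moreover have "sat (N\<lparr>dom := M\<rparr>) e \<phi> \<longleftrightarrow> sat N e \<phi>" if "wf_fm L n \<phi>" "e \<in> tuples M n" for n \<phi> e
    using that
  proof (induction \<phi> arbitrary: n e)
    case (Ex \<phi>)
    have "sat (N\<lparr>dom := M\<rparr>) (u # e) \<phi> \<longleftrightarrow> sat N (u # e) \<phi>" if "u \<in> M" for u
      by (rule Ex.IH[of "Suc n"]) (use Ex.prems that in \<open>auto simp: tuples_def\<close>)
    then show ?case using TV[of n \<phi> e] Ex.prems M by auto
  next
    case (Conj \<phi> \<psi>)
    then show ?case using Conj.IH(1)[of n e] Conj.IH(2)[of n e] by simp
  qed (auto cong: map_cong)
  ultimately show ?thesis using M by (auto simp: elementary_submodel_def is_struct_def)
qed

text \<open>Besides Skolem witnesses each stage receives the entries of \<open>g (X n)\<close>. This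
  lets a type be realized over every stage along the way; with \<open>g\<close> constantly
  \<open>[]\<close> it is the downward Loewenheim-Skolem theorem.\<close>

lemma elementary_hull:
  fixes g :: "'m set \<Rightarrow> 'm list" and L :: "('f, 'r) language"
  assumes N: "is_struct L N" and A: "A \<subseteq> dom N" "|A| \<le>o |flas L|" and g: "\<And>X. set (g X) \<subseteq> dom N"
  obtains X where "X 0 = A" "\<And>n. X n \<subseteq> X (Suc n)" "\<And>n. set (g (X n)) \<subseteq> X (Suc n)"
    "\<And>n. |X n| \<le>o |flas L|" "elementary_submodel L N (\<Union>n. X n)" "|\<Union>n. X n| \<le>o |flas L|"
proof -
  \<comment> \<open>Where no witness exists an arbitrary element is taken, so that the stages stay
    inside the structure.\<close>
  define w where "w = (\<lambda>(\<phi> :: ('f, 'r) fm, e). if \<exists>u\<in>dom N. sat N (u # e) \<phi> then SOME u. u \<in> dom N \<and> sat N (u # e) \<phi> else (SOME u. u \<in> dom N))"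
  have ne: "dom N \<noteq> {}" using N by (auto simp: is_struct_def)
  have wdom: "w (\<phi>, e) \<in> dom N" for \<phi> e
  proof (cases "\<exists>u\<in>dom N. sat N (u # e) \<phi>")
    case True
    then have "(SOME u. u \<in> dom N \<and> sat N (u # e) \<phi>) \<in> dom N \<and> sat N (u # e) \<phi> \<or> (SOME u. u \<in> dom N \<and> sat N (u # e) \<phi>) \<in> dom N" for u
      using someI_ex[of "\<lambda>u. u \<in> dom N \<and> sat N (u # e) \<phi>"] by blast
    then show ?thesis using True by (auto simp: w_def)
  next
    case False
    then have "w (\<phi>, e) = (SOME u. u \<in> dom N)" by (auto simp: w_def)
    then show ?thesis using ne by (simp add: some_in_eq)
  qed
  have wsat: "sat N (w (\<phi>, e) # e) \<phi>" if "\<exists>u\<in>dom N. sat N (u # e) \<phi>" for \<phi> e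
    using someI_ex[of "\<lambda>u. u \<in> dom N \<and> sat N (u # e) \<phi>"] that by (auto simp: w_def)
  define X where "X = rec_nat A (\<lambda>_ Y. Y \<union> w ` (flas L \<times> lists Y) \<union> set (g Y))"
  have X0: "X 0 = A" and XS: "X (Suc n) = X n \<union> w ` (flas L \<times> lists (X n)) \<union> set (g (X n))" for n
    by (simp_all add: X_def)
  have inf: "infinite (flas L)" by (rule infinite_flas)
  have card: "|X n| \<le>o |flas L|" for n
  proof (induction n)
    case 0 then show ?case using A X0 by simp
  next
    case (Suc n)
    have "|flas L \<times> lists (X n)| \<le>o |flas L|"
      by (rule card_of_Times_ordLeq_infinite_Field)
        (simp_all add: inf card_of_lists_bound[OF inf Suc] Field_card_of card_of_card_order_on ordLeq_refl)
    then have "|w ` (flas L \<times> lists (X n))| \<le>o |flas L|"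
      by (rule ordLeq_transitive[OF card_of_image])
    moreover have "|set (g (X n))| \<le>o |flas L|"
      by (rule ordLess_imp_ordLeq, rule finite_ordLess_infinite)
        (simp_all add: inf Field_card_of card_of_well_order_on)
    ultimately show ?case unfolding XS using Suc inf
      by (simp add: card_of_Un_ordLeq_infinite_Field Field_card_of card_of_card_order_on)
  qed
  have dom: "X n \<subseteq> dom N" for n
  proof (induction n)
    case 0 then show ?case using A X0 by simp
  next
    case (Suc n)
    then show ?case unfolding XS using g wdom by auto
  qed
  have mono: "i \<le> j \<Longrightarrow> X i \<subseteq> X j" for i j
    by (rule lift_Suc_mono_le[of X]) (auto simp: XS)
  have fin: "\<exists>n. set e \<subseteq> X n" if "set e \<subseteq> (\<Union>n. X n)" for e :: "'m list"
    using that
  proof (induction e)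
    case (Cons a e)
    then obtain i j where "a \<in> X i" "set e \<subseteq> X j" by auto
    then have "set (a # e) \<subseteq> X (max i j)" using mono[of i "max i j"] mono[of j "max i j"] by auto
    then show ?case by blast
  qed auto
  have "elementary_submodel L N (\<Union>n. X n)"
  proof (rule Tarski_Vaught[OF N])
    show "(\<Union>n. X n) \<subseteq> dom N" using dom by blast
    fix n \<phi> e assume *: "wf_fm L (Suc n) \<phi>" "e \<in> tuples (\<Union>n. X n) n" "\<exists>u\<in>dom N. sat N (u # e) \<phi>"
    then obtain i where "set e \<subseteq> X i" using fin[of e] by (auto simp: tuples_def)
    then have "w (\<phi>, e) \<in> X (Suc i)" using *(1) by (auto simp: XS flas_def)
    then show "\<exists>u\<in>\<Union>n. X n. sat N (u # e) \<phi>" using wsat[OF *(3)] by blast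
  qed
  moreover have "|\<Union>n. X n| \<le>o |flas L|"
    using card_of_UNION_ordLeq_infinite[OF inf, of UNIV X] card inf by (simp add: infinite_iff_card_of_nat)
  ultimately show ?thesis using that[of X] X0 XS card by blast
qed


section \<open>Global types\<close>

lemma realizes_global_iff:
  assumes "global_type L N k p" "realizes N t (p \<inter> forms L A k)" "A \<subseteq> dom N" "F \<in> forms L A k"
  shows "holds N t F \<longleftrightarrow> F \<in> p"
proof
  show "holds N t F" if "F \<in> p" using that assms by (auto simp: realizes_def)
  show "F \<in> p" if h: "holds N t F"
  proof (rule ccontr)
    obtain \<phi> c where F: "F = (\<phi>, c)" by (metis surj_pair)
    assume "F \<notin> p"
    then have "(Neg \<phi>, c) \<in> p"
      using assms(1,4) forms_mono[OF assms(3)] F unfolding global_type_def by blast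
    then have "holds N t (Neg \<phi>, c)" using assms F forms_Neg(1)[of \<phi> c L A k] by (auto simp: realizes_def)
    then show False using h F by (simp add: forms_Neg)
  qed
qed

text \<open>The limit type along an ultrafilter. If \<open>W\<close> contains
  \<open>tuples M k\<close>, every formula in it is realized in \<open>M\<close>, so it is a global
  coheir of its restriction to \<open>M\<close>.\<close>

definition avg :: "('f, 'r) language \<Rightarrow> ('m, 'f, 'r) struct \<Rightarrow> nat \<Rightarrow> 'm list set set \<Rightarrow>
    (('f, 'r) fm \<times> 'm list) set" where
  "avg L N k W = {F \<in> forms L (dom N) k. {t. holds N t F} \<in> W}"

lemma avg_global:
  assumes W: "ultrafilter W" "tuples (dom N) k \<in> W"
  shows "global_type L N k (avg L N k W)"
  unfolding global_type_def
proof (intro conjI)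
  show "avg L N k W \<subseteq> forms L (dom N) k" by (auto simp: avg_def)
  show "consistent N k (avg L N k W)" unfolding consistent_def
  proof (intro allI impI)
    fix \<Sigma> assume "\<Sigma> \<subseteq> avg L N k W" "finite \<Sigma>"
    then have "{t. \<forall>F\<in>\<Sigma>. holds N t F} \<in> W" by (intro ultrafilter_ball[OF W(1)]) (auto simp: avg_def)
    then have "{t. \<forall>F\<in>\<Sigma>. holds N t F} \<inter> tuples (dom N) k \<noteq> {}"
      using W ultrafilterD(3) ultrafilter_nonempty by blast
    then show "\<exists>a\<in>tuples (dom N) k. realizes N a \<Sigma>" by (auto simp: realizes_def)
  qed
  show "\<forall>(\<phi>, c)\<in>forms L (dom N) k. (\<phi>, c) \<in> avg L N k W \<or> (Neg \<phi>, c) \<in> avg L N k W"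
  proof clarify
    fix \<phi> c assume f: "(\<phi>, c) \<in> forms L (dom N) k" and n: "(Neg \<phi>, c) \<notin> avg L N k W"
    have "{t. holds N t (Neg \<phi>, c)} = - {t. holds N t (\<phi>, c)}" by (auto simp: forms_Neg)
    then have "{t. holds N t (\<phi>, c)} \<in> W"
      using n forms_Neg(1)[OF f] ultrafilter_Compl[OF W(1)] by (auto simp: avg_def)
    then show "(\<phi>, c) \<in> avg L N k W" using f by (auto simp: avg_def)
  qed
qed


section \<open>Monster models\<close>

locale monster_model =
  fixes L :: "('f, 'r) language" and T :: "('f, 'r) fm set" and \<kappa> :: "'k rel" and N :: "('m, 'f, 'r) struct"
  assumes monster: "monster L T \<kappa> N"
begin

lemma is_struct: "is_struct L N"
  using monster by (simp add: monster_def is_model_def)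

lemma dom_nonempty: "dom N \<noteq> {}"
  using is_struct by (simp add: is_struct_def)

lemma card_order: "Card_order \<kappa>" and homogeneous: "strongly_homogeneous L \<kappa> N"
  using monster by (auto simp: monster_def)

lemma flas_less: "|flas L| <o \<kappa>"
proof -
  have "|Pow (flas L)| <o \<kappa>" using monster by (simp add: monster_def flas_def)
  then show ?thesis using card_of_Pow ordLess_transitive by blast
qed

lemma infinite_Field: "infinite (Field \<kappa>)"
proof -
  have "|flas L| \<le>o |Field \<kappa>|"
    using flas_less card_order card_of_Field_ordIso ordIso_symmetric ordLess_ordIso_trans ordLess_imp_ordLeq by blast
  then show ?thesis using infinite_flas card_of_ordLeq_infinite by blast
qed

lemma small_Un: "|A| <o \<kappa> \<Longrightarrow> |B| <o \<kappa> \<Longrightarrow> |A \<union> B| <o \<kappa>"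
  by (rule card_of_Un_ordLess_infinite_Field[OF infinite_Field card_order])

lemma small_finite: "finite A \<Longrightarrow> |A| <o \<kappa>"
  using finite_ordLess_infinite[of "|A|" \<kappa>] infinite_Field card_order
  by (simp add: card_of_well_order_on card_order_on_well_order_on Field_card_of)

lemma small_Un_finite: "|A| <o \<kappa> \<Longrightarrow> finite B \<Longrightarrow> |A \<union> B| <o \<kappa>"
  by (simp add: small_Un small_finite)

lemma saturation:
  assumes "A \<subseteq> dom N" "|A| <o \<kappa>" "\<Sigma> \<subseteq> forms L A k" "consistent N k \<Sigma>"
  obtains a where "a \<in> tuples (dom N) k" "realizes N a \<Sigma>"
  using assms monster unfolding monster_def saturated_def by blast

lemma realize_global:
  assumes "global_type L N k p" "A \<subseteq> dom N" "|A| <o \<kappa>"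
  obtains a where "a \<in> tuples (dom N) k" "realizes N a (p \<inter> forms L A k)"
proof (rule saturation[OF assms(2,3), of "p \<inter> forms L A k" k])
  show "consistent N k (p \<inter> forms L A k)"
    using assms(1) unfolding global_type_def consistent_def by (meson le_infE)
qed auto

lemma same_type_automorphism:
  assumes "M \<subseteq> dom N" "|M| <o \<kappa>" "b \<in> tuples (dom N) n" "b' \<in> tuples (dom N) n" "tp L N M b = tp L N M b'"
  obtains \<sigma> where "automorphism L N \<sigma>" "\<forall>u\<in>M. \<sigma> u = u" "map \<sigma> b = b'"
  using tp_automorphism[OF homogeneous, of M b b'] assms small_Un_finite[of M "set b"] by (auto simp: tuples_def)

text \<open>An automorphism over \<open>M\<close> that takes \<open>b\<close> to \<open>b'\<close>
  fixes every tuple from \<open>M\<close>, and \<open>W\<close> concentrates on these tuples; so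
  \<open>b\<close> and \<open>b'\<close> satisfy the same formulas on a large set.\<close>

lemma avg_invariant:
  assumes W: "ultrafilter W" "tuples M k \<in> W" and M: "M \<subseteq> dom N" "|M| <o \<kappa>"
  shows "invariant_type L N M k (avg L N k W)"
proof -
  have "tuples M k \<subseteq> tuples (dom N) k" using M(1) by (auto simp: tuples_def)
  then have "global_type L N k (avg L N k W)" using avg_global ultrafilterD(2)[OF W(1)] W by blast
  moreover have "(\<phi>, b') \<in> avg L N k W" if b: "set b \<subseteq> dom N" "set b' \<subseteq> dom N" "length b = length b'"
    "tp L N M b = tp L N M b'" "(\<phi>, b) \<in> avg L N k W" for \<phi> b b'
  proof -
    obtain \<sigma> where s: "automorphism L N \<sigma>" "\<forall>u\<in>M. \<sigma> u = u" "map \<sigma> b = b'"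
      using same_type_automorphism[OF M, of b "length b" b'] b by (auto simp: tuples_def)
    have f: "(\<phi>, b) \<in> forms L (dom N) k" "{t. holds N t (\<phi>, b)} \<in> W" using b(5) by (auto simp: avg_def)
    have "holds N t (\<phi>, b')" if t: "t \<in> tuples M k" "holds N t (\<phi>, b)" for t
    proof -
      have "map \<sigma> t = t" using t s(2) by (intro map_idI) (auto simp: tuples_def)
      then show ?thesis using automorphism_holds[OF is_struct s(1) f(1), of t] t M(1) s(3)
        by (auto simp: tuples_def)
    qed
    then have "{t. holds N t (\<phi>, b)} \<inter> tuples M k \<subseteq> {t. holds N t (\<phi>, b')}" by auto
    then have "{t. holds N t (\<phi>, b')} \<in> W" using ultrafilterD(2,3)[OF W(1)] f(2) W(2) by blast
    then show ?thesis using f(1) b by (auto simp: avg_def forms_def)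
  qed
  ultimately show ?thesis unfolding invariant_type_def by (metis (no_types, lifting))
qed

text \<open>The base \<open>A\<close> may be larger than the model for which the type is invariant.
  With \<open>A = M \<union> set u\<close> the members also realize the type over
  \<open>u\<close>.\<close>

lemma morley_exists:
  assumes p: "global_type L N k p" and A: "A \<subseteq> dom N" "|A| <o \<kappa>"
    and s0: "s0 \<in> tuples (dom N) k" "realizes N s0 (p \<inter> forms L A k)"
  obtains s :: "nat \<Rightarrow> 'm list" where "s 0 = s0" "\<And>i. s i \<in> tuples (dom N) k"
    "\<And>i. realizes N (s i) (p \<inter> forms L (A \<union> (\<Union>j<i. set (s j))) k)"
proof -
  define pick where "pick = (\<lambda>Y. SOME t. t \<in> tuples (dom N) k \<and> realizes N t (p \<inter> forms L Y k))"
  have pick: "pick Y \<in> tuples (dom N) k \<and> realizes N (pick Y) (p \<inter> forms L Y k)"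
    if "Y \<subseteq> dom N" "|Y| <o \<kappa>" for Y
    unfolding pick_def using realize_global[OF p that] by (metis (mono_tags, lifting) someI)
  define h where "h = (\<lambda>n::nat. \<lambda>Y. if n = 0 then s0 else pick Y)"
  define Y where "Y = rec_nat A (\<lambda>n Y. Y \<union> set (h n Y))"
  define s where "s = (\<lambda>n. h n (Y n))"
  have Y0: "Y 0 = A" and YS: "Y (Suc n) = Y n \<union> set (s n)" for n by (simp_all add: Y_def s_def)
  have main: "Y n \<subseteq> dom N \<and> |Y n| <o \<kappa> \<and> Y n = A \<union> (\<Union>j<n. set (s j)) \<and>
      s n \<in> tuples (dom N) k \<and> realizes N (s n) (p \<inter> forms L (Y n) k)" for n
  proof (induction n)
    case 0 then show ?case using A s0 by (simp add: Y0 s_def h_def)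
  next
    case (Suc n)
    have 1: "Y (Suc n) \<subseteq> dom N" "|Y (Suc n)| <o \<kappa>" "Y (Suc n) = A \<union> (\<Union>j<Suc n. set (s j))"
      using Suc by (auto simp: YS small_Un_finite tuples_def lessThan_Suc)
    then show ?case using pick[OF 1(1,2)] by (simp add: s_def h_def)
  qed
  show ?thesis
  proof (rule that[of s])
    show "s 0 = s0" by (simp add: s_def h_def)
    show "s i \<in> tuples (dom N) k" for i using main by blast
    show "realizes N (s i) (p \<inter> forms L (A \<union> (\<Union>j<i. set (s j))) k)" for i using main[of i] by metis
  qed
qed

end

section \<open>Conant-independence\<close>

lemma conant_divides_forks: "conant_divides L N M k F \<Longrightarrow> conant_forks L N M k F"
  unfolding conant_forks_def by (auto simp: conant_divides_def intro!: exI[of _ "{F}"])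

text \<open>A common solution of the reindexed instances restricts along \<open>ix\<close> to a
  common solution of the original ones.\<close>

lemma conant_divides_reindex:
  assumes G: "conant_divides L N M (length ix) G" and ix: "set ix \<subseteq> {..<n}"
  shows "conant_divides L N M n (reindex ix n (fst G), snd G)"
  unfolding conant_divides_def
proof (intro conjI allI impI)
  have Gf: "(fst G, snd G) \<in> forms L (dom N) (length ix)" using G by (simp add: conant_divides_def)
  show "(reindex ix n (fst G), snd G) \<in> forms L (dom N) n" by (rule reindex_forms[OF Gf ix])
  fix p s
  assume s: "invariant_type L N M (length (snd (reindex ix n (fst G), snd G))) p \<and>
    morley_sequence L N M (length (snd (reindex ix n (fst G), snd G))) p s \<and> s 0 = snd (reindex ix n (fst G), snd G)"
  show "\<not> consistent N n {(fst (reindex ix n (fst G), snd G), s i) |i. True}"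
  proof
    assume c: "consistent N n {(fst (reindex ix n (fst G), snd G), s i) |i. True}"
    have "consistent N (length ix) {(fst G, s i) |i. True}" unfolding consistent_def
    proof (intro allI impI)
      fix \<Sigma> assume \<Sigma>: "\<Sigma> \<subseteq> {(fst G, s i) |i. True}" "finite \<Sigma>"
      let ?\<Sigma> = "(\<lambda>F. (reindex ix n (fst F), snd F)) ` \<Sigma>"
      have "?\<Sigma> \<subseteq> {(fst (reindex ix n (fst G), snd G), s i) |i. True}" using \<Sigma> by fastforce
      then obtain t where t: "t \<in> tuples (dom N) n" "realizes N t ?\<Sigma>"
        using c \<Sigma>(2) unfolding consistent_def by (meson finite_imageI)
      have "map ((!) t) ix \<in> tuples (dom N) (length ix)"
        using t(1) ix by (auto simp: tuples_def intro!: subsetD[OF _ nth_mem])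
      moreover have "holds N (map ((!) t) ix) F" if F: "F \<in> \<Sigma>" for F
      proof -
        obtain i where i: "F = (fst G, s i)" using F \<Sigma>(1) by auto
        have "s i \<in> tuples (dom N) (length (snd G))" using s by (simp add: morley_sequence_def)
        then have "(fst G, s i) \<in> forms L (dom N) (length ix)" using Gf by (auto simp: forms_def tuples_def)
        then show ?thesis using reindex_forms(2)[of "fst G" "s i" L "dom N" ix n t N] ix t F i
          by (auto simp: realizes_def tuples_def)
      qed
      ultimately show "\<exists>a\<in>tuples (dom N) (length ix). realizes N a \<Sigma>" unfolding realizes_def by blast
    qed
    then show False using G s by (auto simp: conant_divides_def)
  qed
qed

lemma conant_forks_reindex:
  assumes F: "conant_forks L N M (length ix) F" and ix: "set ix \<subseteq> {..<n}"
  shows "conant_forks L N M n (reindex ix n (fst F), snd F)"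
proof -
  obtain D where D: "F \<in> forms L (dom N) (length ix)" "finite D" "\<forall>G\<in>D. conant_divides L N M (length ix) G"
    "\<forall>a\<in>tuples (dom N) (length ix). holds N a F \<longrightarrow> (\<exists>G\<in>D. holds N a G)"
    using F by (auto simp: conant_forks_def)
  let ?r = "\<lambda>G. (reindex ix n (fst G), snd G)"
  have h: "holds N a (?r G) = holds N (map ((!) a) ix) G" if "G \<in> forms L (dom N) (length ix)" "a \<in> tuples (dom N) n" for G a
    using reindex_forms(2)[of "fst G" "snd G" L "dom N" ix n a N] that ix by (simp add: tuples_def)
  have m: "map ((!) a) ix \<in> tuples (dom N) (length ix)" if "a \<in> tuples (dom N) n" for a
    using that ix by (auto simp: tuples_def intro!: subsetD[OF _ nth_mem])
  have "?r F \<in> forms L (dom N) n" using reindex_forms(1)[of "fst F" "snd F"] D(1) ix by simp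
  moreover have "finite (?r ` D)" "\<And>G. G \<in> ?r ` D \<Longrightarrow> conant_divides L N M n G"
    using D(2) conant_divides_reindex[OF bspec[OF D(3)] ix] by (simp, elim imageE, simp)
  moreover have "\<exists>G\<in>?r ` D. holds N a G" if a: "a \<in> tuples (dom N) n" "holds N a (?r F)" for a
  proof -
    obtain G where G: "G \<in> D" "holds N (map ((!) a) ix) G" using D(4) m a h[OF D(1)] by blast
    moreover have "G \<in> forms L (dom N) (length ix)" using D(3) G(1) by (simp add: conant_divides_def)
    ultimately show ?thesis using h a(1) by blast
  qed
  ultimately show ?thesis unfolding conant_forks_def
    by (intro conjI exI[of _ "?r ` D"] ballI impI) auto
qed

text \<open>A list of elements of \<open>b\<close> is a subtuple of \<open>b\<close>, possibly with
  repetitions, so a forking formula in its type reindexes to a forking formula satisfied by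
  \<open>b\<close> itself.\<close>

lemma conant_indep_tuple:
  assumes b: "b \<in> tuples (dom N) n" and MB: "M \<union> B \<subseteq> dom N"
    and nf: "\<And>F. F \<in> forms L (M \<union> B) n \<Longrightarrow> holds N b F \<Longrightarrow> \<not> conant_forks L N M n F"
  shows "conant_indep L N M (set b) B"
  unfolding conant_indep_def
proof (intro ballI notI)
  fix a F assume a: "a \<in> lists (set b)" and F: "F \<in> tp L N (M \<union> B) a" and f: "conant_forks L N M (length a) F"
  have "\<forall>u\<in>set a. \<exists>i<n. b ! i = u" using a b by (force simp: tuples_def in_set_conv_nth)
  then obtain p where p: "\<And>u. u \<in> set a \<Longrightarrow> p u < n \<and> b ! p u = u" by metis
  let ?ix = "map p a"
  have ix: "set ?ix \<subseteq> {..<n}" "map ((!) b) ?ix = a" using p by (auto intro: map_idI)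
  have "(fst F, snd F) \<in> forms L (M \<union> B) (length ?ix)" using F by (simp add: tp_def)
  note r = reindex_forms[OF this ix(1)]
  have "holds N b (reindex ?ix n (fst F), snd F)" using r(2)[of b N] F ix b by (simp add: tp_def tuples_def)
  moreover have "conant_forks L N M n (reindex ?ix n (fst F), snd F)"
    using conant_forks_reindex[of L N M ?ix F n] f ix by simp
  ultimately show False using nf r(1) by blast
qed

context monster_model
begin

text \<open>The type \<open>p\<close> is not moved by an automorphism over \<open>M\<close>:
  parameters are pulled back without changing their type over \<open>M\<close>, and invariance keeps
  the formula in \<open>p\<close>.\<close>

lemma morley_automorphism:
  assumes p: "invariant_type L N M k p" and s: "morley_sequence L N M k p s" and M: "M \<subseteq> dom N"
    and \<sigma>: "automorphism L N \<sigma>" "\<forall>u\<in>M. \<sigma> u = u"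
  shows "morley_sequence L N M k p (\<lambda>i. map \<sigma> (s i))"
  unfolding morley_sequence_def
proof (intro allI conjI)
  fix i
  have sd: "s i \<in> tuples (dom N) k" for i using s by (simp add: morley_sequence_def)
  show "map \<sigma> (s i) \<in> tuples (dom N) k" using sd automorphism_tuples[OF \<sigma>(1)] by blast
  show "realizes N (map \<sigma> (s i)) (p \<inter> forms L (M \<union> (\<Union>j<i. set (map \<sigma> (s j)))) k)" unfolding realizes_def
  proof
    fix F assume F: "F \<in> p \<inter> forms L (M \<union> (\<Union>j<i. set (map \<sigma> (s j)))) k"
    obtain \<phi> b where Fb: "F = (\<phi>, b)" by (metis surj_pair)
    let ?B = "M \<union> (\<Union>j<i. set (s j))"
    have B: "?B \<subseteq> dom N" using M sd by (auto simp: tuples_def)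
    have "M \<union> (\<Union>j<i. set (map \<sigma> (s j))) = \<sigma> ` ?B" using \<sigma>(2) by (force simp: image_Un image_UN)
    then have "set b \<subseteq> \<sigma> ` ?B" using F Fb by (auto simp: forms_def)
    then have "\<forall>v\<in>set b. \<exists>u\<in>?B. \<sigma> u = v" by blast
    then obtain q where q: "\<And>v. v \<in> set b \<Longrightarrow> q v \<in> ?B \<and> \<sigma> (q v) = v" by metis
    let ?b = "map q b"
    have b: "set ?b \<subseteq> ?B" "map \<sigma> ?b = b" using q by (auto intro!: map_idI)
    then have bd: "set ?b \<subseteq> dom N" using B by blast
    then have "set (map \<sigma> ?b) \<subseteq> dom N" using automorphism_dom[OF \<sigma>(1)] by auto
    then have "set b \<subseteq> dom N" by (simp only: b(2))
    moreover have "tp L N M b = tp L N M ?b" using automorphism_tp[OF is_struct \<sigma> M bd] unfolding b(2) .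
    moreover have "length b = length ?b" "(\<phi>, b) \<in> p" using F Fb by simp_all
    ultimately have "(\<phi>, ?b) \<in> p" using p bd unfolding invariant_type_def by blast
    moreover have f: "(\<phi>, ?b) \<in> forms L ?B k" using F Fb b(1) by (auto simp: forms_def)
    ultimately have "holds N (s i) (\<phi>, ?b)" using s by (auto simp: morley_sequence_def realizes_def)
    then have "holds N (map \<sigma> (s i)) (\<phi>, map \<sigma> ?b)"
      using automorphism_holds[OF is_struct \<sigma>(1), of "(\<phi>, ?b)" k "s i"] f forms_mono[OF B] sd by auto
    then show "holds N (map \<sigma> (s i)) F" using b(2) Fb by simp
  qed
qed

text \<open>The definition concerns sequences that start exactly with \<open>h\<close>. A start
  conjugate to \<open>h\<close> over \<open>M\<close> suffices, since both the sequence and the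
  solution \<open>y\<close> can be moved.\<close>

lemma conant_divides_morley:
  assumes G: "conant_divides L N M k (\<chi>, h)" and p: "invariant_type L N M (length h) p"
    and s: "morley_sequence L N M (length h) p s" and M: "M \<subseteq> dom N"
    and \<sigma>: "automorphism L N \<sigma>" "\<forall>u\<in>M. \<sigma> u = u" "map \<sigma> (s 0) = h"
    and y: "y \<in> tuples (dom N) k"
  shows "\<exists>i. \<not> holds N y (\<chi>, s i)"
proof (rule ccontr)
  assume "\<not> ?thesis"
  then have all: "holds N y (\<chi>, s i)" for i by blast
  have "morley_sequence L N M (length h) p (\<lambda>i. map \<sigma> (s i))" by (rule morley_automorphism[OF p s M \<sigma>(1,2)])
  then have "\<not> consistent N k {(\<chi>, map \<sigma> (s i)) |i. True}"
    using G[unfolded conant_divides_def, THEN conjunct2, rule_format, of p "\<lambda>i. map \<sigma> (s i)"] p \<sigma>(3) by simp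
  moreover have "holds N (map \<sigma> y) (\<chi>, map \<sigma> (s i))" for i
  proof -
    have "s i \<in> tuples (dom N) (length h)" using s by (simp add: morley_sequence_def)
    moreover have "(\<chi>, h) \<in> forms L (dom N) k" using G by (simp add: conant_divides_def)
    ultimately have "(\<chi>, s i) \<in> forms L (dom N) k" by (auto simp: forms_def tuples_def)
    then show ?thesis using automorphism_holds[OF is_struct \<sigma>(1), of "(\<chi>, s i)" k y] all y by simp
  qed
  then have "consistent N k {(\<chi>, map \<sigma> (s i)) |i. True}" unfolding consistent_def realizes_def
    by (intro allI impI bexI[OF _ automorphism_tuples[OF \<sigma>(1) y]]) auto
  ultimately show False by blast
qed

text \<open>If \<open>y\<close> solved infinitely many instances, the subsequence at these indices,
  projected to the coordinates \<open>ix\<close>, would be a Morley sequence with a common solution.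
  Finiteness of the index set is the form suited to a pigeonhole argument over several dividing
  formulas.\<close>

lemma conant_divides_avg:
  assumes G: "conant_divides L N M k (\<chi>, map ((!) d) ix)" and ix: "set ix \<subseteq> {..<m}"
    and W: "ultrafilter W" "tuples M m \<in> W" and M: "M \<subseteq> dom N" "|M| <o \<kappa>"
    and s: "morley_sequence L N M m (avg L N m W) s"
    and tp: "\<And>n. \<exists>\<sigma>. automorphism L N \<sigma> \<and> (\<forall>u\<in>M. \<sigma> u = u) \<and> map \<sigma> (s n) = d"
    and y: "y \<in> tuples (dom N) k"
  shows "finite {n. holds N y (\<chi>, map ((!) (s n)) ix)}"
proof (rule ccontr)
  let ?I = "{n. holds N y (\<chi>, map ((!) (s n)) ix)}" and ?l = "length ix"
  assume inf: "infinite ?I"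
  define f where "f = enumerate ?I"
  have f: "strict_mono f" "f j \<in> ?I" for j
    using strict_mono_enumerate[OF inf] enumerate_in_set[OF inf] by (auto simp: f_def)
  define s' where "s' = (\<lambda>j. map ((!) (s (f j))) ix)"
  \<comment> \<open>The image of \<open>W\<close> under the projection still concentrates on tuples
    from \<open>M\<close>, so the projected limit type is invariant again.\<close>
  define W' where "W' = {B. (\<lambda>t. map ((!) t) ix) -` B \<in> W}"
  have W'u: "ultrafilter W'" unfolding W'_def by (rule ultrafilter_image[OF W(1)])
  have sub: "map ((!) t) ix \<in> tuples A ?l" if "t \<in> tuples A m" for t and A :: "'m set"
    using that ix by (auto simp: tuples_def intro!: subsetD[OF _ nth_mem])
  have sd: "s n \<in> tuples (dom N) m" for n using s by (simp add: morley_sequence_def)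
  have W't: "tuples M ?l \<in> W'"
    unfolding W'_def using sub by (auto intro!: ultrafilterD(2)[OF W])
  have inv: "invariant_type L N M ?l (avg L N ?l W')" by (rule avg_invariant[OF W'u W't M])
  have "morley_sequence L N M ?l (avg L N ?l W') s'" unfolding morley_sequence_def
  proof (intro allI conjI)
    fix j
    show "s' j \<in> tuples (dom N) ?l" unfolding s'_def by (rule sub[OF sd])
    show "realizes N (s' j) (avg L N ?l W' \<inter> forms L (M \<union> (\<Union>i<j. set (s' i))) ?l)" unfolding realizes_def
    proof
      fix F assume F: "F \<in> avg L N ?l W' \<inter> forms L (M \<union> (\<Union>i<j. set (s' i))) ?l"
      obtain \<phi> c where Fc: "F = (\<phi>, c)" by (metis surj_pair)
      have "set (s' i) \<subseteq> set (s (f i))" for i using sd[of "f i"] ix by (auto simp: s'_def tuples_def intro!: nth_mem)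
      \<comment> \<open>Parameters from earlier members of the subsequence thus come from earlier
        members of \<open>s\<close>.\<close>
      moreover have "f i < f j" if "i < j" for i using f(1) that by (simp add: strict_mono_def)
      ultimately have "M \<union> (\<Union>i<j. set (s' i)) \<subseteq> M \<union> (\<Union>i<f j. set (s i))" by fast
      then have "(\<phi>, c) \<in> forms L (M \<union> (\<Union>i<f j. set (s i))) ?l" using F Fc forms_mono by blast
      note r1 = reindex_forms[OF this ix]
      have "(\<phi>, c) \<in> forms L (dom N) ?l" using F Fc by (simp add: avg_def)
      note r2 = reindex_forms[OF this ix]
      have "(\<lambda>t. map ((!) t) ix) -` {t. holds N t (\<phi>, c)} \<in> W" using F Fc by (simp add: avg_def W'_def)
      then have "(\<lambda>t. map ((!) t) ix) -` {t. holds N t (\<phi>, c)} \<inter> tuples M m \<in> W" using ultrafilterD(3)[OF W(1)] W(2) by blast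
      moreover have "(\<lambda>t. map ((!) t) ix) -` {t. holds N t (\<phi>, c)} \<inter> tuples M m \<subseteq> {t. holds N t (reindex ix m \<phi>, c)}"
        using r2(2)[of _ N] by (auto simp: tuples_def)
      ultimately have "{t. holds N t (reindex ix m \<phi>, c)} \<in> W" by (rule ultrafilterD(2)[OF W(1)])
      then have "(reindex ix m \<phi>, c) \<in> avg L N m W \<inter> forms L (M \<union> (\<Union>i<f j. set (s i))) m"
        using r1(1) r2(1) by (simp add: avg_def)
      then have "holds N (s (f j)) (reindex ix m \<phi>, c)" using s unfolding morley_sequence_def realizes_def by blast
      then show "holds N (s' j) F" using r2(2)[of "s (f j)" N] sd Fc by (simp add: s'_def tuples_def)
    qed
  qed
  moreover obtain \<sigma> where \<sigma>: "automorphism L N \<sigma>" "\<forall>u\<in>M. \<sigma> u = u" "map \<sigma> (s (f 0)) = d" using tp by blast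
  moreover have "map \<sigma> (s' 0) = map ((!) d) ix"
    using \<sigma>(3) ix sd[of "f 0"] by (auto simp: s'_def tuples_def)
  ultimately have "\<exists>i. \<not> holds N y (\<chi>, s' i)"
    using conant_divides_morley[OF G _ _ M(1) \<sigma>(1,2) _ y, of "avg L N ?l W'" s'] inv by simp
  then show False using f(2) by (auto simp: s'_def)
qed

end

section \<open>Symmetry implies \<open>NSOP\<^sub>4\<close>\<close>

lemma map_nth_upt: "r \<le> length E \<Longrightarrow> map ((!) E) [p..<r] = take (r - p) (drop p E)"
  by (rule nth_equalityI) auto

text \<open>Applies the formula to three blocks of a longer assignment, two arguments and the
  parameters, so that statements about several tuples need only block positions.\<close>

lemma formula_at:
  assumes wf: "wf_fm L (k + k + q) \<phi>" and le: "i + k \<le> n" "j + k \<le> n" "l + q \<le> n"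
  obtains \<psi> where "wf_fm L n \<psi>"
    "\<And>E. length E = n \<Longrightarrow> sat N E \<psi> = sat N (take k (drop i E) @ take k (drop j E) @ take q (drop l E)) \<phi>"
proof
  let ?pos = "[i..<i + k] @ [j..<j + k] @ [l..<l + q]"
  have w: "wf_fm L (length ?pos) \<phi>" using wf by (simp add: add.assoc)
  show "wf_fm L n (ren ((!) ?pos) \<phi>)" by (rule ren_list(1)[OF w]) (use le in auto)
  fix E :: "'c list" assume "length E = n"
  then have "map ((!) E) ?pos = take k (drop i E) @ take k (drop j E) @ take q (drop l E)"
    using le by (simp add: map_nth_upt)
  then show "sat N E (ren ((!) ?pos) \<phi>) = sat N (take k (drop i E) @ take k (drop j E) @ take q (drop l E)) \<phi>"
    using ren_list(2)[OF w, of N E] by metis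
qed

context monster_model
begin

text \<open>A formula in \<open>(b0, b1, b2)\<close> over \<open>M\<close>, \<open>(e, e')\<close> that follows from the required properties cannot be
  covered by finitely many Conant-dividing formulas: along a Morley sequence that starts with \<open>(e, e')\<close>
  and their parameters, and whose type is a limit of pairs \<open>(a i, c i)\<close>, one tuple \<open>(a i, u, c j)\<close> solves all
  conjugates, so by the pigeonhole principle it solves infinitely many conjugates of one of them.\<close>

lemma middle_tuple:
  assumes M: "elementary_submodel L N M" "|M| <o \<kappa>"
    and wf: "wf_fm L (k + k + length c0) \<phi>" "set c0 \<subseteq> M" and R: "\<And>x y. R x y \<longleftrightarrow> sat N (x @ y @ c0) \<phi>"
    and a: "\<And>i::nat. a i \<in> tuples M k" and c: "\<And>i::nat. c i \<in> tuples M k"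
    and Raa: "\<And>i j. i < j \<Longrightarrow> R (a i) (a j)" and Rcc: "\<And>i j. i < j \<Longrightarrow> R (c j) (c i)"
    and u: "u \<in> tuples (dom N) k" and Rau: "\<And>i. R (a i) u" and Ruc: "\<And>i. R u (c i)"
    and ua: "\<And>F. F \<in> forms L M k \<Longrightarrow> holds N u F \<Longrightarrow> \<exists>i. holds N (a i) F"
    and uc: "\<And>F. F \<in> forms L M k \<Longrightarrow> holds N u F \<Longrightarrow> \<exists>i. holds N (c i) F"
  shows "\<exists>e e' b0 b1 b2. {e, e', b0, b1, b2} \<subseteq> tuples (dom N) k \<and> R b0 e \<and> R e b1 \<and> R b1 e' \<and> R e' b2 \<and>
    tp L N M b0 = tp L N M u \<and> tp L N M b1 = tp L N M u \<and> tp L N M b2 = tp L N M u \<and>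
    (\<forall>F\<in>forms L (M \<union> set (e @ e')) (k + k + k). holds N (b0 @ b1 @ b2) F \<longrightarrow> \<not> conant_forks L N M (k + k + k) F)"
proof -
  let ?q = "length c0"
  have Md: "M \<subseteq> dom N" using M by (simp add: elementary_submodel_def)
  have tM: "t \<in> tuples (dom N) n" if "t \<in> tuples M n" for t n using that Md by (auto simp: tuples_def)
  have len: "length (a i) = k" "length (c i) = k" "length u = k" for i using a c u by (auto simp: tuples_def)
  have fixM: "map \<sigma> t = t" if "t \<in> tuples M n" "\<forall>v\<in>M. \<sigma> v = v" for t n and \<sigma> :: "'m \<Rightarrow> 'm"
    using that by (intro map_idI) (auto simp: tuples_def)
  have Raut: "R (map \<sigma> x) (map \<sigma> y) = R x y"
    if "automorphism L N \<sigma>" "\<forall>v\<in>M. \<sigma> v = v" "x \<in> tuples (dom N) k" "y \<in> tuples (dom N) k" for \<sigma> x y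
  proof -
    have "x @ y @ c0 \<in> tuples (dom N) (k + k + ?q)" using that wf Md by (auto simp: tuples_def)
    moreover have "map \<sigma> c0 = c0" using wf(2) that(2) by (intro map_idI) auto
    ultimately show ?thesis using automorphism_sat[OF is_struct that(1) wf(1), of "x @ y @ c0"] by (simp add: R)
  qed
  obtain U :: "nat set set" where U: "ultrafilter U" "\<And>n. {n<..} \<in> U" using nonprincipal_ultrafilter by blast
  \<comment> \<open>The image of \<open>U\<close> under the pairing, so \<open>e\<close> and
    \<open>e'\<close> are limits along the same index.\<close>
  define Q where "Q = {B. (\<lambda>i. a i @ c i) -` B \<in> U}"
  have Qu: "ultrafilter Q" unfolding Q_def by (rule ultrafilter_image[OF U(1)])
  have ac: "a i @ c i \<in> tuples M (k + k)" for i using a c tuples_app by blast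
  have "tuples (dom N) (k + k) \<in> Q" using tM[OF ac] ultrafilterD(5)[OF U(1)] by (simp add: Q_def vimage_def)
  note gQ = avg_global[OF Qu this]
  obtain g where g: "g \<in> tuples (dom N) (k + k)" and gr: "realizes N g (avg L N (k + k) Q \<inter> forms L M (k + k))"
    using realize_global[OF gQ Md M(2)] by blast
  have gF: "holds N g F \<longleftrightarrow> {i. holds N (a i @ c i) F} \<in> U" if "F \<in> forms L M (k + k)" for F
    using realizes_global_iff[OF gQ gr Md that] forms_mono[OF Md] that by (auto simp: avg_def Q_def)
  obtain e e' where ge: "g = e @ e'" and e: "e \<in> tuples (dom N) k" "e' \<in> tuples (dom N) k" using tuples_split[OF g] .
  \<comment> \<open>For fixed \<open>j\<close> the relation to \<open>a i\<close> holds for all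
    \<open>i > j\<close>, a set in \<open>U\<close>, and so passes to the limit. The argument for
    \<open>e'\<close> uses that the \<open>c i\<close> decrease.\<close>
  have Rae: "R (a j) e" for j
  proof -
    obtain \<psi> where w: "wf_fm L (k + k + k + ?q) \<psi>" and
      s: "\<And>E. length E = k + k + k + ?q \<Longrightarrow> sat N E \<psi> = sat N (take k (drop (k + k) E) @ take k (drop 0 E) @ take ?q (drop (k + k + k) E)) \<phi>"
      by (rule formula_at[OF wf(1), of "k + k" "k + k + k + ?q" 0 "k + k + k" N]) (simp, simp, simp, erule that, blast)
    have f: "(\<psi>, a j @ c0) \<in> forms L M (k + k)" using w a[of j] wf(2) by (auto simp: forms_def tuples_def add.assoc)
    have "{j<..} \<subseteq> {i. holds N (a i @ c i) (\<psi>, a j @ c0)}" using Raa by (auto simp: holds_def s len R)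
    then have "holds N g (\<psi>, a j @ c0)" using gF[OF f] ultrafilterD(2)[OF U(1) U(2)] by blast
    then show ?thesis using e by (simp add: ge holds_def s len R tuples_def)
  qed
  have Rec: "R e' (c j)" for j
  proof -
    obtain \<psi> where w: "wf_fm L (k + k + k + ?q) \<psi>" and
      s: "\<And>E. length E = k + k + k + ?q \<Longrightarrow> sat N E \<psi> = sat N (take k (drop k E) @ take k (drop (k + k) E) @ take ?q (drop (k + k + k) E)) \<phi>"
      by (rule formula_at[OF wf(1), of k "k + k + k + ?q" "k + k" "k + k + k" N]) (simp, simp, simp, erule that, blast)
    have f: "(\<psi>, c j @ c0) \<in> forms L M (k + k)" using w c[of j] wf(2) by (auto simp: forms_def tuples_def add.assoc)
    have "{j<..} \<subseteq> {i. holds N (a i @ c i) (\<psi>, c j @ c0)}" using Rcc by (auto simp: holds_def s len R)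
    then have "holds N g (\<psi>, c j @ c0)" using gF[OF f] ultrafilterD(2)[OF U(1) U(2)] by blast
    then show ?thesis using e by (simp add: ge holds_def s len R tuples_def)
  qed
  let ?K = "k + k + k"
  define blk where "blk = (\<lambda>j y :: 'm list. take k (drop (j * k) y))"
  define Rc where "Rc = (\<lambda>x x' y. R (blk 0 y) x \<and> R x (blk 1 y) \<and> R (blk 1 y) x' \<and> R x' (blk 2 y))"
  have blks: "blk 0 (y0 @ y1 @ y2) = y0" "blk (Suc 0) (y0 @ y1 @ y2) = y1" "blk 2 (y0 @ y1 @ y2) = y2"
    if "length y0 = k" "length y1 = k" "length y2 = k" for y0 y1 y2 :: "'m list"
    using that by (auto simp: blk_def)
  have blk_tup: "blk j y \<in> tuples A k" if "y \<in> tuples A ?K" "j < 3" for j y and A :: "'m set"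
  proof -
    have "j * k + k \<le> ?K" using that(2) by (auto simp: numeral_3_eq_3 less_Suc_eq)
    then show ?thesis using that(1) by (auto simp: tuples_def blk_def dest!: in_set_takeD in_set_dropD)
  qed
  have blk_map: "map \<sigma> (blk j y) = blk j (map \<sigma> y)" for \<sigma> :: "'m \<Rightarrow> 'm" and j y by (simp add: blk_def take_map drop_map)
  let ?A = "M \<union> set g"
  \<comment> \<open>The finite instances for saturation: \<open>H\<close> is a finite part of the
    type of \<open>u\<close>, imposed on all three blocks, and \<open>D0\<close> consists of
    finitely many forking formulas to be avoided.\<close>
  have core: "\<exists>y\<in>tuples (dom N) ?K. Rc e e' y \<and> (\<forall>j<3. \<forall>h\<in>H. holds N (blk j y) h) \<and> (\<forall>F\<in>D0. \<not> holds N y F)"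
    if H: "finite H" "H \<subseteq> tp L N M u" and D0: "finite D0" "\<forall>F\<in>D0. conant_forks L N M ?K F" for H D0
  proof (rule ccontr)
    assume no: "\<not> ?thesis"
    have "\<exists>D. finite D \<and> (\<forall>G\<in>D. conant_divides L N M ?K G) \<and>
        (\<forall>y\<in>tuples (dom N) ?K. holds N y F \<longrightarrow> (\<exists>G\<in>D. holds N y G))" if "F \<in> D0" for F
      using bspec[OF D0(2) that] by (auto simp: conant_forks_def)
    then obtain DF where DF: "\<And>F. F \<in> D0 \<Longrightarrow> finite (DF F) \<and> (\<forall>G\<in>DF F. conant_divides L N M ?K G) \<and>
        (\<forall>y\<in>tuples (dom N) ?K. holds N y F \<longrightarrow> (\<exists>G\<in>DF F. holds N y G))" by metis
    define D where "D = (\<Union>F\<in>D0. DF F)"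
    have D: "finite D" "\<And>G. G \<in> D \<Longrightarrow> conant_divides L N M ?K G" using D0 DF by (auto simp: D_def)
    have cover: "\<exists>G\<in>D. holds N y G" if yy: "y \<in> tuples (dom N) ?K" "Rc e e' y" "\<And>j h. j < 3 \<Longrightarrow> h \<in> H \<Longrightarrow> holds N (blk j y) h" for y
    proof -
      have "\<exists>F\<in>D0. holds N y F" using no yy by blast
      then obtain F where F: "F \<in> D0" "holds N y F" by blast
      have "\<exists>G\<in>DF F. holds N y G" using DF[OF F(1)] yy(1) F(2) by (elim conjE) (drule bspec, assumption, erule mp, assumption)
      then show ?thesis using F(1) unfolding D_def by blast
    qed
    have "finite (\<Union>G\<in>D. set (snd G))" using D(1) by simp
    \<comment> \<open>The dividing formulas may have parameters outside \<open>M\<close> and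
      \<open>g\<close>. Listing them in front of \<open>g\<close> lets one Morley sequence in the
      type of \<open>d' @ g\<close> serve all formulas in \<open>D\<close>.\<close>
    from finite_list[OF this] obtain d' where d': "set d' = (\<Union>G\<in>D. set (snd G))" by (elim exE)
    have Gf: "G \<in> forms L (dom N) ?K" if "G \<in> D" for G using D(2)[OF that] by (simp add: conant_divides_def)
    have d'd: "set d' \<subseteq> dom N" using Gf d' by (fastforce simp: forms_def)
    let ?l = "length d'" and ?d = "d' @ g"
    let ?m = "?l + (k + k)"
    have dm: "?d \<in> tuples (dom N) ?m" using d'd g by (auto simp: tuples_def)
    define Z where "Z = {t \<in> tuples M ?m. \<exists>i. drop ?l t = a i @ c i}"
    \<comment> \<open>A formula of \<open>d' @ g\<close> over \<open>M\<close> yields, by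
      quantifying out \<open>d'\<close>, a formula of \<open>g\<close>. This holds at some
      \<open>a i @ c i\<close>, and elementarity finds the missing part in \<open>M\<close>. So the
      type of \<open>d' @ g\<close> extends to a limit of tuples in \<open>Z\<close>.\<close>
    have fip: "\<Inter>\<F> \<noteq> {}" if \<F>: "finite \<F>" "\<F> \<subseteq> (\<lambda>F. {t. holds N t F}) ` tp L N M ?d \<union> {Z}" for \<F>
    proof -
      have "finite (\<F> - {Z})" "\<F> - {Z} \<subseteq> (\<lambda>F. {t. holds N t F}) ` tp L N M ?d" using \<F> by auto
      then obtain Fs where Fs: "Fs \<subseteq> tp L N M ?d" "finite Fs" "\<F> - {Z} = (\<lambda>F. {t. holds N t F}) ` Fs"
        by (elim finite_subset_image[THEN exE]) blast+
      have Fsf: "Fs \<subseteq> forms L M ?m" using Fs(1) g by (auto simp: tp_def tuples_def)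
      obtain H where Hf: "H \<in> forms L M ?m" and Hh: "\<And>t. length t = ?m \<Longrightarrow> holds N t H \<longleftrightarrow> (\<forall>F\<in>Fs. holds N t F)"
        using forms_Conj[OF Fs(2) Fsf dom_nonempty] by blast
      obtain \<theta> mm where H: "H = (\<theta>, mm)" by (metis surj_pair)
      have wt: "wf_fm L (?l + (k + k + length mm)) \<theta>" and mm: "set mm \<subseteq> M" using Hf H by (auto simp: forms_def add.assoc)
      have "holds N ?d H" using Hh[of ?d] dm Fs(1) by (auto simp: tuples_def tp_def)
      then have "\<exists>z\<in>tuples (dom N) ?l. sat N (z @ g @ mm) \<theta>" using H d'd
        by (intro bexI[of _ d']) (auto simp: holds_def tuples_def)
      then have "holds N g ((Ex ^^ ?l) \<theta>, mm)" by (simp add: holds_def Ex_power(2))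
      moreover have "((Ex ^^ ?l) \<theta>, mm) \<in> forms L M (k + k)" using Ex_power(1)[OF wt] mm by (simp add: forms_def)
      ultimately have "{i. holds N (a i @ c i) ((Ex ^^ ?l) \<theta>, mm)} \<in> U" using gF by blast
      then obtain i where "holds N (a i @ c i) ((Ex ^^ ?l) \<theta>, mm)" using ultrafilter_nonempty[OF U(1)] by blast
      then obtain z where z: "z \<in> tuples (dom N) ?l" "holds N z (\<theta>, (a i @ c i) @ mm)" by (auto simp: holds_def Ex_power(2))
      have "(\<theta>, (a i @ c i) @ mm) \<in> forms L M ?l" using wt mm ac[of i] len by (auto simp: forms_def tuples_def add.assoc)
      from elementary_ex[OF M(1) this z] obtain z where z: "z \<in> tuples M ?l" "holds N z (\<theta>, (a i @ c i) @ mm)" by blast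
      let ?t = "z @ a i @ c i"
      have t: "?t \<in> tuples M ?m" using z(1) ac[of i] tuples_app by blast
      have "drop ?l ?t = a i @ c i" using z(1) by (simp add: tuples_def)
      then have "?t \<in> Z" using t unfolding Z_def by blast
      moreover have "\<forall>F\<in>Fs. holds N ?t F" using Hh[of ?t] t z(2) H by (auto simp: tuples_def holds_def)
      ultimately have "?t \<in> \<Inter>(insert Z (\<F> - {Z}))" unfolding Fs(3) by auto
      then show ?thesis by blast
    qed
    obtain W where W: "ultrafilter W" and WB: "(\<lambda>F. {t. holds N t F}) ` tp L N M ?d \<union> {Z} \<subseteq> W"
      using ultrafilter_extend[OF fip] by blast
    have WM: "tuples M ?m \<in> W" using WB ultrafilterD(2)[OF W, of Z] by (auto simp: Z_def)
    let ?r = "avg L N ?m W"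
    have inv: "invariant_type L N M ?m ?r" by (rule avg_invariant[OF W WM Md M(2)])
    then have gl: "global_type L N ?m ?r" by (simp add: invariant_type_def)
    \<comment> \<open>The sequence is built over \<open>u\<close> as well, since \<open>a i\<close>
      is related to \<open>u\<close> and \<open>u\<close> to \<open>c i\<close> for all
      \<open>i\<close>; both relations then hold for every member.\<close>
    have Mud: "M \<union> set u \<subseteq> dom N" "|M \<union> set u| <o \<kappa>" using Md u M(2) by (auto simp: tuples_def small_Un_finite)
    obtain s0 where "s0 \<in> tuples (dom N) ?m" "realizes N s0 (?r \<inter> forms L (M \<union> set u) ?m)"
      using realize_global[OF gl Mud] by blast
    from morley_exists[OF gl Mud this] obtain s :: "nat \<Rightarrow> 'm list" where
      s: "\<And>i. s i \<in> tuples (dom N) ?m" and sr: "\<And>i. realizes N (s i) (?r \<inter> forms L (M \<union> set u \<union> (\<Union>j<i. set (s j))) ?m)"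
      by metis
    have srA: "holds N (s i) F" if "F \<in> forms L A ?m" "A \<subseteq> M \<union> set u \<union> (\<Union>j<i. set (s j))" "{t. holds N t F} \<in> W" "A \<subseteq> dom N" for i F A
    proof -
      have "F \<in> ?r \<inter> forms L (M \<union> set u \<union> (\<Union>j<i. set (s j))) ?m"
        unfolding avg_def using that(1,3) forms_mono[OF that(2)] forms_mono[OF that(4)] by blast
      then show ?thesis using sr[of i] unfolding realizes_def by blast
    qed
    have mor: "morley_sequence L N M ?m ?r s" unfolding morley_sequence_def
    proof (intro allI conjI s)
      fix i show "realizes N (s i) (?r \<inter> forms L (M \<union> (\<Union>j<i. set (s j))) ?m)" unfolding realizes_def
        using srA[of _ "M \<union> (\<Union>j<i. set (s j))" i] Md s by (fastforce simp: avg_def tuples_def)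
    qed
    have tps: "tp L N M ?d = tp L N M (s n)" for n
    proof (rule tp_subset_eq)
      show "length ?d = length (s n)" using dm s[of n] by (simp add: tuples_def)
      show "tp L N M ?d \<subseteq> tp L N M (s n)"
      proof
        fix F assume F: "F \<in> tp L N M ?d"
        then have "F \<in> forms L M ?m" using g by (auto simp: tp_def tuples_def)
        moreover from this have "holds N (s n) F" using srA[of F M n] F WB Md by auto
        ultimately show "F \<in> tp L N M (s n)" using s[of n] by (simp add: tp_def tuples_def)
      qed
    qed
    have ex\<sigma>: "\<exists>\<sigma>. automorphism L N \<sigma> \<and> (\<forall>v\<in>M. \<sigma> v = v) \<and> map \<sigma> (s n) = ?d" for n
      using same_type_automorphism[OF Md M(2) s dm tps[symmetric]] by metis
    have snd_split: "\<exists>z f f'. s n = z @ f @ f' \<and> length z = ?l \<and> f \<in> tuples (dom N) k \<and> f' \<in> tuples (dom N) k" for n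
    proof -
      obtain z gg where z: "s n = z @ gg" "z \<in> tuples (dom N) ?l" "gg \<in> tuples (dom N) (k + k)" using tuples_split[OF s[of n]] .
      moreover obtain f f' where "gg = f @ f'" "f \<in> tuples (dom N) k" "f' \<in> tuples (dom N) k" using tuples_split[OF z(3)] .
      ultimately show ?thesis by (auto simp: tuples_def)
    qed
    then obtain z f f' where zf: "\<And>n. s n = z n @ f n @ f' n" "\<And>n. length (z n) = ?l"
      "\<And>n. f n \<in> tuples (dom N) k" "\<And>n. f' n \<in> tuples (dom N) k" by metis
    have lf: "length (f n) = k" "length (f' n) = k" for n using zf(3,4) by (auto simp: tuples_def)
    have Zt: "\<exists>z i. t = z @ a i @ c i \<and> length z = ?l" if "t \<in> Z" for t
    proof -
      obtain i where i: "t \<in> tuples M ?m" "drop ?l t = a i @ c i" using \<open>t \<in> Z\<close> unfolding Z_def by blast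
      then have "t = take ?l t @ a i @ c i" "length (take ?l t) = ?l"
        by (metis append_take_drop_id, simp add: tuples_def)
      then show ?thesis by blast
    qed
    have Rfu: "R (f n) u" for n
    proof -
      obtain \<psi> where w: "wf_fm L (?m + k + ?q) \<psi>" and
        ss: "\<And>E. length E = ?m + k + ?q \<Longrightarrow> sat N E \<psi> = sat N (take k (drop ?l E) @ take k (drop ?m E) @ take ?q (drop (?m + k) E)) \<phi>"
        by (rule formula_at[OF wf(1), of ?l "?m + k + ?q" ?m "?m + k" N]) (simp, simp, simp, erule that, blast)
      have ff: "(\<psi>, u @ c0) \<in> forms L (M \<union> set u) ?m" using w wf(2) len by (auto simp: forms_def add.assoc)
      have "Z \<subseteq> {t. holds N t (\<psi>, u @ c0)}" using Rau by (auto simp: holds_def ss len R dest!: Zt)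
      then have "holds N (s n) (\<psi>, u @ c0)" using srA[OF ff, of n] Mud WB ultrafilterD(2)[OF W, of Z] by auto
      then show ?thesis by (simp add: zf lf holds_def ss len R)
    qed
    have Ruf: "R u (f' n)" for n
    proof -
      obtain \<psi> where w: "wf_fm L (?m + k + ?q) \<psi>" and
        ss: "\<And>E. length E = ?m + k + ?q \<Longrightarrow> sat N E \<psi> = sat N (take k (drop ?m E) @ take k (drop (?l + k) E) @ take ?q (drop (?m + k) E)) \<phi>"
        by (rule formula_at[OF wf(1), of ?m "?m + k + ?q" "?l + k" "?m + k" N]) (simp, simp, simp, erule that, blast)
      have ff: "(\<psi>, u @ c0) \<in> forms L (M \<union> set u) ?m" using w wf(2) len by (auto simp: forms_def add.assoc)
      have "Z \<subseteq> {t. holds N t (\<psi>, u @ c0)}" using Ruc by (auto simp: holds_def ss len R dest!: Zt)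
      then have "holds N (s n) (\<psi>, u @ c0)" using srA[OF ff, of n] Mud WB ultrafilterD(2)[OF W, of Z] by auto
      then show ?thesis by (simp add: zf lf holds_def ss len R)
    qed
    have Hf: "H \<subseteq> forms L M k" using H(2) len by (auto simp: tp_def)
    obtain Hc where Hc: "Hc \<in> forms L M k" "\<And>t. length t = k \<Longrightarrow> holds N t Hc \<longleftrightarrow> (\<forall>h\<in>H. holds N t h)"
      using forms_Conj[OF H(1) Hf dom_nonempty] by blast
    have "holds N u Hc" using Hc(2)[of u] H(2) len by (auto simp: tp_def)
    then obtain i0 n0 where i0: "\<forall>h\<in>H. holds N (a i0) h" and n0: "\<forall>h\<in>H. holds N (c n0) h"
      using ua[OF Hc(1)] uc[OF Hc(1)] Hc(2) len by metis
    \<comment> \<open>The indices are chosen so that the outer blocks satisfy the finite part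
      \<open>H\<close> of the type of \<open>u\<close>; the middle block is \<open>u\<close>
      itself.\<close>
    define y where "y = a i0 @ u @ c n0"
    have y: "y \<in> tuples (dom N) ?K" using tM[OF a] tM[OF c] u by (auto simp: y_def tuples_def)
    have "\<exists>ix. snd G = map ((!) ?d) ix \<and> set ix \<subseteq> {..<?m}" if "G \<in> D" for G
    proof -
      have "set (snd G) \<subseteq> set ?d" using d' that by auto
      then have "\<forall>v\<in>set (snd G). \<exists>i. i < length ?d \<and> ?d ! i = v" by (metis in_set_conv_nth subsetD)
      moreover have "length ?d = ?m" using dm by (simp add: tuples_def)
      ultimately obtain q where q: "\<And>v. v \<in> set (snd G) \<Longrightarrow> q v < ?m \<and> ?d ! q v = v" by metis
      have "map ((!) ?d) (map q (snd G)) = snd G" using q by (auto intro: map_idI)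
      moreover have "set (map q (snd G)) \<subseteq> {..<?m}" using q by auto
      ultimately show ?thesis by metis
    qed
    then obtain ix where ix: "\<And>G. G \<in> D \<Longrightarrow> snd G = map ((!) ?d) (ix G)" "\<And>G. G \<in> D \<Longrightarrow> set (ix G) \<subseteq> {..<?m}" by metis
    \<comment> \<open>An automorphism over \<open>M\<close> takes \<open>s n\<close> to
      \<open>d' @ g\<close> and \<open>y\<close> to a tuple with all required properties relative to
      \<open>e\<close> and \<open>e'\<close>. The dividing formula that covers this tuple is pulled
      back to the \<open>n\<close>-th instance.\<close>
    have "\<exists>G\<in>D. holds N y (fst G, map ((!) (s n)) (ix G))" for n
    proof -
      obtain \<sigma> where \<sigma>: "automorphism L N \<sigma>" "\<forall>v\<in>M. \<sigma> v = v" "map \<sigma> (s n) = ?d" using ex\<sigma> by blast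
      have "map \<sigma> (z n) @ map \<sigma> (f n) @ map \<sigma> (f' n) = d' @ e @ e'" using \<sigma>(3) zf(1)[of n] ge by simp
      then have \<sigma>f: "map \<sigma> (f n) = e" "map \<sigma> (f' n) = e'" using zf(2)[of n] lf[of n] e by (auto simp: tuples_def)
      have my: "map \<sigma> y = a i0 @ map \<sigma> u @ c n0" using fixM[OF a \<sigma>(2)] fixM[OF c \<sigma>(2)] by (simp add: y_def)
      have "Rc e e' (map \<sigma> y)"
        using Raut[OF \<sigma>(1,2) zf(3)[of n] u] Raut[OF \<sigma>(1,2) u zf(4)[of n]] Rfu Ruf Rae Rec
        by (simp add: Rc_def my blks len \<sigma>f)
      moreover have "holds N (blk j (map \<sigma> y)) h" if "j < 3" "h \<in> H" for j h
      proof -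
        have hf: "h \<in> forms L M k" using Hf that by auto
        have "map \<sigma> (snd h) = snd h" using hf \<sigma>(2) by (intro map_idI) (auto simp: forms_def)
        moreover have "holds N u h" using H(2) that by (auto simp: tp_def)
        ultimately have "holds N (map \<sigma> u) h"
          using automorphism_holds[OF is_struct \<sigma>(1), of h k u] hf forms_mono[OF Md] u by auto
        moreover have "j = 0 \<or> j = 1 \<or> j = 2" using that(1) by auto
        ultimately show ?thesis using i0 n0 that(2) by (auto simp: my blks len)
      qed
      ultimately obtain G where G: "G \<in> D" "holds N (map \<sigma> y) G" using cover[OF automorphism_tuples[OF \<sigma>(1) y]] by blast
      have sm: "length (s n) = ?m" using s[of n] by (simp add: tuples_def)
      then have "set (map ((!) (s n)) (ix G)) \<subseteq> dom N"
        using s[of n] ix(2)[OF G(1)] by (auto simp: tuples_def intro!: subsetD[OF _ nth_mem])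
      moreover have "length (map ((!) (s n)) (ix G)) = length (snd G)" using ix(1)[OF G(1)] by (metis length_map)
      ultimately have "(fst G, map ((!) (s n)) (ix G)) \<in> forms L (dom N) ?K" using Gf[OF G(1)] by (simp add: forms_def case_prod_beta)
      from automorphism_holds[OF is_struct \<sigma>(1) this y]
      have "holds N (map \<sigma> y) (fst G, map \<sigma> (map ((!) (s n)) (ix G))) = holds N y (fst G, map ((!) (s n)) (ix G))" by simp
      moreover have "map \<sigma> (map ((!) (s n)) (ix G)) = snd G"
      proof -
        have "map \<sigma> (map ((!) (s n)) (ix G)) = map ((!) (map \<sigma> (s n))) (ix G)" using ix(2)[OF G(1)] sm by auto
        then show ?thesis using ix(1)[OF G(1)] \<sigma>(3) by metis
      qed
      ultimately have "holds N y (fst G, map ((!) (s n)) (ix G))" using G(2) by simp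
      then show ?thesis using G(1) by blast
    qed
    then obtain G where G: "\<And>n. G n \<in> D" "\<And>n. holds N y (fst (G n), map ((!) (s n)) (ix (G n)))" by metis
    have "finite {n. F = G n}" if F: "F \<in> D" for F
    proof -
      have "(fst F, map ((!) ?d) (ix F)) = F" by (rule prod_eqI) (simp_all only: fst_conv snd_conv ix(1)[OF F])
      with D(2)[OF F] have "conant_divides L N M ?K (fst F, map ((!) ?d) (ix F))" by (simp only:)
      then have "finite {n. holds N y (fst F, map ((!) (s n)) (ix F))}"
        by (rule conant_divides_avg[OF _ ix(2)[OF F] W WM Md M(2) mor ex\<sigma> y])
      moreover have "{n. F = G n} \<subseteq> {n. holds N y (fst F, map ((!) (s n)) (ix F))}" using G(2) by auto
      ultimately show ?thesis by (rule rev_finite_subset)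
    qed
    then have "finite (\<Union>F\<in>D. {n. F = G n})" using D(1) by blast
    moreover have "(\<Union>F\<in>D. {n. F = G n}) = UNIV" using G(1) by auto
    ultimately show False by simp
  qed
  \<comment> \<open>The conditions are described by the meaning of the formulas, which makes
    consistency immediate from \<open>core\<close>. Concrete formulas with these meanings are
    exhibited only when the properties of \<open>b\<close> are read off.\<close>
  define \<Sigma>0 where "\<Sigma>0 = {F \<in> forms L ?A ?K. \<forall>y\<in>tuples (dom N) ?K. holds N y F \<longleftrightarrow> Rc e e' y}"
  define \<Sigma>1 where "\<Sigma>1 = {F \<in> forms L ?A ?K. \<exists>h\<in>tp L N M u. \<exists>j<3. \<forall>y\<in>tuples (dom N) ?K. holds N y F \<longleftrightarrow> holds N (blk j y) h}"
  define \<Sigma>2 where "\<Sigma>2 = {(Neg \<psi>, h) |\<psi> h. (\<psi>, h) \<in> forms L ?A ?K \<and> conant_forks L N M ?K (\<psi>, h)}"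
  have Ad: "?A \<subseteq> dom N" "|?A| <o \<kappa>" using Md g M(2) by (auto simp: tuples_def small_Un_finite)
  have sub: "\<Sigma>0 \<union> \<Sigma>1 \<union> \<Sigma>2 \<subseteq> forms L ?A ?K" by (auto simp: \<Sigma>0_def \<Sigma>1_def \<Sigma>2_def forms_Neg)
  have "consistent N ?K (\<Sigma>0 \<union> \<Sigma>1 \<union> \<Sigma>2)" unfolding consistent_def
  proof (intro allI impI)
    fix \<Sigma> assume \<Sigma>: "\<Sigma> \<subseteq> \<Sigma>0 \<union> \<Sigma>1 \<union> \<Sigma>2" "finite \<Sigma>"
    have "\<forall>F\<in>\<Sigma> \<inter> \<Sigma>1. \<exists>h\<in>tp L N M u. \<exists>j<3. \<forall>y\<in>tuples (dom N) ?K. holds N y F \<longleftrightarrow> holds N (blk j y) h"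
      by (auto simp: \<Sigma>1_def)
    then obtain hh where hh: "\<And>F. F \<in> \<Sigma> \<inter> \<Sigma>1 \<Longrightarrow> hh F \<in> tp L N M u \<and> (\<exists>j<3. \<forall>y\<in>tuples (dom N) ?K. holds N y F \<longleftrightarrow> holds N (blk j y) (hh F))"
      by metis
    let ?D0 = "{(\<psi>, h). (Neg \<psi>, h) \<in> \<Sigma> \<inter> \<Sigma>2}"
    have "?D0 = (\<lambda>(\<psi>, h). (Neg \<psi>, h)) -` (\<Sigma> \<inter> \<Sigma>2)" by auto
    moreover have "inj (\<lambda>(\<psi> :: ('f, 'r) fm, h :: 'm list). (Neg \<psi>, h))" by (auto intro: injI)
    ultimately have f0: "finite ?D0" using \<Sigma>(2) by (simp add: finite_vimageI)
    have fk: "\<forall>F\<in>?D0. conant_forks L N M ?K F" by (auto simp: \<Sigma>2_def)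
    have "finite (hh ` (\<Sigma> \<inter> \<Sigma>1))" "hh ` (\<Sigma> \<inter> \<Sigma>1) \<subseteq> tp L N M u" using \<Sigma>(2) hh by auto
    from core[OF this f0 fk] obtain y where y: "y \<in> tuples (dom N) ?K" and y': "Rc e e' y \<and>
      (\<forall>j<3. \<forall>h\<in>hh ` (\<Sigma> \<inter> \<Sigma>1). holds N (blk j y) h) \<and> (\<forall>F\<in>?D0. \<not> holds N y F)" by (elim bexE)
    have "holds N y F" if F: "F \<in> \<Sigma>" for F
    proof -
      consider "F \<in> \<Sigma>0" | "F \<in> \<Sigma>1" | "F \<in> \<Sigma>2" using \<Sigma>(1) F by blast
      then show ?thesis
      proof cases
        case 1 then show ?thesis using y y' unfolding \<Sigma>0_def by simp
      next
        case 2
        then have FI: "F \<in> \<Sigma> \<inter> \<Sigma>1" using F by simp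
        with hh obtain j where j: "j < 3" "\<forall>y\<in>tuples (dom N) ?K. holds N y F \<longleftrightarrow> holds N (blk j y) (hh F)" by metis
        moreover have "holds N (blk j y) (hh F)" using y' j(1) FI by simp
        ultimately show ?thesis using y by simp
      next
        case 3
        then obtain \<psi> h where "F = (Neg \<psi>, h)" by (auto simp: \<Sigma>2_def)
        moreover from this have "(\<psi>, h) \<in> ?D0" using 3 F by simp
        ultimately show ?thesis using y' by (simp only: forms_Neg(2)) blast
      qed
    qed
    then show "\<exists>a\<in>tuples (dom N) ?K. realizes N a \<Sigma>" using y unfolding realizes_def by blast
  qed
  from saturation[OF Ad sub this] obtain b where b: "b \<in> tuples (dom N) ?K" "realizes N b (\<Sigma>0 \<union> \<Sigma>1 \<union> \<Sigma>2)" .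
  have bn: "\<not> conant_forks L N M ?K F" if F: "F \<in> forms L ?A ?K" "holds N b F" for F
  proof
    assume f: "conant_forks L N M ?K F"
    obtain \<psi> h where Fp: "F = (\<psi>, h)" by (metis surj_pair)
    then have "(Neg \<psi>, h) \<in> \<Sigma>2" using F f by (auto simp: \<Sigma>2_def)
    then have "holds N b (Neg \<psi>, h)" using b(2) by (simp add: realizes_def)
    then show False using F(2) Fp by (simp add: forms_Neg)
  qed
  have btp: "tp L N M (blk j b) = tp L N M u" if j: "j < 3" for j
  proof (rule tp_subset_eq[symmetric])
    show "length u = length (blk j b)" using blk_tup[OF b(1) j] len by (simp add: tuples_def)
    show "tp L N M u \<subseteq> tp L N M (blk j b)"
    proof
      fix h assume h: "h \<in> tp L N M u"
      let ?ix = "[j * k..<j * k + k]"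
      have jk: "j * k + k \<le> ?K" using j by (auto simp: numeral_3_eq_3 less_Suc_eq)
      have hf: "(fst h, snd h) \<in> forms L M (length ?ix)" using h len by (simp add: tp_def)
      have ixs: "set ?ix \<subseteq> {..<?K}" using jk by auto
      have mb: "map ((!) y) ?ix = blk j y" if "y \<in> tuples (dom N) ?K" for y
        using that jk by (simp add: map_nth_upt tuples_def blk_def)
      let ?F = "(reindex ?ix ?K (fst h), snd h)"
      have hy: "holds N y ?F = holds N (blk j y) h" if "y \<in> tuples (dom N) ?K" for y
        using reindex_forms(2)[OF hf ixs, of y N] mb[OF that] that by (simp add: tuples_def)
      have "?F \<in> forms L ?A ?K" using reindex_forms(1)[OF hf ixs] forms_mono[of M ?A] by blast
      then have "?F \<in> \<Sigma>1" using h j hy unfolding \<Sigma>1_def by blast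
      then have "holds N (blk j b) h" using hy[OF b(1)] b(2) by (auto simp: realizes_def)
      then show "h \<in> tp L N M (blk j b)" using h len blk_tup[OF b(1) j] by (simp add: tp_def tuples_def)
    qed
  qed
  have bRc: "Rc e e' b"
  proof -
    let ?n = "?K + (k + k + ?q)"
    obtain \<psi>1 where w1: "wf_fm L ?n \<psi>1" and s1:
      "\<And>E. length E = ?n \<Longrightarrow> sat N E \<psi>1 = sat N (take k (drop 0 E) @ take k (drop ?K E) @ take ?q (drop (?K + (k + k)) E)) \<phi>"
      by (rule formula_at[OF wf(1), of 0 ?n ?K "?K + (k + k)" N]) (simp, simp, simp, erule that, blast)
    obtain \<psi>2 where w2: "wf_fm L ?n \<psi>2" and s2:
      "\<And>E. length E = ?n \<Longrightarrow> sat N E \<psi>2 = sat N (take k (drop ?K E) @ take k (drop k E) @ take ?q (drop (?K + (k + k)) E)) \<phi>"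
      by (rule formula_at[OF wf(1), of ?K ?n k "?K + (k + k)" N]) (simp, simp, simp, erule that, blast)
    obtain \<psi>3 where w3: "wf_fm L ?n \<psi>3" and s3:
      "\<And>E. length E = ?n \<Longrightarrow> sat N E \<psi>3 = sat N (take k (drop k E) @ take k (drop (?K + k) E) @ take ?q (drop (?K + (k + k)) E)) \<phi>"
      by (rule formula_at[OF wf(1), of k ?n "?K + k" "?K + (k + k)" N]) (simp, simp, simp, erule that, blast)
    obtain \<psi>4 where w4: "wf_fm L ?n \<psi>4" and s4:
      "\<And>E. length E = ?n \<Longrightarrow> sat N E \<psi>4 = sat N (take k (drop (?K + k) E) @ take k (drop (k + k) E) @ take ?q (drop (?K + (k + k)) E)) \<phi>"
      by (rule formula_at[OF wf(1), of "?K + k" ?n "k + k" "?K + (k + k)" N]) (simp, simp, simp, erule that, blast)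
    let ?F = "(Conj \<psi>1 (Conj \<psi>2 (Conj \<psi>3 \<psi>4)), g @ c0)"
    have "?F \<in> forms L ?A ?K" using w1 w2 w3 w4 wf(2) g by (auto simp: forms_def tuples_def)
    moreover have "holds N y ?F \<longleftrightarrow> Rc e e' y" if "y \<in> tuples (dom N) ?K" for y
      using that e by (simp add: ge holds_def s1 s2 s3 s4 R Rc_def tuples_def blk_def mult_2)
    ultimately have "?F \<in> \<Sigma>0" by (auto simp: \<Sigma>0_def)
    then have "holds N b ?F" using b(2) by (auto simp: realizes_def)
    then show ?thesis using \<open>\<And>y. y \<in> tuples (dom N) ?K \<Longrightarrow> holds N y ?F \<longleftrightarrow> Rc e e' y\<close>[OF b(1)] by simp
  qed
  have bb: "b = blk 0 b @ blk 1 b @ blk 2 b"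
  proof -
    have "take k (drop (2 * k) b) = drop (2 * k) b" using b(1) by (simp add: tuples_def)
    then show ?thesis unfolding blk_def by (simp add: append_take_drop_id mult_2 flip: drop_drop)
  qed
  show ?thesis
    by (rule exI[of _ e], rule exI[of _ e'], rule exI[of _ "blk 0 b"], rule exI[of _ "blk 1 b"], rule exI[of _ "blk 2 b"])
      (use bRc btp bn bb ge e blk_tup[OF b(1)] in \<open>auto simp: Rc_def\<close>)
qed

text \<open>Each stage of the hull is given a realization of \<open>p\<close> over that stage, so
  the model contains a sequence approximating \<open>p\<close> over itself.\<close>

lemma limit_model:
  assumes p: "global_type L N k p" and A: "A \<subseteq> dom N" "|A| \<le>o |flas L|"
  obtains X c where "X 0 = A" "\<And>n. X n \<subseteq> X (Suc n)" "\<And>n. X n \<subseteq> dom N" "\<And>n. |X n| <o \<kappa>"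
    "elementary_submodel L N (\<Union>n. X n)" "|\<Union>n. X n| <o \<kappa>"
    "\<And>n. set (c n) \<subseteq> X (Suc n)" "\<And>n. c n \<in> tuples (dom N) k"
    "\<And>n. realizes N (c n) (p \<inter> forms L (X n) k)"
proof -
  \<comment> \<open>The value \<open>[]\<close> outside small subsets ensures that the entries of
    \<open>g X\<close> lie in the structure for every \<open>X\<close>, as the hull construction
    demands.\<close>
  define g where "g = (\<lambda>X. if X \<subseteq> dom N \<and> |X| <o \<kappa> then SOME t. t \<in> tuples (dom N) k \<and> realizes N t (p \<inter> forms L X k) else [])"
  have g: "g X \<in> tuples (dom N) k \<and> realizes N (g X) (p \<inter> forms L X k)" if X: "X \<subseteq> dom N" "|X| <o \<kappa>" for X
  proof -
    obtain t where "t \<in> tuples (dom N) k \<and> realizes N t (p \<inter> forms L X k)" using realize_global[OF p X] by blast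
    from someI[of "\<lambda>t. t \<in> tuples (dom N) k \<and> realizes N t (p \<inter> forms L X k)", OF this] show ?thesis
      using X by (simp add: g_def)
  qed
  have gd: "set (g X) \<subseteq> dom N" for X
  proof (cases "X \<subseteq> dom N \<and> |X| <o \<kappa>")
    case True
    then show ?thesis using g[of X] by (simp add: tuples_def)
  next
    case False
    then have "g X = []" unfolding g_def by (rule if_not_P)
    then show ?thesis by simp
  qed
  obtain X where X: "X 0 = A" "\<And>n. X n \<subseteq> X (Suc n)" "\<And>n. set (g (X n)) \<subseteq> X (Suc n)"
    "\<And>n. |X n| \<le>o |flas L|" "elementary_submodel L N (\<Union>n. X n)" "|\<Union>n. X n| \<le>o |flas L|"
    using elementary_hull[OF is_struct A, of g] gd by metis
  have d: "X n \<subseteq> dom N" for n using X(5) by (auto simp: elementary_submodel_def)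
  have s: "|X n| <o \<kappa>" "|\<Union>n. X n| <o \<kappa>" for n
    using X(4,6) flas_less ordLeq_ordLess_trans by blast+
  show ?thesis
    by (rule that[of X "\<lambda>n. g (X n)"]) (use X d s g in \<open>simp_all\<close>)
qed

theorem symmetric_imp_NSOP4:
  assumes sym: "conant_symmetric L \<kappa> N"
  shows "NSOP L N 4"
proof
  assume "SOP L N 4"
  then obtain k \<phi> c0 where wf: "wf_fm L (k + k + length c0) \<phi>" and c0: "set c0 \<subseteq> dom N"
    and cyc: "\<not> (\<exists>x :: nat \<Rightarrow> 'm list. \<forall>i<4. x i \<in> tuples (dom N) k \<and> sat N (x i @ x (Suc i mod 4) @ c0) \<phi>)"
    and ex: "\<exists>a :: nat \<Rightarrow> 'm list. (\<forall>i. a i \<in> tuples (dom N) k) \<and> (\<forall>i j. i < j \<longrightarrow> sat N (a i @ a j @ c0) \<phi>)"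
    unfolding SOP_def by blast
  define R where "R = (\<lambda>x y. sat N (x @ y @ c0) \<phi>)"
  have R: "R x y \<longleftrightarrow> sat N (x @ y @ c0) \<phi>" for x y by (simp add: R_def)
  obtain a :: "nat \<Rightarrow> 'm list" where a: "\<And>i. a i \<in> tuples (dom N) k" and Raa: "\<And>i j. i < j \<Longrightarrow> R (a i) (a j)"
    using ex R by blast
  let ?q = "length c0"
  have no4: False if x: "x0 \<in> tuples (dom N) k" "x1 \<in> tuples (dom N) k" "x2 \<in> tuples (dom N) k" "x3 \<in> tuples (dom N) k"
    "R x0 x1" "R x1 x2" "R x2 x3" "R x3 x0" for x0 x1 x2 x3
  proof -
    let ?x = "\<lambda>i::nat. if i = 0 then x0 else if i = 1 then x1 else if i = 2 then x2 else x3"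
    have "?x i \<in> tuples (dom N) k \<and> sat N (?x i @ ?x (Suc i mod 4) @ c0) \<phi>" if i4: "i < 4" for i
    proof -
      consider "i = 0" | "i = 1" | "i = 2" | "i = 3" using i4 by linarith
      then show ?thesis using x by cases (auto simp: R)
    qed
    then have "\<forall>i<4. ?x i \<in> tuples (dom N) k \<and> sat N (?x i @ ?x (Suc i mod 4) @ c0) \<phi>" by (intro allI impI)
    then have "\<exists>x :: nat \<Rightarrow> 'm list. \<forall>i<4. x i \<in> tuples (dom N) k \<and> sat N (x i @ x (Suc i mod 4) @ c0) \<phi>" by (rule exI[of _ ?x])
    then show False using cyc by (rule notE[rotated])
  qed
  obtain U :: "nat set set" where U: "ultrafilter U" "\<And>n. {n<..} \<in> U" using nonprincipal_ultrafilter by blast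
  define P where "P = {B. a -` B \<in> U}"
  have Pu: "ultrafilter P" unfolding P_def by (rule ultrafilter_image[OF U(1)])
  have "tuples (dom N) k \<in> P" using a ultrafilterD(5)[OF U(1)] by (simp add: P_def vimage_def)
  note gP = avg_global[OF Pu this]
  \<comment> \<open>The hull starts with the chain and the parameters of \<open>R\<close>, so all of
    them lie in \<open>M\<close> and are fixed by automorphisms over \<open>M\<close>.\<close>
  let ?A = "set c0 \<union> (\<Union>i. set (a i))"
  have Ad: "?A \<subseteq> dom N" using c0 a by (auto simp: tuples_def)
  have cA: "|?A| \<le>o |flas L|"
  proof -
    have fin: "|set l| \<le>o |flas L|" for l :: "'m list"
      by (rule ordLess_imp_ordLeq, rule finite_ordLess_infinite)
        (simp_all add: infinite_flas Field_card_of card_of_well_order_on)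
    have "|\<Union>i. set (a i)| \<le>o |flas L|"
      using card_of_UNION_ordLeq_infinite[OF infinite_flas[of L], of UNIV "\<lambda>i. set (a i)"] fin infinite_flas[of L]
      by (simp add: infinite_iff_card_of_nat)
    then show ?thesis using fin
      by (simp add: card_of_Un_ordLeq_infinite_Field Field_card_of card_of_card_order_on infinite_flas)
  qed
  obtain X c where X: "X 0 = ?A" "\<And>n. X n \<subseteq> X (Suc n)" "\<And>n. X n \<subseteq> dom N" "\<And>n. |X n| <o \<kappa>"
    and Mel: "elementary_submodel L N (\<Union>n. X n)" and Msm: "|\<Union>n. X n| <o \<kappa>"
    and cX: "\<And>n. set (c n) \<subseteq> X (Suc n)" and c: "\<And>n. c n \<in> tuples (dom N) k"
    and cr: "\<And>n. realizes N (c n) (avg L N k P \<inter> forms L (X n) k)"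
    using limit_model[OF gP Ad cA] by metis
  define M where "M = (\<Union>n. X n)"
  have M: "elementary_submodel L N M" "|M| <o \<kappa>" "M \<subseteq> dom N" using Mel Msm X(3) by (auto simp: M_def)
  have Xm: "i \<le> j \<Longrightarrow> X i \<subseteq> X j" for i j by (rule lift_Suc_mono_le[of X]) (use X(2) in auto)
  have iff: "holds N t F \<longleftrightarrow> {i. holds N (a i) F} \<in> U"
    if "realizes N t (avg L N k P \<inter> forms L B k)" "B \<subseteq> dom N" "F \<in> forms L B k" for t B F
    using realizes_global_iff[OF gP that] forms_mono[OF that(2)] that(3) by (auto simp: avg_def P_def)
  have len: "length (a i) = k" "length (c i) = k" for i using a c by (auto simp: tuples_def)
  have aX: "set (a i) \<subseteq> X n" and c0X: "set c0 \<subseteq> X n" for i n using X(1) Xm[of 0 n] by auto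
  have aM: "a i \<in> tuples M k" for i using a[of i] aX[of i 0] by (auto simp: tuples_def M_def)
  have cM: "c i \<in> tuples M k" for i using c[of i] cX[of i] by (auto simp: tuples_def M_def)
  have c0M: "set c0 \<subseteq> M" using c0X[of 0] by (auto simp: M_def)
  have lim1: "R v t" if t: "realizes N t (avg L N k P \<inter> forms L B k)" "B \<subseteq> dom N" "t \<in> tuples (dom N) k"
    and v: "set v \<subseteq> B" "length v = k" "set c0 \<subseteq> B" "{i. R v (a i)} \<in> U" for t B v
  proof -
    obtain \<psi> where w: "wf_fm L (k + k + ?q) \<psi>" and
      s: "\<And>E. length E = k + k + ?q \<Longrightarrow> sat N E \<psi> = sat N (take k (drop k E) @ take k (drop 0 E) @ take ?q (drop (k + k) E)) \<phi>"
      by (rule formula_at[OF wf, of k "k + k + ?q" 0 "k + k" N]) (simp, simp, simp, erule that, blast)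
    have f: "(\<psi>, v @ c0) \<in> forms L B k" using w v by (auto simp: forms_def add.assoc)
    have "{i. holds N (a i) (\<psi>, v @ c0)} = {i. R v (a i)}" by (auto simp: holds_def s len v R)
    then have "holds N t (\<psi>, v @ c0)" using iff[OF t(1,2) f] v(4) by simp
    then show ?thesis using t(3) v by (simp add: holds_def s len R tuples_def)
  qed
  have lim2: "R t v" if t: "realizes N t (avg L N k P \<inter> forms L B k)" "B \<subseteq> dom N" "t \<in> tuples (dom N) k"
    and v: "set v \<subseteq> B" "length v = k" "set c0 \<subseteq> B" "{i. R (a i) v} \<in> U" for t B v
  proof -
    have f: "(\<phi>, v @ c0) \<in> forms L B k" using wf v by (auto simp: forms_def add.assoc)
    have "{i. holds N (a i) (\<phi>, v @ c0)} = {i. R (a i) v}" by (auto simp: holds_def R)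
    then have "holds N t (\<phi>, v @ c0)" using iff[OF t(1,2) f] v(4) by simp
    then show ?thesis by (simp add: holds_def R)
  qed
  have Ra: "R (a i) t" if t: "realizes N t (avg L N k P \<inter> forms L B k)" "B \<subseteq> dom N" "t \<in> tuples (dom N) k" "X 0 \<subseteq> B" for t B i
  proof (rule lim1[OF t(1-3)])
    show "{j. R (a i) (a j)} \<in> U" by (rule ultrafilterD(2)[OF U(1) U(2)[of i]]) (use Raa in auto)
  qed (use t(4) aX[of i 0] c0X[of 0] len in auto)
  have Rac: "R (a i) (c j)" for i j by (rule Ra[OF cr X(3) c Xm]) simp
  have UU: "UNIV \<in> U" by (rule ultrafilterD(5)[OF U(1)])
  \<comment> \<open>Every \<open>a n\<close> is related to \<open>c i\<close>, so the limit type
    contains \<open>R\<close> with second argument \<open>c i\<close>, and \<open>c j\<close>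
    realizes it over a stage containing \<open>c i\<close>. This reverses the direction of the
    chain.\<close>
  have Rcc: "R (c j) (c i)" if "i < j" for i j
  proof (rule lim2[OF cr X(3) c])
    show "set (c i) \<subseteq> X j" using cX[of i] Xm[of "Suc i" j] that by auto
    show "{n. R (a n) (c i)} \<in> U" using Rac UU by simp
  qed (use len c0X in auto)
  obtain u where u: "u \<in> tuples (dom N) k" "realizes N u (avg L N k P \<inter> forms L M k)"
    using realize_global[OF gP M(3,2)] by blast
  have Rau: "R (a i) u" for i by (rule Ra[OF u(2) M(3) u(1)]) (auto simp: M_def)
  have Ruc: "R u (c i)" for i
  proof (rule lim2[OF u(2) M(3) u(1)])
    show "set (c i) \<subseteq> M" using cM[of i] by (simp add: tuples_def)
    show "{n. R (a n) (c i)} \<in> U" using Rac UU by simp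
  qed (use len c0M in auto)
  have ua: "\<exists>i. holds N (a i) F" if "F \<in> forms L M k" "holds N u F" for F
    using iff[OF u(2) M(3) that(1)] that(2) ultrafilter_nonempty[OF U(1)] by blast
  \<comment> \<open>The parameters of \<open>F\<close> already lie in some stage \<open>X n\<close>,
    and over this stage \<open>c n\<close> and \<open>u\<close> realize the same limit type.\<close>
  have uc: "\<exists>i. holds N (c i) F" if F: "F \<in> forms L M k" "holds N u F" for F
  proof -
    have "\<exists>n. set l \<subseteq> X n" if "set l \<subseteq> M" for l :: "'m list" using that
    proof (induction l)
      case (Cons v l)
      then obtain i j where "v \<in> X i" "set l \<subseteq> X j" by (auto simp: M_def)
      then have "set (v # l) \<subseteq> X (max i j)" using Xm[of i "max i j"] Xm[of j "max i j"] by auto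
      then show ?case by blast
    qed auto
    moreover have "set (snd F) \<subseteq> M" using F(1) by (auto simp: forms_def)
    ultimately obtain n where "set (snd F) \<subseteq> X n" by metis
    then have "F \<in> forms L (X n) k" using F(1) by (auto simp: forms_def)
    then have "holds N (c n) F" using iff[OF cr X(3)] iff[OF u(2) M(3) F(1)] F(2) by simp
    then show ?thesis by blast
  qed
  from middle_tuple[OF M(1,2) wf c0M R aM cM Raa Rcc u(1) Rau Ruc ua uc]
  obtain e e' b0 b1 b2 where t: "{e, e', b0, b1, b2} \<subseteq> tuples (dom N) k"
    and Re: "R b0 e" "R e b1" "R b1 e'" "R e' b2"
    and tpb: "tp L N M b0 = tp L N M u" "tp L N M b1 = tp L N M u" "tp L N M b2 = tp L N M u"
    and nf: "\<forall>F\<in>forms L (M \<union> set (e @ e')) (k + k + k). holds N (b0 @ b1 @ b2) F \<longrightarrow> \<not> conant_forks L N M (k + k + k) F"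
    by metis
  let ?g = "e @ e'" and ?b = "b0 @ b1 @ b2"
  have lb: "length e = k" "length e' = k" "length b0 = k" "length b1 = k" "length b2 = k"
    and sb: "set e \<subseteq> dom N" "set e' \<subseteq> dom N" "set b0 \<subseteq> dom N" "set b1 \<subseteq> dom N" "set b2 \<subseteq> dom N"
    using t by (auto simp: tuples_def)
  have "conant_indep L N M (set ?b) (set ?g)"
    by (rule conant_indep_tuple[where n = "k + k + k"]) (use t nf M(3) in \<open>auto simp: tuples_def\<close>)
  moreover have "conant_indep L N M (set ?b) (set ?g) \<longleftrightarrow> conant_indep L N M (set ?g) (set ?b)"
    using sym[unfolded conant_symmetric_def, rule_format, of M "set ?b" "set ?g"] M(1,2) sb by (simp add: small_finite)
  ultimately have ind: "conant_indep L N M (set ?g) (set ?b)" by simp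
  let ?K = "k + k + k" let ?n = "k + k + (?K + ?q)"
  obtain \<psi>1 where w1: "wf_fm L ?n \<psi>1" and s1:
    "\<And>E. length E = ?n \<Longrightarrow> sat N E \<psi>1 = sat N (take k (drop (k + k) E) @ take k (drop 0 E) @ take ?q (drop (k + k + ?K) E)) \<phi>"
    by (rule formula_at[OF wf, of "k + k" ?n 0 "k + k + ?K" N]) (simp, simp, simp, erule that, blast)
  obtain \<psi>2 where w2: "wf_fm L ?n \<psi>2" and s2:
    "\<And>E. length E = ?n \<Longrightarrow> sat N E \<psi>2 = sat N (take k (drop 0 E) @ take k (drop ?K E) @ take ?q (drop (k + k + ?K) E)) \<phi>"
    by (rule formula_at[OF wf, of 0 ?n ?K "k + k + ?K" N]) (simp, simp, simp, erule that, blast)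
  obtain \<psi>3 where w3: "wf_fm L ?n \<psi>3" and s3:
    "\<And>E. length E = ?n \<Longrightarrow> sat N E \<psi>3 = sat N (take k (drop ?K E) @ take k (drop k E) @ take ?q (drop (k + k + ?K) E)) \<phi>"
    by (rule formula_at[OF wf, of ?K ?n k "k + k + ?K" N]) (simp, simp, simp, erule that, blast)
  obtain \<psi>4 where w4: "wf_fm L ?n \<psi>4" and s4:
    "\<And>E. length E = ?n \<Longrightarrow> sat N E \<psi>4 = sat N (take k (drop k E) @ take k (drop (?K + k) E) @ take ?q (drop (k + k + ?K) E)) \<phi>"
    by (rule formula_at[OF wf, of k ?n "?K + k" "k + k + ?K" N]) (simp, simp, simp, erule that, blast)
  let ?\<psi> = "Conj \<psi>1 (Conj \<psi>2 (Conj \<psi>3 \<psi>4))"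
  have h\<psi>: "holds N (f @ f') (?\<psi>, d0 @ d1 @ d2 @ c0) \<longleftrightarrow> R d0 f \<and> R f d1 \<and> R d1 f' \<and> R f' d2"
    if "length f = k" "length f' = k" "length d0 = k" "length d1 = k" "length d2 = k" for f f' d0 d1 d2
    using that by (simp add: holds_def s1 s2 s3 s4 R)
  have f\<psi>: "(?\<psi>, ?b @ c0) \<in> forms L (M \<union> set ?b) (k + k)" using w1 w2 w3 w4 lb c0M by (auto simp: forms_def add.assoc)
  have "(?\<psi>, ?b @ c0) \<in> tp L N (M \<union> set ?b) ?g"
    using f\<psi> h\<psi>[OF lb] Re lb by (simp add: tp_def)
  moreover have "?g \<in> lists (set ?g)" by auto
  ultimately have "\<not> conant_forks L N M (k + k) (?\<psi>, ?b @ c0)" using ind lb unfolding conant_indep_def by fastforce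
  then have nd: "\<not> conant_divides L N M (k + k) (?\<psi>, ?b @ c0)" using conant_divides_forks by blast
  have Mb: "M \<union> set ?b \<subseteq> dom N" using M(3) sb by auto
  have "(?\<psi>, ?b @ c0) \<in> forms L (dom N) (k + k)" using f\<psi> forms_mono[OF Mb] by blast
  \<comment> \<open>The parameters \<open>c0\<close> belong to the tuple on which the Morley
    sequence is built. Since they lie in \<open>M\<close>, the second member is again a triple
    followed by \<open>c0\<close>.\<close>
  with nd obtain p s where p: "invariant_type L N M (length (?b @ c0)) p" and s: "morley_sequence L N M (length (?b @ c0)) p s"
    and s0: "s 0 = ?b @ c0" and con: "consistent N (k + k) {(?\<psi>, s i) |i. True}"
    unfolding conant_divides_def by auto
  let ?m = "length (?b @ c0)"
  have gp: "global_type L N ?m p" using p by (simp add: invariant_type_def)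
  have sd: "s i \<in> tuples (dom N) ?m" for i using s by (simp add: morley_sequence_def)
  have sr: "realizes N (s i) (p \<inter> forms L (M \<union> (\<Union>j<i. set (s j))) ?m)" for i using s by (simp add: morley_sequence_def)
  have "tp L N M (s i) = p \<inter> forms L M ?m" for i
  proof -
    have "realizes N (s i) (p \<inter> forms L M ?m)" using sr[of i] forms_mono[of M "M \<union> (\<Union>j<i. set (s j))"] by (auto simp: realizes_def)
    from realizes_global_iff[OF gp this M(3)] show ?thesis using sd[of i] by (auto simp: tp_def tuples_def)
  qed
  then have "tp L N M (s 0) = tp L N M (s 1)" by simp
  then obtain \<sigma> where \<sigma>: "automorphism L N \<sigma>" "\<forall>v\<in>M. \<sigma> v = v" "map \<sigma> (s 0) = s 1"
    using same_type_automorphism[OF M(3,2) sd sd] by metis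
  define d0 d1 d2 where "d0 = map \<sigma> b0" "d1 = map \<sigma> b1" "d2 = map \<sigma> b2"
  have "map \<sigma> c0 = c0" using c0M \<sigma>(2) by (intro map_idI) auto
  then have s1d: "s 1 = d0 @ d1 @ d2 @ c0" using \<sigma>(3) s0 by (simp add: d0_d1_d2_def)
  have d: "d0 \<in> tuples (dom N) k" "d1 \<in> tuples (dom N) k" "d2 \<in> tuples (dom N) k"
    using t automorphism_tuples[OF \<sigma>(1)] by (auto simp: d0_d1_d2_def)
  have ld: "length d0 = k" "length d1 = k" "length d2 = k" using d by (auto simp: tuples_def)
  have "\<exists>f\<in>tuples (dom N) (k + k). realizes N f {(?\<psi>, s 0), (?\<psi>, s 1)}"
    using con unfolding consistent_def by (rule allE[of _ "{(?\<psi>, s 0), (?\<psi>, s 1)}"]) auto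
  then obtain ff where ff: "ff \<in> tuples (dom N) (k + k)" "holds N ff (?\<psi>, s 0)" "holds N ff (?\<psi>, s 1)"
    by (auto simp: realizes_def)
  obtain f f' where f: "ff = f @ f'" "f \<in> tuples (dom N) k" "f' \<in> tuples (dom N) k" using tuples_split[OF ff(1)] .
  then have lf: "length f = k" "length f' = k" by (auto simp: tuples_def)
  have R0: "R b0 f" "R f b1" "R b1 f'" "R f' b2" using ff(2) h\<psi>[OF lf lb(3-5)] by (simp_all add: f s0)
  have R1: "R d0 f" "R f d1" "R d1 f'" "R f' d2" using ff(3) h\<psi>[OF lf ld] unfolding f(1) s1d by simp_all
  let ?l = "k + (?K + ?q + (k + ?q))"
  obtain \<chi>1 where x1: "wf_fm L ?l \<chi>1" and y1:
    "\<And>E. length E = ?l \<Longrightarrow> sat N E \<chi>1 = sat N (take k (drop (k + ?K + ?q) E) @ take k (drop 0 E) @ take ?q (drop (k + ?K + ?q + k) E)) \<phi>"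
    by (rule formula_at[OF wf, of "k + ?K + ?q" ?l 0 "k + ?K + ?q + k" N]) (simp, simp, simp, erule that, blast)
  obtain \<chi>2 where x2: "wf_fm L ?l \<chi>2" and y2:
    "\<And>E. length E = ?l \<Longrightarrow> sat N E \<chi>2 = sat N (take k (drop 0 E) @ take k (drop (k + k) E) @ take ?q (drop (k + ?K + ?q + k) E)) \<phi>"
    by (rule formula_at[OF wf, of 0 ?l "k + k" "k + ?K + ?q + k" N]) (simp, simp, simp, erule that, blast)
  \<comment> \<open>Expresses a path of length two from the parameter to the middle block of the
    variable. Having \<open>z\<close> quantified leaves \<open>b0\<close> as the only parameter that
    is exchanged.\<close>
  let ?\<chi> = "(Ex ^^ k) (Conj \<chi>1 \<chi>2)"
  have h\<chi>: "holds N (s 1) (?\<chi>, w @ c0) \<longleftrightarrow> (\<exists>z\<in>tuples (dom N) k. R w z \<and> R z d1)" if "length w = k" for w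
    unfolding holds_def Ex_power(2) fst_conv snd_conv s1d
    by (rule bex_cong[OF refl]) (simp add: tuples_def y1 y2 that ld R)
  have m: "?m = ?K + ?q" using lb by simp
  have f\<chi>: "(?\<chi>, w @ c0) \<in> forms L (M \<union> (\<Union>j<1. set (s j))) ?m" if "length w = k" "set w \<subseteq> set ?b" for w
    using Ex_power(1)[of L k "?K + ?q + (k + ?q)" "Conj \<chi>1 \<chi>2"] x1 x2 that c0M unfolding m
    by (auto simp: forms_def s0)
  have B: "M \<union> (\<Union>j<1. set (s j)) \<subseteq> dom N" using M(3) sd by (auto simp: tuples_def)
  have sub: "set b0 \<subseteq> set ?b" "set b2 \<subseteq> set ?b" by auto
  have "holds N (s 1) (?\<chi>, b0 @ c0)" using h\<chi>[OF lb(3)] R0(1) R1(2) f(2) by blast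
  then have "(?\<chi>, b0 @ c0) \<in> p" using realizes_global_iff[OF gp sr B f\<chi>[OF lb(3) sub(1)]] by simp
  \<comment> \<open>Invariance sees only types over \<open>M\<close>, and there \<open>b0\<close>
    and \<open>b2\<close> both have the type of \<open>u\<close>.\<close>
  moreover have "tp L N M (b0 @ c0) = tp L N M (b2 @ c0)"
  proof -
    obtain \<tau> where \<tau>: "automorphism L N \<tau>" "\<forall>v\<in>M. \<tau> v = v" "map \<tau> b0 = b2"
      using same_type_automorphism[OF M(3,2), of b0 k b2] t tpb by auto
    have "map \<tau> c0 = c0" using c0M \<tau>(2) by (intro map_idI) auto
    then show ?thesis using automorphism_tp[OF is_struct \<tau>(1,2) M(3), of "b0 @ c0"] sb c0 \<tau>(3) by simp
  qed
  ultimately have "(?\<chi>, b2 @ c0) \<in> p" using p sb c0 lb unfolding invariant_type_def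
    by (metis (no_types, lifting) Un_least length_append set_append)
  then have "holds N (s 1) (?\<chi>, b2 @ c0)" using realizes_global_iff[OF gp sr B f\<chi>[OF lb(5) sub(2)]] by simp
  then obtain z where "z \<in> tuples (dom N) k" "R b2 z" "R z d1" using h\<chi>[OF lb(5)] by blast
  \<comment> \<open>The cycle is \<open>b2\<close>, \<open>z\<close>, \<open>d1\<close>,
    \<open>f'\<close>, mixing the first and the second triple of the sequence.\<close>
  then show False using no4[of z d1 f' b2] R1(3) R0(4) d(2) f(3) t by blast
qed

end

section \<open>The strong order properties get weaker with decreasing index\<close>

text \<open>It is enough to stretch one edge of a 4-cycle to a path of length \<open>m - 3\<close>
  to obtain a closed walk of length \<open>m\<close>. Vertices may repeat, as \<open>SOP\<close>
  allows.\<close>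

lemma SOP_4:
  fixes N :: "('m, 'f, 'r) struct"
  assumes "SOP L N m" "m \<ge> 4"
  shows "SOP L N 4"
proof -
  obtain k \<phi> c where wf: "wf_fm L (k + k + length c) \<phi>" and c: "set c \<subseteq> dom N"
    and cyc: "\<not> (\<exists>x :: nat \<Rightarrow> 'm list. \<forall>i<m. x i \<in> tuples (dom N) k \<and> sat N (x i @ x (Suc i mod m) @ c) \<phi>)"
    and ex: "\<exists>a :: nat \<Rightarrow> 'm list. (\<forall>i. a i \<in> tuples (dom N) k) \<and> (\<forall>i j. i < j \<longrightarrow> sat N (a i @ a j @ c) \<phi>)"
    using assms(1) unfolding SOP_def by blast
  define R where "R = (\<lambda>x y. sat N (x @ y @ c) \<phi>)"
  obtain a :: "nat \<Rightarrow> 'm list" where a: "\<And>i. a i \<in> tuples (dom N) k" and Raa: "\<And>i j. i < j \<Longrightarrow> R (a i) (a j)"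
    using ex unfolding R_def by blast
  let ?q = "length c" let ?t = "tuples (dom N) k"
  \<comment> \<open>\<open>path j\<close> is a path of length \<open>j + 1\<close>; conjoining a path of length \<open>m - 3\<close> to \<open>R\<close> turns 4-cycles into \<open>m\<close>-cycles.\<close>
  define path where "path = rec_nat R (\<lambda>_ P x y. \<exists>z\<in>?t. R x z \<and> P z y)"
  have p0: "path 0 = R" and pS: "path (Suc j) x y \<longleftrightarrow> (\<exists>z\<in>?t. R x z \<and> path j z y)" for j x y
    by (simp_all add: path_def)
  have "\<exists>\<psi>. wf_fm L (k + k + ?q) \<psi> \<and> (\<forall>x y. length x = k \<longrightarrow> length y = k \<longrightarrow> sat N (x @ y @ c) \<psi> = path j x y)" for j
  proof (induction j)
    case 0
    then show ?case using wf by (auto simp: p0 R_def)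
  next
    case (Suc j)
    then obtain \<psi> where \<psi>: "wf_fm L (k + k + ?q) \<psi>"
      "\<And>x y. length x = k \<Longrightarrow> length y = k \<Longrightarrow> sat N (x @ y @ c) \<psi> = path j x y" by blast
    let ?n = "k + (k + k + ?q)"
    obtain \<chi>1 where w1: "wf_fm L ?n \<chi>1" and s1:
      "\<And>E. length E = ?n \<Longrightarrow> sat N E \<chi>1 = sat N (take k (drop k E) @ take k (drop 0 E) @ take ?q (drop (k + k + k) E)) \<phi>"
      by (rule formula_at[OF wf, of k ?n 0 "k + k + k" N]) (simp, simp, simp, erule that, blast)
    obtain \<chi>2 where w2: "wf_fm L ?n \<chi>2" and s2:
      "\<And>E. length E = ?n \<Longrightarrow> sat N E \<chi>2 = sat N (take k (drop 0 E) @ take k (drop (k + k) E) @ take ?q (drop (k + k + k) E)) \<psi>"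
      by (rule formula_at[OF \<psi>(1), of 0 ?n "k + k" "k + k + k" N]) (simp, simp, simp, erule that, blast)
    let ?\<chi> = "(Ex ^^ k) (Conj \<chi>1 \<chi>2)"
    have "wf_fm L (k + k + ?q) ?\<chi>" by (rule Ex_power(1)) (simp add: w1 w2)
    moreover have "sat N (x @ y @ c) ?\<chi> = path (Suc j) x y" if "length x = k" "length y = k" for x y
      unfolding Ex_power(2) pS
      by (rule bex_cong[OF refl]) (simp add: tuples_def s1 s2 that R_def \<psi>(2))
    ultimately show ?case by blast
  qed
  then obtain \<psi> where \<psi>: "wf_fm L (k + k + ?q) \<psi>"
    "\<And>x y. length x = k \<Longrightarrow> length y = k \<Longrightarrow> sat N (x @ y @ c) \<psi> = path (m - 4) x y" by blast
  have walk: "\<exists>w :: nat \<Rightarrow> 'm list. w 0 = x \<and> w (Suc j) = y \<and> (\<forall>i\<le>Suc j. w i \<in> ?t) \<and> (\<forall>i\<le>j. R (w i) (w (Suc i)))"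
    if "path j x y" "x \<in> ?t" "y \<in> ?t" for j x y
    using that
  proof (induction j arbitrary: x)
    case 0
    then show ?case by (intro exI[of _ "\<lambda>i. if i = 0 then x else y"]) (auto simp: p0)
  next
    case (Suc j)
    then obtain z where z: "z \<in> ?t" "R x z" "path j z y" by (auto simp: pS)
    from Suc.IH[OF z(3,1) Suc.prems(3)] obtain w :: "nat \<Rightarrow> 'm list"
      where w: "w 0 = z" "w (Suc j) = y" "\<forall>i\<le>Suc j. w i \<in> ?t" "\<forall>i\<le>j. R (w i) (w (Suc i))" by blast
    let ?w = "case_nat x w"
    have "\<forall>i\<le>Suc (Suc j). ?w i \<in> ?t" using w(3) Suc.prems(2) by (auto split: nat.split)
    moreover have "\<forall>i\<le>Suc j. R (?w i) (?w (Suc i))" using w(1,4) z(2) by (auto split: nat.split)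
    ultimately show ?case using w(2) by (intro exI[of _ ?w]) auto
  qed
  have chain: "path j (a p) (a r)" if "p + j < r" for j p r
    using that
  proof (induction j arbitrary: p)
    case 0 then show ?case using Raa by (simp add: p0)
  next
    case (Suc j)
    have "path j (a (Suc p)) (a r)" by (rule Suc.IH) (use Suc.prems in simp)
    then show ?case using Raa[of p "Suc p"] a[of "Suc p"] unfolding pS by blast
  qed
  define R' where "R' = (\<lambda>x y. sat N (x @ y @ c) (Conj \<phi> \<psi>))"
  have R': "R' x y \<longleftrightarrow> R x y \<and> path (m - 4) x y" if "x \<in> ?t" "y \<in> ?t" for x y
    using that \<psi>(2) by (simp add: R'_def R_def tuples_def)
  have "\<not> (\<exists>x :: nat \<Rightarrow> 'm list. \<forall>i<4. x i \<in> ?t \<and> R' (x i) (x (Suc i mod 4)))"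
  proof
    assume "\<exists>x :: nat \<Rightarrow> 'm list. \<forall>i<4. x i \<in> ?t \<and> R' (x i) (x (Suc i mod 4))"
    then obtain x :: "nat \<Rightarrow> 'm list" where x: "\<And>i. i < 4 \<Longrightarrow> x i \<in> ?t" "\<And>i. i < 4 \<Longrightarrow> R' (x i) (x (Suc i mod 4))" by blast
    have xt: "x 0 \<in> ?t" "x 1 \<in> ?t" "x 2 \<in> ?t" "x 3 \<in> ?t" using x(1) by auto
    have xR: "path (m - 4) (x 0) (x 1)" "R (x 1) (x 2)" "R (x 2) (x 3)" "R (x 3) (x 0)"
    proof -
      have m: "Suc 0 mod 4 = (1::nat)" "Suc 1 mod 4 = (2::nat)" "Suc 2 mod 4 = (3::nat)" "Suc 3 mod 4 = (0::nat)" by simp_all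
      have "R' (x 0) (x 1)" "R' (x 1) (x 2)" "R' (x 2) (x 3)" "R' (x 3) (x 0)"
        using x(2)[of 0] x(2)[of 1] x(2)[of 2] x(2)[of 3] unfolding m by simp_all
      then show "path (m - 4) (x 0) (x 1)" "R (x 1) (x 2)" "R (x 2) (x 3)" "R (x 3) (x 0)"
        using R'[OF xt(1,2)] R'[OF xt(2,3)] R'[OF xt(3,4)] R'[OF xt(4,1)] by simp_all
    qed
    obtain w :: "nat \<Rightarrow> 'm list" where w: "w 0 = x 0" "w (Suc (m - 4)) = x 1" "\<forall>i\<le>Suc (m - 4). w i \<in> ?t" "\<forall>i\<le>m - 4. R (w i) (w (Suc i))"
      using walk[OF xR(1) xt(1,2)] by blast
    \<comment> \<open>The path occupies the indices from 0 to \<open>m - 3\<close>; the two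
      remaining vertices of the 4-cycle close the walk.\<close>
    let ?x = "\<lambda>i. if i \<le> m - 3 then w i else if i = m - 2 then x 2 else x 3"
    have m3: "Suc (m - 4) = m - 3" using assms(2) by simp
    have "?x i \<in> ?t \<and> R (?x i) (?x (Suc i mod m))" if i: "i < m" for i
    proof -
      consider "i < m - 3" | "i = m - 3" | "i = m - 2" | "i = m - 1" using i assms(2) by linarith
      then show ?thesis
      proof cases
        case 1
        then have "Suc i mod m = Suc i" "i \<le> m - 4" by auto
        then show ?thesis using 1 w(3,4) m3 by auto
      next
        case 2
        then have "Suc i mod m = m - 2" using assms(2) by (simp add: Suc_diff_Suc numeral_3_eq_3 numeral_2_eq_2)
        then show ?thesis using 2 w(2) m3 xR(2) xt assms(2) by auto
      next
        case 3
        then have "Suc i = m - 1" using assms(2) by simp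
        then have "Suc i mod m = m - 1" using assms(2) by simp
        then show ?thesis using 3 xR(3) xt assms(2) by auto
      next
        case 4
        then have "Suc i = m" using assms(2) by simp
        then have "Suc i mod m = 0" by simp
        then show ?thesis using 4 xR(4) xt w(1) assms(2) by auto
      qed
    qed
    then have "\<forall>i<m. ?x i \<in> ?t \<and> sat N (?x i @ ?x (Suc i mod m) @ c) \<phi>" unfolding R_def by (intro allI impI)
    then have "\<exists>x :: nat \<Rightarrow> 'm list. \<forall>i<m. x i \<in> ?t \<and> sat N (x i @ x (Suc i mod m) @ c) \<phi>" by (rule exI[of _ ?x])
    then show False using cyc by (rule notE[rotated])
  qed
  moreover have "R' (a (m * i)) (a (m * j))" if "i < j" for i j
  proof -
    \<comment> \<open>Thinning the chain by the factor \<open>m\<close> leaves room for the path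
      between consecutive elements.\<close>
    have "m * i + m \<le> m * j" using that by (metis mult_Suc_right add.commute Suc_leI mult_le_mono2)
    then have "m * i + (m - 4) < m * j" "m * i < m * j" using assms(2) by linarith+
    then show ?thesis using R'[OF a a] Raa chain by blast
  qed
  moreover have "wf_fm L (k + k + ?q) (Conj \<phi> \<psi>)" using wf \<psi> by simp
  ultimately show ?thesis unfolding SOP_def using c a
    by (intro exI[of _ k] exI[of _ "Conj \<phi> \<psi>"] exI[of _ c] exI[of _ R'] conjI) (auto simp: R'_def intro!: exI[of _ "\<lambda>i. a (m * i)"])
qed

theorem symmetric_imp_strictly_NSOP_le:
  assumes "monster L T \<kappa> N" "conant_symmetric L \<kappa> N" "strictly_NSOP L N n"
  shows "n \<le> 4"
proof (rule ccontr)
  interpret monster_model L T \<kappa> N using assms(1) by unfold_locales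
  assume "\<not> n \<le> 4"
  then have "SOP L N 4" using SOP_4[of L N "n - 1"] assms(3) by (simp add: strictly_NSOP_def)
  then show False using symmetric_imp_NSOP4[OF assms(2)] by blast
qed

section \<open>Amalgamation of digraphs without directed triangles\<close>

text \<open>The triangle need not consist of three distinct vertices, so loops are excluded too.\<close>

definition trifree :: "'a set \<Rightarrow> 'a rel \<Rightarrow> bool" where
  "trifree V R \<longleftrightarrow> (\<forall>x\<in>V. \<forall>y\<in>V. \<forall>z\<in>V. (x, y) \<in> R \<longrightarrow> (y, z) \<in> R \<longrightarrow> (z, x) \<notin> R)"

lemma trifreeD: "trifree V R \<Longrightarrow> x \<in> V \<Longrightarrow> y \<in> V \<Longrightarrow> z \<in> V \<Longrightarrow> (x, y) \<in> R \<Longrightarrow> (y, z) \<in> R \<Longrightarrow> (z, x) \<in> R \<Longrightarrow> False"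
  unfolding trifree_def by blast

text \<open>The map may identify points: the image of a triangle is then a degenerate triangle,
  which \<open>trifree\<close> forbids as well.\<close>

lemma trifree_hom:
  assumes "trifree V' R'" "\<And>x. x \<in> V \<Longrightarrow> f x \<in> V'" "\<And>x y. x \<in> V \<Longrightarrow> y \<in> V \<Longrightarrow> (x, y) \<in> R \<Longrightarrow> (f x, f y) \<in> R'"
  shows "trifree V R"
  unfolding trifree_def
proof (intro ballI impI notI)
  fix x y z assume "x \<in> V" "y \<in> V" "z \<in> V" "(x, y) \<in> R" "(y, z) \<in> R" "(z, x) \<in> R"
  then have "f x \<in> V'" "f y \<in> V'" "f z \<in> V'" "(f x, f y) \<in> R'" "(f y, f z) \<in> R'" "(f z, f x) \<in> R'" using assms(2,3) by auto
  then show False using assms(1) unfolding trifree_def by blast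
qed

text \<open>A relation instead of a function: inverses, restrictions and unions of maps need no
  bookkeeping of domains.\<close>

definition piso :: "'a rel \<Rightarrow> 'a rel \<Rightarrow> bool" where
  "piso R P \<longleftrightarrow> (\<forall>x x' y y'. (x, x') \<in> P \<longrightarrow> (y, y') \<in> P \<longrightarrow> (x = y \<longleftrightarrow> x' = y') \<and> ((x, y) \<in> R \<longleftrightarrow> (x', y') \<in> R))"

lemma pisoD:
  assumes "piso R P" "(x, x') \<in> P" "(y, y') \<in> P"
  shows "x = y \<longleftrightarrow> x' = y'" "(x, y) \<in> R \<longleftrightarrow> (x', y') \<in> R"
  using assms unfolding piso_def by blast+

lemma piso_converse: "piso R P \<Longrightarrow> piso R (P\<inverse>)"
  unfolding piso_def by blast

text \<open>Each partial isomorphism \<open>P j\<close> of \<open>(V, R)\<close> is made total by gluing a copy of \<open>V\<close> to \<open>V\<close> along it;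
  the copies for different \<open>j\<close> are amalgamated freely.\<close>

locale amalgam =
  fixes V :: "'a set" and R :: "'a rel" and J :: "'j set" and P :: "'j \<Rightarrow> 'a rel" and new :: "'j \<Rightarrow> 'a \<Rightarrow> 'a"
  assumes R: "R \<subseteq> V \<times> V" and tri: "trifree V R"
    and P: "\<And>j. j \<in> J \<Longrightarrow> P j \<subseteq> V \<times> V" "\<And>j. j \<in> J \<Longrightarrow> piso R (P j)"
    and new: "\<And>j x. new j x \<notin> V" "\<And>i j x y. new i x = new j y \<Longrightarrow> i = j \<and> x = y"
begin

text \<open>The graph of the embedding of \<open>V\<close> onto its \<open>j\<close>-th copy, a
  total extension of \<open>P j\<close>.\<close>

definition E :: "'j \<Rightarrow> 'a rel" where
  "E j = P j \<union> {(x, new j x) |x. x \<in> V \<and> x \<notin> Domain (P j)}"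

definition V' :: "'a set" where
  "V' = V \<union> (\<Union>j\<in>J. Range (E j))"

definition R' :: "'a rel" where
  "R' = R \<union> (\<Union>j\<in>J. {(y, y') |x x' y y'. (x, y) \<in> E j \<and> (x', y') \<in> E j \<and> (x, x') \<in> R})"

lemma E_dom: "j \<in> J \<Longrightarrow> (x, y) \<in> E j \<Longrightarrow> x \<in> V"
  using P(1) by (auto simp: E_def)

lemma E_total: "x \<in> V \<Longrightarrow> \<exists>y. (x, y) \<in> E j"
  by (auto simp: E_def)

lemma E_old: "j \<in> J \<Longrightarrow> (x, y) \<in> E j \<Longrightarrow> y \<in> V \<Longrightarrow> (x, y) \<in> P j"
  using new(1) by (auto simp: E_def)

lemma E_new: "j \<in> J \<Longrightarrow> (x, y) \<in> E j \<Longrightarrow> y \<notin> V \<Longrightarrow> y = new j x \<and> x \<notin> Domain (P j)"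
  using P(1) by (auto simp: E_def)

text \<open>Labels record the copy, so different copies share no point outside \<open>V\<close>.
  This is the freeness of the amalgam.\<close>

lemma E_index: "i \<in> J \<Longrightarrow> j \<in> J \<Longrightarrow> (x, y) \<in> E i \<Longrightarrow> (x', y) \<in> E j \<Longrightarrow> y \<notin> V \<Longrightarrow> i = j"
  using E_new new(2) by metis

lemma E_inj:
  assumes j: "j \<in> J" and e: "(x, y) \<in> E j" "(x', y') \<in> E j"
  shows "x = x' \<longleftrightarrow> y = y'"
proof (cases "y \<in> V")
  case True
  note p = E_old[OF j e(1) True]
  show ?thesis
  proof (cases "y' \<in> V")
    case True
    from E_old[OF j e(2) this] show ?thesis using pisoD(1)[OF P(2)[OF j] p] by blast
  next
    case False
    then show ?thesis using E_new[OF j e(2) False] p True by blast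
  qed
next
  case False
  note n = E_new[OF j e(1) False]
  show ?thesis
  proof (cases "y' \<in> V")
    case True
    from E_old[OF j e(2) this] show ?thesis using n False True by blast
  next
    case False
    then show ?thesis using E_new[OF j e(2) False] n new(2) by metis
  qed
qed

lemma R'_old:
  assumes "(y, y') \<in> R'" "y \<in> V" "y' \<in> V"
  shows "(y, y') \<in> R"
proof (cases "(y, y') \<in> R")
  case False
  then obtain j x x' where j: "j \<in> J" "(x, y) \<in> E j" "(x', y') \<in> E j" "(x, x') \<in> R"
    using assms(1) by (auto simp: R'_def)
  then show ?thesis using E_old[OF j(1)] assms pisoD(2)[OF P(2)[OF j(1)]] by metis
qed

lemma R'_new:
  assumes "(y, y') \<in> R'" "y \<notin> V \<or> y' \<notin> V"
  shows "\<exists>j\<in>J. \<exists>x x'. (x, y) \<in> E j \<and> (x', y') \<in> E j \<and> (x, x') \<in> R"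
  using assms R by (auto simp: R'_def)

lemma E_edge:
  assumes j: "j \<in> J" and e: "(x, y) \<in> E j" "(x', y') \<in> E j"
  shows "(x, x') \<in> R \<longleftrightarrow> (y, y') \<in> R'"
proof
  assume "(x, x') \<in> R"
  then show "(y, y') \<in> R'" unfolding R'_def using j e by blast
next
  assume r: "(y, y') \<in> R'"
  show "(x, x') \<in> R"
  proof (cases "y \<in> V \<and> y' \<in> V")
    case True
    then show ?thesis using R'_old[OF r] E_old[OF j] e pisoD(2)[OF P(2)[OF j]] by metis
  next
    case False
    then obtain i z z' where i: "i \<in> J" "(z, y) \<in> E i" "(z', y') \<in> E i" "(z, z') \<in> R" using R'_new[OF r] by blast
    have "i = j" using False E_index[OF i(1) j i(2) e(1)] E_index[OF i(1) j i(3) e(2)] by blast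
    then show ?thesis using E_inj[OF j] i e by metis
  qed
qed

text \<open>Edges at a new point lie in the only copy that contains it. Both neighbours are
  therefore in that copy, and the whole triangle pulls back to \<open>V\<close>.\<close>

lemma no_triangle_new:
  assumes "(y, y') \<in> R'" "(y', y'') \<in> R'" "(y'', y) \<in> R'" "y \<notin> V"
  shows False
proof -
  obtain j x x' where j: "j \<in> J" "(x, y) \<in> E j" "(x', y') \<in> E j" "(x, x') \<in> R" using R'_new[OF assms(1)] assms(4) by blast
  obtain i z'' z where i: "i \<in> J" "(z'', y'') \<in> E i" "(z, y) \<in> E i" "(z'', z) \<in> R" using R'_new[OF assms(3)] assms(4) by blast
  have ij: "i = j" by (rule E_index[OF i(1) j(1) i(3) j(2) assms(4)])
  have "z = x" using E_inj[OF j(1)] i j ij by blast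
  moreover have "(x', z'') \<in> R" using E_edge[OF j(1,3)] i(2) ij assms(2) by blast
  ultimately show False using tri j(4) i(4) R unfolding trifree_def by blast
qed

lemma trifree': "trifree V' R'"
  unfolding trifree_def
proof (intro ballI impI notI)
  fix x y z assume r: "(x, y) \<in> R'" "(y, z) \<in> R'" "(z, x) \<in> R'"
  have "x \<in> V" "y \<in> V" "z \<in> V" using no_triangle_new r by blast+
  then show False using R'_old r tri unfolding trifree_def by blast
qed

lemma R'_sub: "R' \<subseteq> V' \<times> V'"
  using R by (auto simp: R'_def V'_def)

lemma R'_restrict: "R = R' \<inter> V \<times> V"
proof
  show "R \<subseteq> R' \<inter> V \<times> V" using R by (auto simp: R'_def)
  show "R' \<inter> V \<times> V \<subseteq> R" using R'_old by (intro subrelI) blast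
qed

lemma E_sub: "j \<in> J \<Longrightarrow> E j \<subseteq> V' \<times> V'"
  using E_dom by (auto simp: V'_def)

lemma piso_old: "Q \<subseteq> V \<times> V \<Longrightarrow> piso R Q \<Longrightarrow> piso R' Q"
proof -
  assume Q: "Q \<subseteq> V \<times> V" "piso R Q"
  have "(x, y) \<in> R \<longleftrightarrow> (x, y) \<in> R'" if "x \<in> V" "y \<in> V" for x y using R'_restrict that by blast
  note eq = this
  show ?thesis unfolding piso_def
  proof (intro allI impI)
    fix x x' y y' assume q: "(x, x') \<in> Q" "(y, y') \<in> Q"
    then have "x \<in> V" "x' \<in> V" "y \<in> V" "y' \<in> V" using Q(1) by auto
    then show "(x = y \<longleftrightarrow> x' = y') \<and> ((x, y) \<in> R' \<longleftrightarrow> (x', y') \<in> R')"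
      using pisoD[OF Q(2) q] eq[of x y] eq[of x' y'] by simp
  qed
qed

lemma piso_E: "j \<in> J \<Longrightarrow> piso R' (E j)"
proof -
  assume j: "j \<in> J"
  show ?thesis unfolding piso_def
  proof (intro allI impI)
    fix x x' y y' assume e: "(x, x') \<in> E j" "(y, y') \<in> E j"
    have "(x, y) \<in> R \<longleftrightarrow> (x, y) \<in> R'" using E_dom[OF j] e R'_restrict by blast
    then show "(x = y \<longleftrightarrow> x' = y') \<and> ((x, y) \<in> R' \<longleftrightarrow> (x', y') \<in> R')"
      using E_inj[OF j e] E_edge[OF j e] by simp
  qed
qed

text \<open>Forth and back at once: \<open>E j\<close> makes the map total on \<open>V\<close>, and
  the inverse of \<open>E i\<close> puts all of \<open>V\<close> into the range. The union is a
  partial isomorphism since the two sets of new points are not joined to the relevant rest.\<close>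

lemma piso_two_sided:
  assumes i: "i \<in> J" and j: "j \<in> J" and ij: "P i = (P j)\<inverse>" "i \<noteq> j"
  shows "piso R' (E j \<union> (E i)\<inverse>)"
proof -
  have mixed: "(x = y \<longleftrightarrow> x' = y') \<and> ((x, y) \<in> R' \<longleftrightarrow> (x', y') \<in> R') \<and> ((y, x) \<in> R' \<longleftrightarrow> (y', x') \<in> R')"
    if e: "(x, x') \<in> E j" "(y', y) \<in> E i" for x x' y y'
  proof (cases "y \<in> V")
    case True
    then have "(y, y') \<in> E j" using E_old[OF i e(2)] ij(1) by (auto simp: E_def)
    then show ?thesis using pisoD[OF piso_E[OF j]] e(1) by metis
  next
    case y: False
    show ?thesis
    proof (cases "x' \<in> V")
      case True
      then have "(x', x) \<in> E i" using E_old[OF j e(1)] ij(1) by (auto simp: E_def)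
      then show ?thesis using pisoD[OF piso_E[OF i]] e(2) by metis
    next
      case x': False
      have d: "x \<in> V" "y' \<in> V" using E_dom[OF j e(1)] E_dom[OF i e(2)] by auto
      \<comment> \<open>An edge between \<open>x\<close> and the new point \<open>y\<close> would
        place \<open>x\<close> in copy \<open>i\<close>. Then \<open>x\<close> would be in the
        domain of \<open>P j\<close>, and its image \<open>x'\<close> would be old.\<close>
      have 1: "(w, x) \<notin> E i" for w
      proof
        assume w: "(w, x) \<in> E i"
        have "(x, w) \<in> P j" using E_old[OF i w d(1)] ij(1) by simp
        then have "(x, w) \<in> E j" by (simp add: E_def)
        then show False using E_inj[OF j e(1)] E_dom[OF i w] x' by blast
      qed
      have 2: "(w, y') \<notin> E j" for w
      proof
        assume w: "(w, y') \<in> E j"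
        have "(y', w) \<in> P i" using E_old[OF j w d(2)] ij(1) by simp
        then have "(y', w) \<in> E i" by (simp add: E_def)
        then show False using E_inj[OF i e(2)] E_dom[OF j w] y by blast
      qed
      have "(x, y) \<notin> R' \<and> (y, x) \<notin> R'"
      proof (intro conjI notI)
        assume "(x, y) \<in> R'"
        then obtain l w w' where "l \<in> J" "(w, x) \<in> E l" "(w', y) \<in> E l" using R'_new[of x y] y by blast
        then show False using E_index[OF _ i _ e(2) y] 1 by blast
      next
        assume "(y, x) \<in> R'"
        then obtain l w w' where "l \<in> J" "(w, x) \<in> E l" "(w', y) \<in> E l" using R'_new[of y x] y by blast
        then show False using E_index[OF _ i _ e(2) y] 1 by blast
      qed
      moreover have "(x', y') \<notin> R' \<and> (y', x') \<notin> R'"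
      proof (intro conjI notI)
        assume "(x', y') \<in> R'"
        then obtain l w w' where "l \<in> J" "(w, x') \<in> E l" "(w', y') \<in> E l" using R'_new[of x' y'] x' by blast
        then show False using E_index[OF _ j _ e(1) x'] 2 by blast
      next
        assume "(y', x') \<in> R'"
        then obtain l w w' where "l \<in> J" "(w, x') \<in> E l" "(w', y') \<in> E l" using R'_new[of y' x'] x' by blast
        then show False using E_index[OF _ j _ e(1) x'] 2 by blast
      qed
      moreover have "x \<noteq> y" "x' \<noteq> y'" using d y x' by auto
      ultimately show ?thesis by blast
    qed
  qed
  show ?thesis unfolding piso_def
  proof (intro allI impI)
    fix x x' y y' assume "(x, x') \<in> E j \<union> (E i)\<inverse>" "(y, y') \<in> E j \<union> (E i)\<inverse>"
    then consider "(x, x') \<in> E j" "(y, y') \<in> E j" | "(x, x') \<in> E j" "(y', y) \<in> E i"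
      | "(x', x) \<in> E i" "(y, y') \<in> E j" | "(x', x) \<in> E i" "(y', y) \<in> E i" by blast
    then show "(x = y \<longleftrightarrow> x' = y') \<and> ((x, y) \<in> R' \<longleftrightarrow> (x', y') \<in> R')"
    proof cases
      case 1 then show ?thesis using pisoD[OF piso_E[OF j]] by blast
    next
      case 2 then show ?thesis using mixed by blast
    next
      case 3 then show ?thesis using mixed[OF 3(2,1)] by blast
    next
      case 4 then show ?thesis using pisoD[OF piso_E[OF i]] by blast
    qed
  qed
qed

end

section \<open>A homogeneous digraph\<close>

type_synonym point = "nat set set"

text \<open>A code \<open>h\<close> stands for the partial map with graph \<open>range h\<close>, which has at most continuum many elements.\<close>

type_synonym code = "nat set \<Rightarrow> point \<times> point"

lemma inj_pair_exists: "\<exists>f :: 'a \<times> 'a \<Rightarrow> 'a. inj f" if "infinite (UNIV :: 'a set)"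
proof -
  have "|(UNIV :: 'a set) \<times> (UNIV :: 'a set)| \<le>o |UNIV :: 'a set|"
    using card_of_Times_same_infinite[OF that] ordIso_imp_ordLeq by blast
  then show ?thesis using card_of_ordLeq[of "(UNIV :: 'a set) \<times> (UNIV :: 'a set)" "UNIV :: 'a set"] by auto
qed

text \<open>This is the equality of \<open>2^c\<close> with its \<open>c\<close>-th power, where
  \<open>c\<close> is the continuum: a map from \<open>nat set\<close> to points is coded by its
  uncurried graph, a set of pairs of sets of natural numbers, and \<open>z\<close> provides
  tags.\<close>

lemma enc_exists: "\<exists>e :: (point \<times> (code \<times> bool) \<times> point) + (nat set rel \<times> nat set) \<Rightarrow> point. inj e"
proof -
  have "infinite (UNIV :: nat set set)" by (simp add: Finite_Set.finite_set)
  then obtain q :: "nat set \<times> nat set \<Rightarrow> nat set" where q: "inj q" using inj_pair_exists by blast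
  have "infinite (UNIV :: point set)" by (simp add: Finite_Set.finite_set)
  then obtain p :: "point \<times> point \<Rightarrow> point" where p: "inj p" using inj_pair_exists by blast
  have q': "q x = q y \<longleftrightarrow> x = y" for x y using q by (simp add: inj_eq)
  have p': "p x = p y \<longleftrightarrow> x = y" for x y using p by (simp add: inj_eq)
  define c :: "code \<Rightarrow> point" where "c = (\<lambda>h. {q (a, b) |a b. b \<in> p (h a)})"
  have c: "h = h'" if "c h = c h'" for h h'
  proof
    fix a
    have "b \<in> p (h a) \<longleftrightarrow> q (a, b) \<in> c h" for h b by (auto simp: c_def q')
    then have "p (h a) = p (h' a)" using that by auto
    then show "h a = h' a" by (simp add: p')
  qed
  define z :: "bool \<Rightarrow> point" where "z = (\<lambda>s. if s then {} else {{}})"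
  have z: "z s = z t \<longleftrightarrow> s = t" for s t by (auto simp: z_def)
  define e where "e = case_sum (\<lambda>(\<alpha>, (h, s), x). p (z True, p (\<alpha>, p (c h, p (z s, x))))) (\<lambda>(D, a). p (z False, p (q ` D, {a})))"
  have "inj e"
  proof (rule injI)
    fix u v assume "e u = e v"
    then show "u = v" using c inj_image_eq_iff[OF q]
      by (cases u; cases v) (auto simp: e_def p' z split: prod.splits)
  qed
  then show ?thesis by blast
qed

text \<open>Left summands label glued points by the stage, the code with its direction, and the
  original point. Right summands label vertices of the first stage by a digraph and one of its
  vertices.\<close>

definition enc :: "(point \<times> (code \<times> bool) \<times> point) + (nat set rel \<times> nat set) \<Rightarrow> point" where
  "enc = (SOME e. inj e)"

lemma enc_eq [simp]: "enc u = enc v \<longleftrightarrow> u = v"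
  using someI_ex[OF enc_exists] by (simp add: enc_def inj_eq)

section \<open>Stages and the one-step extension\<close>

text \<open>\<open>ms h\<close> is the part constructed so far of an automorphism that extends \<open>range h\<close>.\<close>

record stage =
  vs :: "point set"
  es :: "point rel"
  ms :: "code \<Rightarrow> point rel"

text \<open>An empty \<open>ms S h\<close> means that \<open>h\<close> has not been taken up yet;
  from then on the map has to extend \<open>range h\<close>.\<close>

definition good_stage :: "stage \<Rightarrow> bool" where
  "good_stage S \<longleftrightarrow> es S \<subseteq> vs S \<times> vs S \<and> trifree (vs S) (es S) \<and>
     (\<forall>h. ms S h \<subseteq> vs S \<times> vs S \<and> piso (es S) (ms S h) \<and> (ms S h \<noteq> {} \<longrightarrow> range h \<subseteq> ms S h))"

definition stage_le :: "stage \<Rightarrow> stage \<Rightarrow> bool" where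
  "stage_le S S' \<longleftrightarrow> vs S \<subseteq> vs S' \<and> es S = es S' \<inter> vs S \<times> vs S \<and> (\<forall>h. ms S h \<subseteq> ms S' h)"

lemma stage_le_trans: "stage_le S1 S2 \<Longrightarrow> stage_le S2 S3 \<Longrightarrow> stage_le S1 S3"
  unfolding stage_le_def by (intro conjI) blast+

lemma stage_le_refl: "good_stage S \<Longrightarrow> stage_le S S"
  by (auto simp: stage_le_def good_stage_def)

definition unions :: "stage set \<Rightarrow> stage" where
  "unions \<O> = \<lparr>vs = (\<Union>S\<in>\<O>. vs S), es = (\<Union>S\<in>\<O>. es S), ms = (\<lambda>h. \<Union>S\<in>\<O>. ms S h)\<rparr>"

text \<open>Triangles and the conditions on partial isomorphisms involve finitely many points, which
  lie together in one member of the chain.\<close>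

lemma unions_good:
  assumes good_stage: "\<And>S. S \<in> \<O> \<Longrightarrow> good_stage S" and chain: "\<And>S S'. S \<in> \<O> \<Longrightarrow> S' \<in> \<O> \<Longrightarrow> stage_le S S' \<or> stage_le S' S"
  shows "good_stage (unions \<O>)" and "S \<in> \<O> \<Longrightarrow> stage_le S (unions \<O>)"
proof -
  have stage_le: "stage_le S (unions \<O>)" if S: "S \<in> \<O>" for S unfolding stage_le_def
  proof (intro conjI allI)
    show "vs S \<subseteq> vs (unions \<O>)" "ms S h \<subseteq> ms (unions \<O>) h" for h using S by (auto simp: unions_def)
    show "es S = es (unions \<O>) \<inter> vs S \<times> vs S"
    proof
      show "es S \<subseteq> es (unions \<O>) \<inter> vs S \<times> vs S" using S good_stage[OF S] by (auto simp: unions_def good_stage_def)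
      show "es (unions \<O>) \<inter> vs S \<times> vs S \<subseteq> es S"
      proof
        fix e assume e: "e \<in> es (unions \<O>) \<inter> vs S \<times> vs S"
        then obtain S' where S': "S' \<in> \<O>" "e \<in> es S'" by (auto simp: unions_def)
        from chain[OF S S'(1)] show "e \<in> es S" using e S'(2) unfolding stage_le_def by blast
      qed
    qed
  qed
  then show "S \<in> \<O> \<Longrightarrow> stage_le S (unions \<O>)" .
  have max: "\<exists>S\<in>\<O>. stage_le S1 S \<and> stage_le S2 S" if "S1 \<in> \<O>" "S2 \<in> \<O>" for S1 S2
    using chain[OF that] chain[OF that(1,1)] chain[OF that(2,2)] that by blast
  show "good_stage (unions \<O>)" unfolding good_stage_def
  proof (intro conjI allI impI)
    show sub: "es (unions \<O>) \<subseteq> vs (unions \<O>) \<times> vs (unions \<O>)" "ms (unions \<O>) h \<subseteq> vs (unions \<O>) \<times> vs (unions \<O>)" for h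
      using good_stage by (fastforce simp: unions_def good_stage_def)+
    show "range h \<subseteq> ms (unions \<O>) h" if ne: "ms (unions \<O>) h \<noteq> {}" for h
    proof -
      obtain S where S: "S \<in> \<O>" "ms S h \<noteq> {}" using ne by (auto simp: unions_def)
      then have "range h \<subseteq> ms S h" using good_stage[of S] by (simp add: good_stage_def)
      also have "\<dots> \<subseteq> ms (unions \<O>) h" using stage_le[OF S(1)] by (simp add: stage_le_def)
      finally show ?thesis .
    qed
    show "trifree (vs (unions \<O>)) (es (unions \<O>))" unfolding trifree_def
    proof (intro ballI impI notI)
      fix x y z assume v: "x \<in> vs (unions \<O>)" "y \<in> vs (unions \<O>)" "z \<in> vs (unions \<O>)"
        and e: "(x, y) \<in> es (unions \<O>)" "(y, z) \<in> es (unions \<O>)" "(z, x) \<in> es (unions \<O>)"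
      obtain S1 S2 S3 where S: "S1 \<in> \<O>" "x \<in> vs S1" "S2 \<in> \<O>" "y \<in> vs S2" "S3 \<in> \<O>" "z \<in> vs S3"
        using v by (auto simp: unions_def)
      obtain S4 where S4: "S4 \<in> \<O>" "stage_le S1 S4" "stage_le S2 S4" using max[OF S(1,3)] by blast
      obtain S5 where S5: "S5 \<in> \<O>" "stage_le S4 S5" "stage_le S3 S5" using max[OF S4(1) S(5)] by blast
      have "vs S1 \<subseteq> vs S5" "vs S2 \<subseteq> vs S5" "vs S3 \<subseteq> vs S5" using S4 S5 by (auto simp: stage_le_def)
      then have v5: "x \<in> vs S5" "y \<in> vs S5" "z \<in> vs S5" using S by auto
      have eq: "es S5 = es (unions \<O>) \<inter> vs S5 \<times> vs S5" using stage_le[OF S5(1)] by (simp add: stage_le_def)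
      have "(x, y) \<in> es S5" "(y, z) \<in> es S5" "(z, x) \<in> es S5" using e v5 by (simp_all add: eq)
      moreover have "trifree (vs S5) (es S5)" using good_stage[OF S5(1)] by (simp add: good_stage_def)
      ultimately show False using trifreeD v5 by metis
    qed
    show "piso (es (unions \<O>)) (ms (unions \<O>) h)" for h unfolding piso_def
    proof (intro allI impI)
      fix x x' y y' assume "(x, x') \<in> ms (unions \<O>) h" "(y, y') \<in> ms (unions \<O>) h"
      then obtain S1 S2 where S: "S1 \<in> \<O>" "(x, x') \<in> ms S1 h" "S2 \<in> \<O>" "(y, y') \<in> ms S2 h" by (auto simp: unions_def)
      obtain S3 where S3: "S3 \<in> \<O>" "stage_le S1 S3" "stage_le S2 S3" using max[OF S(1,3)] by blast
      have "ms S1 h \<subseteq> ms S3 h" "ms S2 h \<subseteq> ms S3 h" using S3 by (auto simp: stage_le_def)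
      then have m: "(x, x') \<in> ms S3 h" "(y, y') \<in> ms S3 h" using S by auto
      have g: "ms S3 h \<subseteq> vs S3 \<times> vs S3" "piso (es S3) (ms S3 h)" using good_stage[OF S3(1)] by (auto simp: good_stage_def)
      have v3: "x \<in> vs S3" "x' \<in> vs S3" "y \<in> vs S3" "y' \<in> vs S3" using subsetD[OF g(1) m(1)] subsetD[OF g(1) m(2)] by simp_all
      have eq: "es S3 = es (unions \<O>) \<inter> vs S3 \<times> vs S3" using stage_le[OF S3(1)] by (simp add: stage_le_def)
      have "(x, y) \<in> es S3 \<longleftrightarrow> (x, y) \<in> es (unions \<O>)" "(x', y') \<in> es S3 \<longleftrightarrow> (x', y') \<in> es (unions \<O>)"
        using v3 by (simp_all add: eq)
      then show "(x = y \<longleftrightarrow> x' = y') \<and> ((x, y) \<in> es (unions \<O>) \<longleftrightarrow> (x', y') \<in> es (unions \<O>))"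
        using pisoD[OF g(2) m] by simp
    qed
  qed
qed

text \<open>Each code occurs once for each of the two directions of its map.\<close>

definition idx :: "stage \<Rightarrow> (code \<times> bool) set" where
  "idx S = {h. range h \<subseteq> vs S \<times> vs S \<and> piso (es S) (range h)} \<times> UNIV"

text \<open>Adding \<open>range h\<close> starts a map that has not been taken up so far.\<close>

definition cur :: "stage \<Rightarrow> code \<times> bool \<Rightarrow> point rel" where
  "cur S = (\<lambda>(h, s). if s then ms S h \<union> range h else (ms S h \<union> range h)\<inverse>)"

definition nw :: "point \<Rightarrow> code \<times> bool \<Rightarrow> point \<Rightarrow> point" where
  "nw \<alpha> j x = enc (Inl (\<alpha>, j, x))"

text \<open>In \<open>ms\<close>, the copy for \<open>True\<close> makes the map total on the old
  vertices and the inverse of the copy for \<open>False\<close> makes it reach all of them.\<close>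

definition step :: "point \<Rightarrow> stage \<Rightarrow> stage" where
  "step \<alpha> S = \<lparr>vs = amalgam.V' (vs S) (idx S) (cur S) (nw \<alpha>),
     es = amalgam.R' (vs S) (es S) (idx S) (cur S) (nw \<alpha>),
     ms = (\<lambda>h. if (h, True) \<in> idx S
       then amalgam.E (vs S) (cur S) (nw \<alpha>) (h, True) \<union> (amalgam.E (vs S) (cur S) (nw \<alpha>) (h, False))\<inverse> else ms S h)\<rparr>"

lemma step_good:
  assumes good_stage: "good_stage S" and fresh: "\<And>j x. nw \<alpha> j x \<notin> vs S"
  shows "good_stage (step \<alpha> S)" "stage_le S (step \<alpha> S)"
    and "range h \<subseteq> vs S \<times> vs S \<Longrightarrow> piso (es S) (range h) \<Longrightarrow>
      range h \<subseteq> ms (step \<alpha> S) h \<and> vs S \<subseteq> Domain (ms (step \<alpha> S) h) \<and> vs S \<subseteq> Range (ms (step \<alpha> S) h)"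
    and "vs (step \<alpha> S) \<subseteq> vs S \<union> {nw \<alpha> j x |j x. True}"
proof -
  \<comment> \<open>The union is always one of its two parts, so it inherits being a partial
    isomorphism.\<close>
  have cur: "ms S h \<union> range h = (if ms S h = {} then range h else ms S h)" for h using good_stage by (auto simp: good_stage_def)
  have c: "cur S j \<subseteq> vs S \<times> vs S" "piso (es S) (cur S j)" if j: "j \<in> idx S" for j
  proof -
    obtain h s where h: "j = (h, s)" by (metis surj_pair)
    have "ms S h \<union> range h \<subseteq> vs S \<times> vs S" "piso (es S) (ms S h \<union> range h)"
      using j good_stage h unfolding cur by (auto simp: idx_def good_stage_def)
    then show "cur S j \<subseteq> vs S \<times> vs S" "piso (es S) (cur S j)" using piso_converse unfolding h cur_def by auto
  qed
  interpret amalgam "vs S" "es S" "idx S" "cur S" "nw \<alpha>"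
    by unfold_locales (use good_stage fresh c in \<open>auto simp: good_stage_def nw_def\<close>)
  have st: "vs (step \<alpha> S) = V'" "es (step \<alpha> S) = R'"
    "ms (step \<alpha> S) h = (if (h, True) \<in> idx S then E (h, True) \<union> (E (h, False))\<inverse> else ms S h)" for h
    by (simp_all add: step_def)
  have tf: "(h, True) \<in> idx S \<longleftrightarrow> (h, False) \<in> idx S" for h by (simp add: idx_def)
  have conv: "cur S (h, False) = (cur S (h, True))\<inverse>" for h by (simp add: cur_def)
  have "cur S (h, True) \<subseteq> E (h, True)" for h by (simp add: E_def)
  then have sub: "ms S h \<union> range h \<subseteq> E (h, True)" for h unfolding cur_def by simp
  have VV: "vs S \<subseteq> V'" by (simp add: V'_def)
  show "good_stage (step \<alpha> S)" unfolding good_stage_def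
  proof (intro conjI allI impI)
    show "es (step \<alpha> S) \<subseteq> vs (step \<alpha> S) \<times> vs (step \<alpha> S)" unfolding st by (rule R'_sub)
    show "trifree (vs (step \<alpha> S)) (es (step \<alpha> S))" unfolding st by (rule trifree')
    fix h
    show "ms (step \<alpha> S) h \<subseteq> vs (step \<alpha> S) \<times> vs (step \<alpha> S)"
    proof (cases "(h, True) \<in> idx S")
      case True
      then show ?thesis unfolding st using E_sub[of "(h, True)"] E_sub[of "(h, False)"] tf by auto
    next
      case False
      have "ms S h \<subseteq> vs S \<times> vs S" using good_stage by (simp add: good_stage_def)
      also have "\<dots> \<subseteq> V' \<times> V'" by (rule Sigma_mono[OF VV VV])
      finally show ?thesis unfolding st using False by simp
    qed
    show "piso (es (step \<alpha> S)) (ms (step \<alpha> S) h)"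
    proof (cases "(h, True) \<in> idx S")
      case True
      then show ?thesis unfolding st using piso_two_sided[of "(h, False)" "(h, True)"] tf conv by simp
    next
      case False
      then show ?thesis unfolding st using good_stage piso_old by (simp add: good_stage_def)
    qed
    assume "ms (step \<alpha> S) h \<noteq> {}"
    then show "range h \<subseteq> ms (step \<alpha> S) h"
      unfolding st using good_stage sub[of h] by (auto simp: good_stage_def split: if_splits)
  qed
  show "stage_le S (step \<alpha> S)" unfolding stage_le_def st
  proof (intro conjI allI)
    show "vs S \<subseteq> V'" by (rule VV)
    show "es S = R' \<inter> vs S \<times> vs S" by (rule R'_restrict)
    show "ms S h \<subseteq> (if (h, True) \<in> idx S then E (h, True) \<union> (E (h, False))\<inverse> else ms S h)" for h
      using sub[of h] by (cases "(h, True) \<in> idx S") auto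
  qed
  show "range h \<subseteq> ms (step \<alpha> S) h \<and> vs S \<subseteq> Domain (ms (step \<alpha> S) h) \<and> vs S \<subseteq> Range (ms (step \<alpha> S) h)"
    if "range h \<subseteq> vs S \<times> vs S" "piso (es S) (range h)"
  proof -
    have "(h, True) \<in> idx S" using that by (simp add: idx_def)
    then have m: "ms (step \<alpha> S) h = E (h, True) \<union> (E (h, False))\<inverse>" unfolding st by simp
    show ?thesis unfolding m using sub[of h] E_total[of _ "(h, True)"] E_total[of _ "(h, False)"] by blast
  qed
  show "vs (step \<alpha> S) \<subseteq> vs S \<union> {nw \<alpha> j x |j x. True}"
  proof
    fix y assume "y \<in> vs (step \<alpha> S)"
    then consider "y \<in> vs S" | j x where "j \<in> idx S" "(x, y) \<in> E j" "y \<notin> vs S" unfolding st V'_def by auto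
    then show "y \<in> vs S \<union> {nw \<alpha> j x |j x. True}"
    proof cases
      case 2
      then have "y = nw \<alpha> j x" using E_new by blast
      then show ?thesis by blast
    qed simp
  qed
qed

text \<open>The disjoint union of all triangle-free digraphs on \<open>nat set\<close>. It makes the
  limit universal for digraphs of size at most continuum.\<close>

definition base_stage :: stage where
  "base_stage = \<lparr>vs = range (\<lambda>u. enc (Inr u)),
     es = {(enc (Inr (D, a)), enc (Inr (D, b))) |D a b. trifree UNIV D \<and> (a, b) \<in> D}, ms = (\<lambda>_. {})\<rparr>"

lemma base_good: "good_stage base_stage"
proof -
  have "trifree (vs base_stage) (es base_stage)" unfolding trifree_def
  proof (intro ballI impI notI)
    fix x y z assume "(x, y) \<in> es base_stage" "(y, z) \<in> es base_stage" "(z, x) \<in> es base_stage"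
    then obtain D a b c where "trifree UNIV (D :: nat set rel)" "(a, b) \<in> D" "(b, c) \<in> D" "(c, a) \<in> D"
      by (auto simp: base_stage_def)
    then show False using trifreeD[of UNIV D a b c] by simp
  qed
  moreover have "es base_stage \<subseteq> vs base_stage \<times> vs base_stage" by (auto simp: base_stage_def)
  ultimately show ?thesis by (simp add: good_stage_def) (simp add: base_stage_def piso_def)
qed

section \<open>Transfinite iteration along the successor of the continuum\<close>

text \<open>The stages are indexed by the elements of the successor cardinal of the continuum; limit stages
  are handled by taking unions at every stage.\<close>

definition stage_order :: "point rel" where
  "stage_order = cardSuc |UNIV :: nat set set|"

definition stage_at :: "point \<Rightarrow> stage" where
  "stage_at = wfrec (stage_order - Id) (\<lambda>f \<alpha>. step \<alpha> (unions (insert base_stage (f ` {\<beta>. (\<beta>, \<alpha>) \<in> stage_order - Id}))))"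

lemma inf_cont: "infinite (UNIV :: nat set set)"
  by (simp add: Finite_Set.finite_set)

lemma ord_card_order: "Card_order stage_order"
  unfolding stage_order_def by (rule cardSuc_Card_order) (rule card_of_Card_order)

lemma ord_facts: "wf (stage_order - Id)" "trans (stage_order - Id)" "total_on (Field stage_order) (stage_order - Id)" "trans stage_order" "Refl stage_order"
proof -
  have w: "Well_order stage_order" using ord_card_order card_order_on_well_order_on by blast
  then show "wf (stage_order - Id)" "trans stage_order" "Refl stage_order"
    by (auto simp: well_order_on_def linear_order_on_def partial_order_on_def preorder_on_def)
  show "trans (stage_order - Id)" using w
    by (auto simp: well_order_on_def linear_order_on_def partial_order_on_def preorder_on_def intro!: trans_diff_Id)
  show "total_on (Field stage_order) (stage_order - Id)" using w
    by (auto simp: well_order_on_def linear_order_on_def)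
qed

lemma obj_eq: "stage_at \<alpha> = step \<alpha> (unions (insert base_stage (stage_at ` {\<beta>. (\<beta>, \<alpha>) \<in> stage_order - Id})))"
proof -
  let ?F = "\<lambda>f \<alpha>. step \<alpha> (unions (insert base_stage (f ` {\<beta>. (\<beta>, \<alpha>) \<in> stage_order - Id})))"
  have "adm_wf (stage_order - Id) ?F" unfolding adm_wf_def
  proof (intro allI impI)
    fix f g :: "point \<Rightarrow> stage" and \<alpha> assume "\<forall>z. (z, \<alpha>) \<in> stage_order - Id \<longrightarrow> f z = g z"
    then have "f ` {\<beta>. (\<beta>, \<alpha>) \<in> stage_order - Id} = g ` {\<beta>. (\<beta>, \<alpha>) \<in> stage_order - Id}" by (intro image_cong) auto
    then show "?F f \<alpha> = ?F g \<alpha>" by simp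
  qed
  from wfrec_fixpoint[OF ord_facts(1) this] show ?thesis unfolding stage_at_def by (rule fun_cong)
qed

definition labels :: "point \<Rightarrow> point set" where
  "labels \<alpha> = {nw \<beta> j x |\<beta> j x. (\<beta>, \<alpha>) \<in> stage_order - Id \<or> \<beta> = \<alpha>}"

text \<open>The clauses need each other in the induction: comparability of earlier stages makes
  their union good, the bound by \<open>labels\<close> makes the new points fresh, and the last
  clause records that a stage extends every map that was available before it.\<close>

lemma obj_invariant:
  "good_stage (stage_at \<alpha>) \<and> stage_le base_stage (stage_at \<alpha>) \<and> (\<forall>\<beta>. (\<beta>, \<alpha>) \<in> stage_order - Id \<longrightarrow> stage_le (stage_at \<beta>) (stage_at \<alpha>)) \<and>
   vs (stage_at \<alpha>) \<subseteq> vs base_stage \<union> labels \<alpha> \<and>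
   (\<forall>\<beta> h. (\<beta>, \<alpha>) \<in> stage_order - Id \<longrightarrow> range h \<subseteq> vs (stage_at \<beta>) \<times> vs (stage_at \<beta>) \<longrightarrow> piso (es (stage_at \<beta>)) (range h) \<longrightarrow>
     range h \<subseteq> ms (stage_at \<alpha>) h \<and> vs (stage_at \<beta>) \<subseteq> Domain (ms (stage_at \<alpha>) h) \<and> vs (stage_at \<beta>) \<subseteq> Range (ms (stage_at \<alpha>) h))"
  using ord_facts(1)
proof (induction \<alpha> rule: wf_induct_rule)
  case (less \<alpha>)
  let ?B = "{\<beta>. (\<beta>, \<alpha>) \<in> stage_order - Id}"
  let ?\<O> = "insert base_stage (stage_at ` ?B)"
  have bb: "stage_le base_stage base_stage" by (auto simp: stage_le_def base_stage_def)
  have g: "good_stage S" if "S \<in> ?\<O>" for S using that less base_good by auto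
  have ch: "stage_le S S' \<or> stage_le S' S" if "S \<in> ?\<O>" "S' \<in> ?\<O>" for S S'
  proof -
    have "stage_le (stage_at \<beta>) (stage_at \<gamma>) \<or> stage_le (stage_at \<gamma>) (stage_at \<beta>)" if b: "\<beta> \<in> ?B" "\<gamma> \<in> ?B" for \<beta> \<gamma>
    proof -
      have "\<beta> \<in> Field stage_order" "\<gamma> \<in> Field stage_order" using b by (auto simp: Field_def)
      then have "\<beta> = \<gamma> \<or> (\<beta>, \<gamma>) \<in> stage_order - Id \<or> (\<gamma>, \<beta>) \<in> stage_order - Id" using ord_facts(3) unfolding total_on_def by blast
      then show ?thesis
      proof (elim disjE)
        assume "\<beta> = \<gamma>"
        then show ?thesis using stage_le_refl[OF g[of "stage_at \<beta>"]] b(1) by simp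
      next
        assume "(\<beta>, \<gamma>) \<in> stage_order - Id"
        moreover have "(\<gamma>, \<alpha>) \<in> stage_order - Id" using b(2) by simp
        ultimately show ?thesis using less[of \<gamma>] by simp
      next
        assume "(\<gamma>, \<beta>) \<in> stage_order - Id"
        moreover have "(\<beta>, \<alpha>) \<in> stage_order - Id" using b(1) by simp
        ultimately show ?thesis using less[of \<beta>] by simp
      qed
    qed
    moreover have "stage_le base_stage (stage_at \<beta>)" if "\<beta> \<in> ?B" for \<beta> using less that by blast
    ultimately show ?thesis using that bb by auto
  qed
  let ?U = "unions ?\<O>"
  have Ug: "good_stage ?U" and Ule: "\<And>S. S \<in> ?\<O> \<Longrightarrow> stage_le S ?U" using unions_good[of ?\<O>, OF g ch] by blast+
  have lab: "labels \<beta> \<subseteq> {nw \<gamma> j x |\<gamma> j x. (\<gamma>, \<alpha>) \<in> stage_order - Id}" if "\<beta> \<in> ?B" for \<beta>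
    using that transD[OF ord_facts(2)] unfolding labels_def by blast
  have Uv: "vs ?U \<subseteq> vs base_stage \<union> {nw \<gamma> j x |\<gamma> j x. (\<gamma>, \<alpha>) \<in> stage_order - Id}"
  proof
    fix v assume "v \<in> vs ?U"
    then consider "v \<in> vs base_stage" | \<beta> where "\<beta> \<in> ?B" "v \<in> vs (stage_at \<beta>)" by (auto simp: unions_def)
    then show "v \<in> vs base_stage \<union> {nw \<gamma> j x |\<gamma> j x. (\<gamma>, \<alpha>) \<in> stage_order - Id}"
    proof cases
      case 2
      then have "v \<in> vs base_stage \<union> labels \<beta>" using less by blast
      then show ?thesis using lab[OF 2(1)] by blast
    qed simp
  qed
  \<comment> \<open>Labels contain the index of the stage that introduced them, and all earlier
    points carry a smaller index or belong to the first stage.\<close>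
  have fresh: "nw \<alpha> j x \<notin> vs ?U" for j x
  proof
    assume "nw \<alpha> j x \<in> vs ?U"
    then have "nw \<alpha> j x \<in> vs base_stage \<or> (\<exists>\<gamma> i y. nw \<alpha> j x = nw \<gamma> i y \<and> (\<gamma>, \<alpha>) \<in> stage_order - Id)" using Uv by blast
    then show False by (auto simp: nw_def base_stage_def)
  qed
  note st = step_good[OF Ug fresh]
  have o: "stage_at \<alpha> = step \<alpha> ?U" by (rule obj_eq)
  have leo: "stage_le S (stage_at \<alpha>)" if "S \<in> ?\<O>" for S unfolding o by (rule stage_le_trans[OF Ule[OF that] st(2)])
  have v: "vs (stage_at \<alpha>) \<subseteq> vs base_stage \<union> labels \<alpha>"
  proof -
    have "vs (stage_at \<alpha>) \<subseteq> vs ?U \<union> {nw \<alpha> j x |j x. True}" unfolding o by (rule st(4))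
    then show ?thesis using Uv unfolding labels_def by blast
  qed
  have fin: "range h \<subseteq> ms (stage_at \<alpha>) h \<and> vs (stage_at \<beta>) \<subseteq> Domain (ms (stage_at \<alpha>) h) \<and> vs (stage_at \<beta>) \<subseteq> Range (ms (stage_at \<alpha>) h)"
    if b: "(\<beta>, \<alpha>) \<in> stage_order - Id" "range h \<subseteq> vs (stage_at \<beta>) \<times> vs (stage_at \<beta>)" "piso (es (stage_at \<beta>)) (range h)" for \<beta> h
  proof -
    have l: "stage_le (stage_at \<beta>) ?U" using b(1) by (intro Ule) blast
    then have vv: "vs (stage_at \<beta>) \<subseteq> vs ?U" by (simp add: stage_le_def)
    have "piso (es ?U) (range h)" unfolding piso_def
    proof (intro allI impI)
      fix x x' y y' assume q: "(x, x') \<in> range h" "(y, y') \<in> range h"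
      then have "x \<in> vs (stage_at \<beta>)" "x' \<in> vs (stage_at \<beta>)" "y \<in> vs (stage_at \<beta>)" "y' \<in> vs (stage_at \<beta>)" using subsetD[OF b(2) q(1)] subsetD[OF b(2) q(2)] by simp_all
      then have "(x, y) \<in> es (stage_at \<beta>) \<longleftrightarrow> (x, y) \<in> es ?U" "(x', y') \<in> es (stage_at \<beta>) \<longleftrightarrow> (x', y') \<in> es ?U"
        using l by (auto simp: stage_le_def)
      then show "(x = y \<longleftrightarrow> x' = y') \<and> ((x, y) \<in> es ?U \<longleftrightarrow> (x', y') \<in> es ?U)" using pisoD[OF b(3) q] by simp
    qed
    moreover have "range h \<subseteq> vs ?U \<times> vs ?U" using b(2) Sigma_mono[OF vv vv] by (rule subset_trans)
    ultimately have "range h \<subseteq> ms (stage_at \<alpha>) h \<and> vs ?U \<subseteq> Domain (ms (stage_at \<alpha>) h) \<and> vs ?U \<subseteq> Range (ms (stage_at \<alpha>) h)"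
      unfolding o by (intro st(3))
    then show ?thesis using subset_trans[OF vv] by simp
  qed
  have "good_stage (stage_at \<alpha>)" unfolding o by (rule st(1))
  moreover have "stage_le base_stage (stage_at \<alpha>)" by (rule leo) simp
  moreover have "\<forall>\<beta>. (\<beta>, \<alpha>) \<in> stage_order - Id \<longrightarrow> stage_le (stage_at \<beta>) (stage_at \<alpha>)" using leo by blast
  moreover have "\<forall>\<beta> h. (\<beta>, \<alpha>) \<in> stage_order - Id \<longrightarrow> range h \<subseteq> vs (stage_at \<beta>) \<times> vs (stage_at \<beta>) \<longrightarrow> piso (es (stage_at \<beta>)) (range h) \<longrightarrow>
     range h \<subseteq> ms (stage_at \<alpha>) h \<and> vs (stage_at \<beta>) \<subseteq> Domain (ms (stage_at \<alpha>) h) \<and> vs (stage_at \<beta>) \<subseteq> Range (ms (stage_at \<alpha>) h)"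
    by (intro allI impI fin)
  ultimately show ?case by (intro conjI v)
qed

lemmas obj_good = conjunct1[OF obj_invariant]
lemmas base_le_obj = conjunct1[OF conjunct2[OF obj_invariant]]
lemmas obj_mono = conjunct1[OF conjunct2[OF conjunct2[OF obj_invariant]], rule_format]
lemmas obj_extends = conjunct2[OF conjunct2[OF conjunct2[OF conjunct2[OF obj_invariant]]], rule_format]

section \<open>Universality and homogeneity of the limit digraph\<close>

definition limit :: stage where
  "limit = unions (stage_at ` Field stage_order)"

lemma lim_good: "good_stage limit" and obj_le_lim: "\<alpha> \<in> Field stage_order \<Longrightarrow> stage_le (stage_at \<alpha>) limit"
proof -
  have g: "good_stage S" if "S \<in> stage_at ` Field stage_order" for S using that obj_good by auto
  have ch: "stage_le S S' \<or> stage_le S' S" if SS: "S \<in> stage_at ` Field stage_order" "S' \<in> stage_at ` Field stage_order" for S S'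
  proof -
    obtain \<beta> \<gamma> where b: "S = stage_at \<beta>" "S' = stage_at \<gamma>" "\<beta> \<in> Field stage_order" "\<gamma> \<in> Field stage_order" using SS by auto
    have "stage_le (stage_at \<beta>) (stage_at \<beta>)" by (rule stage_le_refl[OF obj_good])
    moreover have "\<beta> = \<gamma> \<or> (\<beta>, \<gamma>) \<in> stage_order - Id \<or> (\<gamma>, \<beta>) \<in> stage_order - Id" using ord_facts(3) b(3,4) unfolding total_on_def by blast
    ultimately show ?thesis using obj_mono b(1,2) by metis
  qed
  show "good_stage limit" "\<alpha> \<in> Field stage_order \<Longrightarrow> stage_le (stage_at \<alpha>) limit"
    unfolding limit_def using unions_good[of "stage_at ` Field stage_order", OF g ch] by blast+
qed

lemma ord_limit: "\<alpha> \<in> Field stage_order \<Longrightarrow> \<exists>\<beta>\<in>Field stage_order. (\<alpha>, \<beta>) \<in> stage_order - Id"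
proof -
  assume a: "\<alpha> \<in> Field stage_order"
  have "infinite (Field stage_order)" unfolding stage_order_def
    using cardSuc_finite[OF card_of_Card_order[of "UNIV :: nat set set"]] inf_cont by (simp add: Field_card_of)
  from infinite_Card_order_limit[OF ord_card_order this a] show ?thesis by auto
qed

lemma ord_directed: "\<alpha> \<in> Field stage_order \<Longrightarrow> \<beta> \<in> Field stage_order \<Longrightarrow> \<exists>\<gamma>\<in>Field stage_order. (\<alpha>, \<gamma>) \<in> stage_order - Id \<and> (\<beta>, \<gamma>) \<in> stage_order - Id"
proof -
  assume ab: "\<alpha> \<in> Field stage_order" "\<beta> \<in> Field stage_order"
  then consider "\<alpha> = \<beta>" | "(\<alpha>, \<beta>) \<in> stage_order - Id" | "(\<beta>, \<alpha>) \<in> stage_order - Id" using ord_facts(3) unfolding total_on_def by blast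
  then show ?thesis
  proof cases
    case 1 then show ?thesis using ord_limit[OF ab(1)] by auto
  next
    case 2 then show ?thesis using ord_limit[OF ab(2)] transD[OF ord_facts(2)] by blast
  next
    case 3 then show ?thesis using ord_limit[OF ab(1)] transD[OF ord_facts(2)] by blast
  qed
qed

text \<open>Regularity of a successor cardinal: continuum many points cannot be cofinal in the
  stages.\<close>

lemma small_in_stage:
  assumes "B \<subseteq> vs limit" "|B| \<le>o |UNIV :: nat set set|"
  shows "\<exists>\<alpha>\<in>Field stage_order. B \<subseteq> vs (stage_at \<alpha>)"
  unfolding stage_order_def
proof (rule cardSuc_UNION[OF card_of_Card_order _ _ _ assms(2)])
  show "infinite (Field |UNIV :: nat set set| )" using inf_cont by (simp add: Field_card_of)
  show "relChain (cardSuc |UNIV :: nat set set| ) (\<lambda>\<alpha>. vs (stage_at \<alpha>))" unfolding relChain_def stage_order_def[symmetric]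
  proof (intro allI impI)
    fix i j assume "(i, j) \<in> stage_order"
    then show "vs (stage_at i) \<subseteq> vs (stage_at j)" using obj_mono[of i j] by (cases "i = j") (auto simp: stage_le_def)
  qed
  show "B \<subseteq> (\<Union>\<alpha>\<in>Field (cardSuc |UNIV :: nat set set| ). vs (stage_at \<alpha>))"
    using assms(1) by (simp add: limit_def unions_def stage_order_def)
qed

text \<open>\<open>D\<close> is a component of the first stage, and later stages add no edges
  between old points.\<close>

lemma lim_universal:
  assumes "trifree UNIV (D :: nat set rel)"
  shows "\<exists>f. inj f \<and> range f \<subseteq> vs limit \<and> (\<forall>x y. (x, y) \<in> D \<longleftrightarrow> (f x, f y) \<in> es limit)"
proof -
  obtain \<alpha> where a: "\<alpha> \<in> Field stage_order"
    using cardSuc_finite[OF card_of_Card_order[of "UNIV :: nat set set"]] inf_cont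
    by (metis Field_card_of all_not_in_conv finite.emptyI stage_order_def)
  have "stage_le base_stage limit" by (rule stage_le_trans[OF base_le_obj obj_le_lim[OF a]])
  then have l: "vs base_stage \<subseteq> vs limit" "es base_stage = es limit \<inter> vs base_stage \<times> vs base_stage" by (auto simp: stage_le_def)
  let ?f = "\<lambda>a. enc (Inr (D, a))"
  have v: "?f a \<in> vs base_stage" for a by (auto simp: base_stage_def)
  have "(x, y) \<in> D \<longleftrightarrow> (?f x, ?f y) \<in> es base_stage" for x y using assms by (auto simp: base_stage_def)
  moreover have "(?f x, ?f y) \<in> es base_stage \<longleftrightarrow> (?f x, ?f y) \<in> es limit" for x y by (subst l(2)) (simp add: v)
  ultimately have "(x, y) \<in> D \<longleftrightarrow> (?f x, ?f y) \<in> es limit" for x y by simp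
  moreover have "inj ?f" by (rule injI) simp
  moreover have "range ?f \<subseteq> vs limit" using v l(1) by auto
  ultimately show ?thesis by (intro exI[of _ ?f]) simp
qed

text \<open>The map is the range of a code and lives in one stage. Later stages extend it past every
  stage in domain and range, so \<open>ms limit h\<close> is the graph of an automorphism.\<close>

lemma lim_homogeneous:
  assumes P: "P \<subseteq> vs limit \<times> vs limit" "|P| \<le>o |UNIV :: nat set set|" "piso (es limit) P"
  shows "\<exists>\<sigma>. bij_betw \<sigma> (vs limit) (vs limit) \<and> (\<forall>x\<in>vs limit. \<forall>y\<in>vs limit. (x, y) \<in> es limit \<longleftrightarrow> (\<sigma> x, \<sigma> y) \<in> es limit) \<and>
    (\<forall>(x, y)\<in>P. \<sigma> x = y)"
\<comment> \<open>The range of a code is never empty, so the empty map is treated apart.\<close>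
proof (cases "P = {}")
  case True
  then show ?thesis by (intro exI[of _ id]) auto
next
  case False
  from iffD2[OF card_of_ordLeq2[OF this] P(2)] obtain h :: code where h: "range h = P" by (elim exE)
  have "|Domain P \<union> Range P| \<le>o |UNIV :: nat set set|"
  proof -
    have DR: "|Domain P| \<le>o |UNIV :: nat set set|" "|Range P| \<le>o |UNIV :: nat set set|"
      unfolding Domain_fst Range_snd by (rule ordLeq_transitive[OF card_of_image P(2)])+
    have "infinite (Field |UNIV :: nat set set| )" unfolding Field_card_of by (rule inf_cont)
    from card_of_Un_ordLeq_infinite_Field[OF this DR card_of_Card_order] show ?thesis .
  qed
  moreover have "Domain P \<union> Range P \<subseteq> vs limit" using P(1) by auto
  ultimately obtain \<alpha> where a: "\<alpha> \<in> Field stage_order" "Domain P \<union> Range P \<subseteq> vs (stage_at \<alpha>)" using small_in_stage by blast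
  \<comment> \<open>The stage \<open>\<gamma>\<close> lies above both the stage containing the map
    and \<open>\<alpha>'\<close>; a later stage \<open>\<beta>\<close> extends the map over all of
    \<open>\<gamma>\<close>.\<close>
  have stage: "\<exists>\<beta>\<in>Field stage_order. range h \<subseteq> ms (stage_at \<beta>) h \<and> vs (stage_at \<alpha>') \<subseteq> Domain (ms (stage_at \<beta>) h) \<and> vs (stage_at \<alpha>') \<subseteq> Range (ms (stage_at \<beta>) h)"
    if a': "\<alpha>' \<in> Field stage_order" for \<alpha>'
  proof -
    obtain \<gamma> where g: "\<gamma> \<in> Field stage_order" "(\<alpha>, \<gamma>) \<in> stage_order - Id" "(\<alpha>', \<gamma>) \<in> stage_order - Id" using ord_directed[OF a(1) a'] by blast
    obtain \<beta> where b: "\<beta> \<in> Field stage_order" "(\<gamma>, \<beta>) \<in> stage_order - Id" using ord_limit[OF g(1)] by blast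
    have v: "vs (stage_at \<alpha>) \<subseteq> vs (stage_at \<gamma>)" "vs (stage_at \<alpha>') \<subseteq> vs (stage_at \<gamma>)" using obj_mono[OF g(2)] obj_mono[OF g(3)] by (auto simp: stage_le_def)
    have r: "range h \<subseteq> vs (stage_at \<gamma>) \<times> vs (stage_at \<gamma>)" unfolding h using a(2) v(1) by auto
    have "piso (es (stage_at \<gamma>)) (range h)" unfolding piso_def
    proof (intro allI impI)
      fix x x' y y' assume q: "(x, x') \<in> range h" "(y, y') \<in> range h"
      have "x \<in> vs (stage_at \<gamma>)" "x' \<in> vs (stage_at \<gamma>)" "y \<in> vs (stage_at \<gamma>)" "y' \<in> vs (stage_at \<gamma>)" using subsetD[OF r q(1)] subsetD[OF r q(2)] by simp_all
      then have "(x, y) \<in> es (stage_at \<gamma>) \<longleftrightarrow> (x, y) \<in> es limit" "(x', y') \<in> es (stage_at \<gamma>) \<longleftrightarrow> (x', y') \<in> es limit"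
        using obj_le_lim[OF g(1)] by (auto simp: stage_le_def)
      then show "(x = y \<longleftrightarrow> x' = y') \<and> ((x, y) \<in> es (stage_at \<gamma>) \<longleftrightarrow> (x', y') \<in> es (stage_at \<gamma>))" using pisoD[OF P(3)] q h by simp
    qed
    then have "range h \<subseteq> ms (stage_at \<beta>) h \<and> vs (stage_at \<gamma>) \<subseteq> Domain (ms (stage_at \<beta>) h) \<and> vs (stage_at \<gamma>) \<subseteq> Range (ms (stage_at \<beta>) h)"
      by (rule obj_extends[OF b(2) r])
    then show ?thesis using v(2) b(1) by (meson subset_trans)
  qed
  let ?Q = "ms limit h"
  have Q: "?Q \<subseteq> vs limit \<times> vs limit" "piso (es limit) ?Q" using lim_good by (auto simp: good_stage_def)
  have QI: "ms (stage_at \<beta>) h \<subseteq> ?Q" if "\<beta> \<in> Field stage_order" for \<beta> using obj_le_lim[OF that] by (simp add: stage_le_def)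
  have dr: "x \<in> Domain ?Q \<and> x \<in> Range ?Q" if x: "x \<in> vs limit" for x
  proof -
    obtain \<alpha>' where "\<alpha>' \<in> Field stage_order" "x \<in> vs (stage_at \<alpha>')" using x by (auto simp: limit_def unions_def)
    with stage obtain \<beta> where "\<beta> \<in> Field stage_order" "x \<in> Domain (ms (stage_at \<beta>) h)" "x \<in> Range (ms (stage_at \<beta>) h)" by (meson subsetD)
    then show ?thesis using QI by blast
  qed
  have PQ: "P \<subseteq> ?Q" using stage[OF a(1)] QI h by blast
  define \<sigma> where "\<sigma> = (\<lambda>x. SOME y. (x, y) \<in> ?Q)"
  have s: "(x, \<sigma> x) \<in> ?Q" if "x \<in> vs limit" for x unfolding \<sigma>_def using dr[OF that] by (meson DomainE someI)
  have u: "\<sigma> x = y" if q: "(x, y) \<in> ?Q" for x y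
  proof -
    have "x \<in> vs limit" using q Q(1) by auto
    then show ?thesis using pisoD(1)[OF Q(2) s q, of x] by simp
  qed
  have "inj_on \<sigma> (vs limit)"
  proof (rule inj_onI)
    fix x y assume "x \<in> vs limit" "y \<in> vs limit" "\<sigma> x = \<sigma> y"
    then show "x = y" using pisoD(1)[OF Q(2) s s] by simp
  qed
  moreover have "\<sigma> ` vs limit = vs limit"
  proof
    show "\<sigma> ` vs limit \<subseteq> vs limit" using s Q(1) by blast
    show "vs limit \<subseteq> \<sigma> ` vs limit"
    proof
      fix y assume "y \<in> vs limit"
      then obtain x where "(x, y) \<in> ?Q" using dr by blast
      moreover from this have "x \<in> vs limit" using Q(1) by auto
      ultimately show "y \<in> \<sigma> ` vs limit" using u by blast
    qed
  qed
  moreover have "(x, y) \<in> es limit \<longleftrightarrow> (\<sigma> x, \<sigma> y) \<in> es limit" if "x \<in> vs limit" "y \<in> vs limit" for x y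
    using pisoD(2)[OF Q(2) s[OF that(1)] s[OF that(2)]] .
  moreover have "\<forall>(x, y)\<in>P. \<sigma> x = y" using u PQ by blast
  ultimately show ?thesis unfolding bij_betw_def by (intro exI[of _ \<sigma>]) simp
qed

text \<open>Universality gives some copy of \<open>C\<close> in the limit; homogeneity moves the
  part of it that corresponds to \<open>X\<close> onto the prescribed \<open>g\<close>.\<close>

lemma lim_extend:
  fixes C :: "'b set" and Q :: "'b rel"
  assumes C: "|C| \<le>o |UNIV :: nat set set|" "trifree C Q" and X: "X \<subseteq> C"
    and g: "inj_on g X" "g ` X \<subseteq> vs limit" "\<And>x y. x \<in> X \<Longrightarrow> y \<in> X \<Longrightarrow> (x, y) \<in> Q \<longleftrightarrow> (g x, g y) \<in> es limit"
  shows "\<exists>G. inj_on G C \<and> G ` C \<subseteq> vs limit \<and> (\<forall>x\<in>C. \<forall>y\<in>C. (x, y) \<in> Q \<longleftrightarrow> (G x, G y) \<in> es limit) \<and> (\<forall>x\<in>X. G x = g x)"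
proof -
  obtain j :: "'b \<Rightarrow> nat set" where j: "inj_on j C" using C(1) card_of_ordLeq[of C "UNIV :: nat set set"] by auto
  define D where "D = {(j x, j y) |x y. x \<in> C \<and> y \<in> C \<and> (x, y) \<in> Q}"
  have D: "(j x, j y) \<in> D \<longleftrightarrow> (x, y) \<in> Q" if "x \<in> C" "y \<in> C" for x y
  proof
    assume "(j x, j y) \<in> D"
    then obtain x' y' where *: "j x = j x'" "j y = j y'" "x' \<in> C" "y' \<in> C" "(x', y') \<in> Q" by (auto simp: D_def)
    then have "x = x'" "y = y'" using inj_onD[OF j] that by simp_all
    then show "(x, y) \<in> Q" using * by simp
  qed (use that in \<open>auto simp: D_def\<close>)
  have "trifree UNIV D" unfolding trifree_def
  proof (intro ballI impI notI)
    fix a b c assume e: "(a, b) \<in> D" "(b, c) \<in> D" "(c, a) \<in> D"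
    then obtain x y z where "a = j x" "b = j y" "c = j z" "x \<in> C" "y \<in> C" "z \<in> C" by (auto simp: D_def)
    then show False using trifreeD[OF C(2), of x y z] e D by simp
  qed
  from lim_universal[OF this] obtain f where f: "inj f" "range f \<subseteq> vs limit" "\<And>x y. (x, y) \<in> D \<longleftrightarrow> (f x, f y) \<in> es limit" by blast
  define P where "P = (\<lambda>x. (f (j x), g x)) ` X"
  have P1: "P \<subseteq> vs limit \<times> vs limit" using f(2) g(2) by (auto simp: P_def)
  have P2: "|P| \<le>o |UNIV :: nat set set|"
    unfolding P_def by (rule ordLeq_transitive[OF card_of_image ordLeq_transitive[OF card_of_mono1[OF X] C(1)]])
  have P3: "piso (es limit) P" unfolding piso_def
  proof (intro allI impI)
    fix x x' y y' assume "(x, x') \<in> P" "(y, y') \<in> P"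
    then obtain u v where uv: "u \<in> X" "v \<in> X" "x = f (j u)" "x' = g u" "y = f (j v)" "y' = g v" by (auto simp: P_def)
    have uC: "u \<in> C" "v \<in> C" using uv X by auto
    have "x = y \<longleftrightarrow> u = v" using uv inj_eq[OF f(1)] inj_on_eq_iff[OF j uC] by simp
    moreover have "x' = y' \<longleftrightarrow> u = v" using uv inj_on_eq_iff[OF g(1) uv(1,2)] by simp
    ultimately show "(x = y \<longleftrightarrow> x' = y') \<and> ((x, y) \<in> es limit \<longleftrightarrow> (x', y') \<in> es limit)"
      using uv f(3)[of "j u" "j v"] D[OF uC] g(3)[OF uv(1,2)] by simp
  qed
  from lim_homogeneous[OF P1 P2 P3] obtain \<sigma> where bij: "bij_betw \<sigma> (vs limit) (vs limit)"
    and edge: "\<forall>x\<in>vs limit. \<forall>y\<in>vs limit. (x, y) \<in> es limit \<longleftrightarrow> (\<sigma> x, \<sigma> y) \<in> es limit"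
    and ext: "\<forall>(x, y)\<in>P. \<sigma> x = y" by (elim exE conjE)
  let ?G = "\<lambda>x. \<sigma> (f (j x))"
  have fv: "f a \<in> vs limit" for a using f(2) by auto
  have "inj_on ?G C"
  proof (rule inj_onI)
    fix x y assume xy: "x \<in> C" "y \<in> C" "?G x = ?G y"
    have "f (j x) = f (j y)" using inj_onD[OF bij_betw_imp_inj_on[OF bij] xy(3) fv fv] .
    then show "x = y" using inj_eq[OF f(1)] inj_onD[OF j _ xy(1,2)] by simp
  qed
  moreover have "?G ` C \<subseteq> vs limit" using fv bij_betw_imp_surj_on[OF bij] by auto
  moreover have "(x, y) \<in> Q \<longleftrightarrow> (?G x, ?G y) \<in> es limit" if "x \<in> C" "y \<in> C" for x y
    using D[OF that] f(3)[of "j x" "j y"] edge fv by simp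
  moreover have "?G x = g x" if "x \<in> X" for x using ext that by (auto simp: P_def)
  ultimately show ?thesis by (intro exI[of _ ?G]) auto
qed

section \<open>The theory of the homogeneous digraph\<close>

instance tm :: (countable) countable by countable_datatype

instance fm :: (countable, countable) countable by countable_datatype

definition GL :: "(nat, nat) language" where
  "GL = \<lparr>funs = {}, rels = {0}, farity = (\<lambda>_. 0), rarity = (\<lambda>_. 2)\<rparr>"

definition GN :: "(point, nat, nat) struct" where
  "GN = \<lparr>dom = vs limit, fn = (\<lambda>_ _. {}), rel = (\<lambda>_ a. (a ! 0, a ! 1) \<in> es limit)\<rparr>"

definition GT :: "(nat, nat) fm set" where
  "GT = {\<phi>. wf_fm GL 0 \<phi> \<and> sat GN [] \<phi>}"

lemma GL_simps [simp]: "funs GL = {}" "rels GL = {0}" "rarity GL P = 2"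
  by (simp_all add: GL_def)

lemma GN_simps [simp]: "dom GN = vs limit" "rel GN P a \<longleftrightarrow> (a ! 0, a ! 1) \<in> es limit"
  by (simp_all add: GN_def)

lemma lim_nonempty: "vs limit \<noteq> {}"
  using lim_universal[of "{}"] by (auto simp: trifree_def)

lemma GN_struct: "is_struct GL GN"
  using lim_nonempty by (simp add: is_struct_def)

lemma GN_model: "is_model GL GT GN"
  using GN_struct by (simp add: is_model_def GT_def)

lemma lim_trifree: "trifree (vs limit) (es limit)"
  using lim_good by (simp add: good_stage_def)

lemma GN_automorphism:
  assumes "bij_betw \<sigma> (vs limit) (vs limit)" "\<forall>x\<in>vs limit. \<forall>y\<in>vs limit. (x, y) \<in> es limit \<longleftrightarrow> (\<sigma> x, \<sigma> y) \<in> es limit"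
  shows "automorphism GL GN \<sigma>"
  unfolding automorphism_def
proof (intro conjI ballI)
  fix P e assume "P \<in> rels GL" and e: "e \<in> tuples (dom GN) (rarity GL P)"
  then have "length e = 2" "set e \<subseteq> vs limit" by (simp_all add: tuples_def)
  then show "rel GN P e \<longleftrightarrow> rel GN P (map \<sigma> e)" using assms(2) nth_mem[of _ e] by (simp add: subset_iff)
qed (use assms(1) in simp_all)

lemma set_zip_map: "set (zip (map f xs) (map g xs)) = (\<lambda>x. (f x, g x)) ` set xs"
  by (induction xs) auto

text \<open>Quantifier-free equivalence of finite tuples implies elementary equivalence, because the
  partial isomorphism extends to an automorphism.\<close>

lemma piso_sat:
  assumes l: "length e = length e'" and P: "piso (es limit) (set (zip e e'))"
    and d: "set e \<subseteq> vs limit" "set e' \<subseteq> vs limit" and wf: "wf_fm GL (length e) \<phi>"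
  shows "sat GN e \<phi> \<longleftrightarrow> sat GN e' \<phi>"
proof -
  let ?P = "set (zip e e')"
  have 1: "?P \<subseteq> vs limit \<times> vs limit" using d by (auto dest: set_zip_leftD set_zip_rightD)
  have 2: "|?P| \<le>o |UNIV :: nat set set|"
    by (rule ordLess_imp_ordLeq, rule finite_ordLess_infinite)
      (simp_all only: Field_card_of card_of_well_order_on finite_set inf_cont not_False_eq_True)
  from lim_homogeneous[OF 1 2 P] obtain \<sigma> where s: "bij_betw \<sigma> (vs limit) (vs limit)"
    "\<forall>x\<in>vs limit. \<forall>y\<in>vs limit. (x, y) \<in> es limit \<longleftrightarrow> (\<sigma> x, \<sigma> y) \<in> es limit" "\<forall>(x, y)\<in>?P. \<sigma> x = y" by (elim exE conjE)
  have "map \<sigma> e = e'"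
  proof (rule nth_equalityI)
    fix i assume i: "i < length (map \<sigma> e)"
    then have "(e ! i, e' ! i) \<in> ?P" using l by (auto simp: set_zip)
    then show "map \<sigma> e ! i = e' ! i" using s(3) i by auto
  qed (simp add: l)
  moreover have "e \<in> tuples (dom GN) (length e)" using d(1) by (simp add: tuples_def)
  ultimately show ?thesis using automorphism_sat[OF GN_struct GN_automorphism[OF s(1,2)] wf] by metis
qed

section \<open>The limit digraph as a monster model\<close>

lemma small_iff: "|A :: 'a set| <o stage_order \<longleftrightarrow> |A| \<le>o |UNIV :: nat set set|"
  unfolding stage_order_def by (rule cardSuc_ordLeq_ordLess) (rule card_of_Card_order)+

lemma cont_infinite_Field: "infinite (Field |UNIV :: nat set set| )"
  unfolding Field_card_of by (rule inf_cont)

lemma cont_Un: "|A| \<le>o |UNIV :: nat set set| \<Longrightarrow> |B| \<le>o |UNIV :: nat set set| \<Longrightarrow> |A \<union> B| \<le>o |UNIV :: nat set set|"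
  by (rule card_of_Un_ordLeq_infinite_Field[OF cont_infinite_Field _ _ card_of_Card_order])

lemma cont_finite: "finite A \<Longrightarrow> |A| \<le>o |UNIV :: nat set set|"
  by (rule ordLess_imp_ordLeq, rule finite_ordLess_infinite)
    (simp_all only: Field_card_of card_of_well_order_on inf_cont not_False_eq_True)

lemma cont_image: "|A| \<le>o |UNIV :: nat set set| \<Longrightarrow> |f ` A| \<le>o |UNIV :: nat set set|"
  by (rule ordLeq_transitive[OF card_of_image])

lemma cont_countable_Un: "(\<And>n::nat. |A n| \<le>o |UNIV :: nat set set| ) \<Longrightarrow> |\<Union>n. A n| \<le>o |UNIV :: nat set set|"
  by (rule card_of_UNION_ordLeq_infinite[OF inf_cont]) (auto simp: infinite_iff_card_of_nat[symmetric] inf_cont)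

lemma GN_homogeneous: "strongly_homogeneous GL stage_order GN"
  unfolding strongly_homogeneous_def
proof (intro allI impI)
  fix A h assume *: "partial_elementary GL GN A h \<and> |A| <o stage_order"
  then have A: "A \<subseteq> vs limit" "h ` A \<subseteq> vs limit"
    and el: "\<And>n \<phi> e. wf_fm GL n \<phi> \<Longrightarrow> e \<in> tuples A n \<Longrightarrow> sat GN e \<phi> \<longleftrightarrow> sat GN (map h e) \<phi>"
    and sm: "|A| \<le>o |UNIV :: nat set set|"
    by (auto simp: partial_elementary_def small_iff)
  let ?P = "(\<lambda>x. (x, h x)) ` A"
  have 1: "?P \<subseteq> vs limit \<times> vs limit" using A by auto
  have 3: "piso (es limit) ?P" unfolding piso_def
  proof (intro allI impI)
    fix x x' y y' assume "(x, x') \<in> ?P" "(y, y') \<in> ?P"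
    then have xy: "x \<in> A" "y \<in> A" "x' = h x" "y' = h y" by auto
    then have e: "[x, y] \<in> tuples A 2" by (simp add: tuples_def)
    have "sat GN [x, y] (Eq (Var 0) (Var 1)) \<longleftrightarrow> sat GN (map h [x, y]) (Eq (Var 0) (Var 1))" by (rule el[OF _ e]) simp
    moreover have "sat GN [x, y] (Rel 0 [Var 0, Var 1]) \<longleftrightarrow> sat GN (map h [x, y]) (Rel 0 [Var 0, Var 1])" by (rule el[OF _ e]) simp
    ultimately show "(x = y \<longleftrightarrow> x' = y') \<and> ((x, y) \<in> es limit \<longleftrightarrow> (x', y') \<in> es limit)" using xy by simp
  qed
  from lim_homogeneous[OF 1 cont_image[OF sm] 3] obtain \<sigma> where s: "bij_betw \<sigma> (vs limit) (vs limit)"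
    "\<forall>x\<in>vs limit. \<forall>y\<in>vs limit. (x, y) \<in> es limit \<longleftrightarrow> (\<sigma> x, \<sigma> y) \<in> es limit" "\<forall>(x, y)\<in>?P. \<sigma> x = y" by (elim exE conjE)
  have "\<forall>u\<in>A. \<sigma> u = h u" using s(3) by auto
  then show "\<exists>h'. automorphism GL GN h' \<and> (\<forall>u\<in>A. h' u = h u)" using GN_automorphism[OF s(1,2)] by blast
qed

text \<open>An ultrafilter containing the solution sets of \<open>\<Sigma>\<close> decides the
  diagram of a would-be solution over \<open>A\<close>. This diagram is a triangle-free digraph of
  size at most continuum, so \<open>lim_extend\<close> realizes it over \<open>A\<close>.\<close>

lemma GN_saturated: "saturated GL stage_order GN"
  unfolding saturated_def
proof (intro allI impI)
  fix A k \<Sigma> assume A: "A \<subseteq> dom GN" and sm: "|A| <o stage_order" and \<Sigma>: "\<Sigma> \<subseteq> forms GL A k" and con: "consistent GN k \<Sigma>"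
  let ?S = "\<lambda>F. {t \<in> tuples (vs limit) k. holds GN t F}"
  have fip: "\<Inter>\<F> \<noteq> {}" if \<F>: "finite \<F>" "\<F> \<subseteq> insert (tuples (vs limit) k) (?S ` \<Sigma>)" for \<F>
  proof -
    have "finite (\<F> - {tuples (vs limit) k})" "\<F> - {tuples (vs limit) k} \<subseteq> ?S ` \<Sigma>" using \<F> by auto
    from finite_subset_image[OF this] obtain \<Sigma>0 where \<Sigma>0: "\<Sigma>0 \<subseteq> \<Sigma>" "finite \<Sigma>0" "\<F> - {tuples (vs limit) k} = ?S ` \<Sigma>0"
      by (elim exE conjE)
    obtain t where t: "t \<in> tuples (vs limit) k" "realizes GN t \<Sigma>0" using con \<Sigma>0 unfolding consistent_def by auto
    have "t \<in> B" if B: "B \<in> \<F>" for B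
    proof (cases "B = tuples (vs limit) k")
      case False
      then have "B \<in> ?S ` \<Sigma>0" unfolding \<Sigma>0(3)[symmetric] using B by simp
      then obtain F where "F \<in> \<Sigma>0" "B = ?S F" by (rule imageE)
      then show ?thesis using t by (simp add: realizes_def)
    qed (simp add: t)
    then show ?thesis by blast
  qed
  obtain W where W: "ultrafilter W" "insert (tuples (vs limit) k) (?S ` \<Sigma>) \<subseteq> W"
    using ultrafilter_extend[OF fip] by blast
  have Wt: "tuples (vs limit) k \<in> W" using W(2) by simp
  \<comment> \<open>Parameters and coordinates are treated alike as names, \<open>Inl a\<close> and
    \<open>Inr i\<close>, which a tuple \<open>t\<close> evaluates.\<close>
  define ev where "ev = (\<lambda>(t :: point list) y. case y of Inl a \<Rightarrow> a | Inr i \<Rightarrow> t ! i)"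
  define D where "D = Inl ` A \<union> Inr ` {..<k}"
  define q where "q = (\<lambda>x y. {t. ev t x = ev t y} \<in> W)"
  \<comment> \<open>Names that are equal almost everywhere must denote one point; the quotient is
    formed by representatives inside \<open>D\<close>.\<close>
  define r where "r = (\<lambda>x. SOME y. y \<in> D \<and> q x y)"
  define Q where "Q = {(x, y). {t. (ev t x, ev t y) \<in> es limit} \<in> W}"
  have evd: "ev t x \<in> vs limit" if "x \<in> D" "t \<in> tuples (vs limit) k" for x t
  proof (cases x)
    case (Inl a)
    then show ?thesis using that(1) A by (auto simp: D_def ev_def)
  next
    case (Inr i)
    then have "i < length t" "set t \<subseteq> vs limit" using that by (auto simp: D_def tuples_def)
    then show ?thesis using Inr nth_mem[of i t] by (auto simp: ev_def)
  qed
  have W2: "A \<in> W \<Longrightarrow> B \<in> W \<Longrightarrow> A \<inter> B \<subseteq> C \<Longrightarrow> C \<in> W" for A B C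
    by (rule ultrafilterD(2)[OF W(1) ultrafilterD(3)[OF W(1)]])
  have qr: "q x x" for x using ultrafilterD(5)[OF W(1)] by (simp add: q_def)
  have qs: "q x y \<Longrightarrow> q y x" for x y unfolding q_def by (erule ultrafilterD(2)[OF W(1)]) auto
  have qt: "q x y \<Longrightarrow> q y z \<Longrightarrow> q x z" for x y z unfolding q_def by (erule W2, assumption) auto
  have rD: "r x \<in> D \<and> q x (r x)" if "x \<in> D" for x unfolding r_def by (rule someI[of _ x]) (simp add: that qr)
  have r_eq: "r x = r y \<longleftrightarrow> q x y" if "x \<in> D" "y \<in> D" for x y
  proof
    assume "r x = r y"
    then show "q x y" using rD[OF that(1)] rD[OF that(2)] qs qt by metis
  next
    assume "q x y"
    then have "(\<lambda>z. z \<in> D \<and> q x z) = (\<lambda>z. z \<in> D \<and> q y z)" using qs qt by blast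
    then show "r x = r y" by (simp add: r_def)
  qed
  have Qr: "(r x, r y) \<in> Q \<longleftrightarrow> (x, y) \<in> Q" if "x \<in> D" "y \<in> D" for x y
  proof -
    have e: "{t. ev t x = ev t (r x)} \<inter> {t. ev t y = ev t (r y)} \<in> W"
      using rD[OF that(1)] rD[OF that(2)] ultrafilterD(3)[OF W(1)] by (simp add: q_def)
    show ?thesis unfolding Q_def mem_Collect_eq prod.case by (rule iffI; erule W2[OF e]; auto)
  qed
  let ?C = "r ` D"
  have tri: "trifree ?C Q" unfolding trifree_def
  proof (intro ballI impI notI)
    fix x y z assume "x \<in> ?C" "y \<in> ?C" "z \<in> ?C" and e: "(x, y) \<in> Q" "(y, z) \<in> Q" "(z, x) \<in> Q"
    then have d: "x \<in> D" "y \<in> D" "z \<in> D" using rD by auto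
    have "{t. (ev t x, ev t y) \<in> es limit} \<inter> {t. (ev t y, ev t z) \<in> es limit} \<inter> {t. (ev t z, ev t x) \<in> es limit} \<inter> tuples (vs limit) k \<in> W"
      using e Wt ultrafilterD(3)[OF W(1)] by (simp add: Q_def)
    then obtain t where t: "(ev t x, ev t y) \<in> es limit" "(ev t y, ev t z) \<in> es limit" "(ev t z, ev t x) \<in> es limit" "t \<in> tuples (vs limit) k"
      using ultrafilter_nonempty[OF W(1)] by blast
    show False using trifreeD[OF lim_trifree evd[OF d(1) t(4)] evd[OF d(2) t(4)] evd[OF d(3) t(4)]] t by blast
  qed
  have card: "|?C| \<le>o |UNIV :: nat set set|" unfolding D_def
    by (rule cont_image, rule cont_Un, rule cont_image) (use sm in \<open>simp add: small_iff\<close>, rule cont_finite, simp)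
  have ID: "Inl a \<in> D" if "a \<in> A" for a using that by (simp add: D_def)
  have qI: "q (Inl a) (Inl b) \<longleftrightarrow> a = b" for a b
    using ultrafilterD(1,5)[OF W(1)] by (auto simp: q_def ev_def)
  let ?X = "(\<lambda>a. r (Inl a)) ` A"
  have injr: "inj_on (\<lambda>a. r (Inl a)) A" by (rule inj_onI) (use r_eq ID qI in blast)
  define g where "g = inv_into A (\<lambda>a. r (Inl a))"
  have g: "g (r (Inl a)) = a" if "a \<in> A" for a unfolding g_def by (rule inv_into_f_f[OF injr that])
  have QI: "(Inl a, Inl b) \<in> Q \<longleftrightarrow> (a, b) \<in> es limit" for a b
    using ultrafilterD(1,5)[OF W(1)] by (cases "(a, b) \<in> es limit") (auto simp: Q_def ev_def)
  have "\<exists>G. inj_on G ?C \<and> G ` ?C \<subseteq> vs limit \<and> (\<forall>x\<in>?C. \<forall>y\<in>?C. (x, y) \<in> Q \<longleftrightarrow> (G x, G y) \<in> es limit) \<and> (\<forall>x\<in>?X. G x = g x)"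
  proof (rule lim_extend[OF card tri])
    show "?X \<subseteq> ?C" using ID by auto
    show "inj_on g ?X" by (rule inj_onI) (auto simp: g)
    show "g ` ?X \<subseteq> vs limit" using A by (auto simp: g)
    show "(x, y) \<in> Q \<longleftrightarrow> (g x, g y) \<in> es limit" if "x \<in> ?X" "y \<in> ?X" for x y
      using that g Qr[OF ID ID] QI by auto
  qed
  then obtain G where G: "inj_on G ?C" "G ` ?C \<subseteq> vs limit" "\<forall>x\<in>?C. \<forall>y\<in>?C. (x, y) \<in> Q \<longleftrightarrow> (G x, G y) \<in> es limit" "\<forall>x\<in>?X. G x = g x"
    by (elim exE conjE)
  define H where "H = (\<lambda>y. G (r y))"
  have Hd: "H y \<in> vs limit" if "y \<in> D" for y using G(2) that by (auto simp: H_def)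
  have Heq: "H y = H z \<longleftrightarrow> q y z" if "y \<in> D" "z \<in> D" for y z
    unfolding H_def using inj_on_eq_iff[OF G(1), of "r y" "r z"] r_eq[OF that] that by simp
  have HQ: "(H y, H z) \<in> es limit \<longleftrightarrow> (y, z) \<in> Q" if "y \<in> D" "z \<in> D" for y z
    unfolding H_def using G(3) Qr[OF that] that by simp
  have HI: "H (Inl a) = a" if "a \<in> A" for a unfolding H_def using G(4) g[OF that] that by simp
  let ?x = "map (\<lambda>i. H (Inr i)) [0..<k]"
  have IR: "Inr i \<in> D" if "i < k" for i using that by (simp add: D_def)
  have xd: "?x \<in> tuples (vs limit) k" using Hd IR by (auto simp: tuples_def)
  \<comment> \<open>Almost every \<open>t\<close> agrees with the decision of \<open>W\<close> on a
    given property. For finitely many properties one \<open>t\<close> agrees with all decisions and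
    also satisfies \<open>F\<close>, so it can be compared with the constructed tuple.\<close>
  have dec: "{t. P t \<longleftrightarrow> ({t. P t} \<in> W)} \<in> W" for P
    using ultrafilterD(4)[OF W(1), of "{t. P t}"] ultrafilter_Compl[OF W(1), of "{t. P t}"]
    by (cases "{t. P t} \<in> W") (simp_all add: Collect_neg_eq)
  have "holds GN ?x F" if F: "F \<in> \<Sigma>" for F
  proof -
    obtain \<phi> c where Fc: "F = (\<phi>, c)" by (metis surj_pair)
    have c: "set c \<subseteq> A" "wf_fm GL (k + length c) \<phi>" using F Fc \<Sigma> by (auto simp: forms_def)
    let ?y = "map Inr [0..<k] @ map Inl c"
    have yD: "set ?y \<subseteq> D" using c(1) by (auto simp: D_def)
    have "{t. \<forall>p\<in>set ?y \<times> set ?y. (ev t (fst p) = ev t (snd p) \<longleftrightarrow> {t. ev t (fst p) = ev t (snd p)} \<in> W)} \<in> W"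
      by (rule ultrafilter_ball[OF W(1)]) (simp, rule dec)
    moreover have "{t. \<forall>p\<in>set ?y \<times> set ?y. ((ev t (fst p), ev t (snd p)) \<in> es limit \<longleftrightarrow> {t. (ev t (fst p), ev t (snd p)) \<in> es limit} \<in> W)} \<in> W"
      by (rule ultrafilter_ball[OF W(1)]) (simp, rule dec)
    moreover have "?S F \<in> W" using W(2) F by auto
    ultimately have "{t. \<forall>p\<in>set ?y \<times> set ?y. (ev t (fst p) = ev t (snd p) \<longleftrightarrow> {t. ev t (fst p) = ev t (snd p)} \<in> W)} \<inter>
      {t. \<forall>p\<in>set ?y \<times> set ?y. ((ev t (fst p), ev t (snd p)) \<in> es limit \<longleftrightarrow> {t. (ev t (fst p), ev t (snd p)) \<in> es limit} \<in> W)} \<inter> ?S F \<in> W"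
      using ultrafilterD(3)[OF W(1)] by simp
    from ultrafilter_nonempty[OF W(1) this]
    obtain t where t1: "\<forall>p\<in>set ?y \<times> set ?y. (ev t (fst p) = ev t (snd p) \<longleftrightarrow> {t. ev t (fst p) = ev t (snd p)} \<in> W)"
      and t2: "\<forall>p\<in>set ?y \<times> set ?y. ((ev t (fst p), ev t (snd p)) \<in> es limit \<longleftrightarrow> {t. (ev t (fst p), ev t (snd p)) \<in> es limit} \<in> W)"
      and t3: "t \<in> tuples (vs limit) k" "holds GN t F" by auto
    have t4: "ev t y = ev t z \<longleftrightarrow> H y = H z" "(ev t y, ev t z) \<in> es limit \<longleftrightarrow> (H y, H z) \<in> es limit" if yz: "y \<in> set ?y" "z \<in> set ?y" for y z
    proof -
      have d: "y \<in> D" "z \<in> D" using yz yD by auto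
      show "ev t y = ev t z \<longleftrightarrow> H y = H z" using bspec[OF t1, of "(y, z)"] yz Heq[OF d] by (simp add: q_def)
      show "(ev t y, ev t z) \<in> es limit \<longleftrightarrow> (H y, H z) \<in> es limit" using bspec[OF t2, of "(y, z)"] yz HQ[OF d] by (simp add: Q_def)
    qed
    have m1: "map (ev t) ?y = t @ c" using t3(1) by (auto simp: ev_def tuples_def comp_def intro!: nth_equalityI)
    have m2: "map H ?y = ?x @ c" using c(1) HI by (auto simp: comp_def subset_iff intro!: map_idI)
    have "piso (es limit) (set (zip (map (ev t) ?y) (map H ?y)))" unfolding set_zip_map piso_def
    proof (intro allI impI)
      fix x x' y y' assume "(x, x') \<in> (\<lambda>x. (ev t x, H x)) ` set ?y" "(y, y') \<in> (\<lambda>x. (ev t x, H x)) ` set ?y"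
      then obtain u v where "u \<in> set ?y" "v \<in> set ?y" "x = ev t u" "x' = H u" "y = ev t v" "y' = H v"
        by (elim imageE Pair_inject)
      then show "(x = y \<longleftrightarrow> x' = y') \<and> ((x, y) \<in> es limit \<longleftrightarrow> (x', y') \<in> es limit)" using t4[of u v] by simp
    qed
    then have dg: "piso (es limit) (set (zip (t @ c) (?x @ c)))" unfolding m1 m2 .
    have "sat GN (t @ c) \<phi> \<longleftrightarrow> sat GN (?x @ c) \<phi>"
      by (rule piso_sat[OF _ dg]) (use t3(1) xd c A in \<open>auto simp: tuples_def\<close>)
    then show ?thesis using t3(2) Fc by (simp add: holds_def)
  qed
  then show "\<exists>a\<in>tuples (dom GN) k. realizes GN a \<Sigma>" using xd by (intro bexI[of _ ?x]) (simp_all add: realizes_def)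
qed

text \<open>There are countably many formulas, so the bound required of \<open>\<kappa>\<close> is
  the continuum.\<close>

lemma GN_monster: "monster GL GT stage_order GN"
proof -
  have "|Pow {\<phi> :: (nat, nat) fm. \<exists>n. wf_fm GL n \<phi>}| \<le>o |UNIV :: nat set set|"
  proof -
    have "inj_on (\<lambda>X. to_nat ` X) (Pow {\<phi> :: (nat, nat) fm. \<exists>n. wf_fm GL n \<phi>})"
      by (rule inj_onI) (simp add: inj_image_eq_iff)
    then show ?thesis using card_of_ordLeq[of _ "UNIV :: nat set set"] by blast
  qed
  then show ?thesis unfolding monster_def
    using GN_model ord_card_order GN_saturated GN_homogeneous by (simp add: small_iff)
qed

text \<open>Completeness is tested on structures whose universe consists of formulas. A countable
  elementary submodel, transported along an injection into that type, shows satisfiability there;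
  the full theory decides every sentence anyway.\<close>

lemma GT_complete: "complete_theory GL GT"
  unfolding complete_theory_def
proof (intro conjI allI impI ballI)
  have "\<exists>X :: nat \<Rightarrow> point set. elementary_submodel GL GN (\<Union>n. X n) \<and> |\<Union>n. X n| \<le>o |flas GL|"
  proof (rule elementary_hull[OF GN_struct, of "{}" "\<lambda>_. []"])
    fix X :: "nat \<Rightarrow> point set"
    assume "elementary_submodel GL GN (\<Union>n. X n)" "|\<Union>n. X n| \<le>o |flas GL|"
    then show ?thesis by (intro exI[of _ X] conjI)
  qed (simp_all add: card_of_empty)
  then obtain X :: "nat \<Rightarrow> point set" where X: "elementary_submodel GL GN (\<Union>n. X n)" "|\<Union>n. X n| \<le>o |flas GL|"
    by (elim exE conjE)
  define M where "M = (\<Union>n. X n)"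
  have "|M| \<le>o |UNIV :: (nat, nat) fm set|" unfolding M_def
    by (rule ordLeq_transitive[OF X(2) card_of_mono1]) simp
  then obtain \<iota> :: "point \<Rightarrow> (nat, nat) fm" where \<iota>: "inj_on \<iota> M" using card_of_ordLeq[of M "UNIV :: (nat, nat) fm set"] by auto
  have Md: "M \<subseteq> vs limit" "M \<noteq> {}" using X(1) by (auto simp: elementary_submodel_def is_struct_def M_def)
  define N' :: "((nat, nat) fm, nat, nat) struct" where
    "N' = \<lparr>dom = \<iota> ` M, fn = (\<lambda>_ _. undefined), rel = (\<lambda>P a. rel GN P (map (inv_into M \<iota>) a))\<rparr>"
  have v: "val N' (map \<iota> e) t = \<iota> (val GN e t) \<and> val GN e t \<in> M" if "wf_tm GL n t" "e \<in> tuples M n" for n t e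
    using that by (cases t) (auto simp: tuples_def)
  have s: "sat N' (map \<iota> e) \<phi> \<longleftrightarrow> sat (GN\<lparr>dom := M\<rparr>) e \<phi>" if "wf_fm GL n \<phi>" "e \<in> tuples M n" for n \<phi> e
    using that
  proof (induction \<phi> arbitrary: n e)
    case (Eq t t')
    then show ?case using v[of n t e] v[of n t' e] inj_on_eq_iff[OF \<iota>] by simp
  next
    case (Rel P ts)
    have "map (inv_into M \<iota>) (map (val N' (map \<iota> e)) ts) = map (val GN e) ts"
      using v[of n _ e] Rel by (auto simp: inv_into_f_f[OF \<iota>])
    moreover have "val (GN\<lparr>dom := M\<rparr>) e = val GN e" by (rule ext) simp
    ultimately show ?case by (simp add: N'_def del: GN_simps map_map)
  next
    case (Conj \<phi> \<psi>)
    then show ?case using Conj.IH(1)[of n e] Conj.IH(2)[of n e] by simp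
  next
    case (Ex \<phi>)
    have "sat N' (\<iota> u # map \<iota> e) \<phi> \<longleftrightarrow> sat (GN\<lparr>dom := M\<rparr>) (u # e) \<phi>" if "u \<in> M" for u
      using Ex.IH[of "Suc n" "u # e"] Ex.prems that by (simp add: tuples_def)
    then show ?case by (simp add: N'_def)
  qed auto
  have "is_model GL GT N'" unfolding is_model_def
  proof (intro conjI ballI)
    show "is_struct GL N'" using Md by (simp add: is_struct_def N'_def)
    fix \<phi> assume \<phi>: "\<phi> \<in> GT"
    then have "sat (GN\<lparr>dom := M\<rparr>) [] \<phi>"
      using elementary_submodel_sat[OF X(1), of 0 \<phi> "[]"] by (simp add: M_def GT_def tuples_def)
    then show "sat N' [] \<phi>" using s[of 0 \<phi> "[]"] \<phi> by (simp add: GT_def tuples_def)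
  qed
  then show "\<exists>N :: ((nat, nat) fm, nat, nat) struct. is_model GL GT N" by blast
  show "wf_fm GL 0 \<phi>" if "\<phi> \<in> GT" for \<phi> using that by (simp add: GT_def)
  show "(\<forall>N :: ((nat, nat) fm, nat, nat) struct. is_model GL GT N \<longrightarrow> sat N [] \<phi>) \<or>
    (\<forall>N :: ((nat, nat) fm, nat, nat) struct. is_model GL GT N \<longrightarrow> sat N [] (Neg \<phi>))" if w: "wf_fm GL 0 \<phi>" for \<phi>
  proof -
    have "\<phi> \<in> GT \<or> Neg \<phi> \<in> GT" using w by (simp add: GT_def)
    then show ?thesis unfolding is_model_def by blast
  qed
qed

text \<open>The strict order on the natural numbers has no directed triangle, so it embeds; 3-cycles
  of the edge relation are excluded in the limit.\<close>

lemma GN_SOP3: "SOP GL GN 3"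
proof -
  let ?Q = "{(i, j). i < j} :: nat rel"
  have "trifree UNIV ?Q" by (auto simp: trifree_def)
  moreover have "|UNIV :: nat set| \<le>o |UNIV :: nat set set|"
    using card_of_ordLeq[of "UNIV :: nat set" "UNIV :: nat set set"] inj_singleton by blast
  ultimately have "\<exists>G. inj_on G (UNIV :: nat set) \<and> G ` UNIV \<subseteq> vs limit \<and> (\<forall>x\<in>UNIV. \<forall>y\<in>UNIV. (x, y) \<in> ?Q \<longleftrightarrow> (G x, G y) \<in> es limit) \<and> (\<forall>x\<in>{}. G x = undefined x)"
    by (intro lim_extend) auto
  then obtain G :: "nat \<Rightarrow> point" where G: "range G \<subseteq> vs limit" "\<And>i j. i < j \<Longrightarrow> (G i, G j) \<in> es limit" by auto
  let ?\<phi> = "Rel 0 [Var 0, Var 1] :: (nat, nat) fm"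
  have s: "sat GN ([x] @ [y] @ []) ?\<phi> \<longleftrightarrow> (x, y) \<in> es limit" for x y by simp
  show ?thesis unfolding SOP_def
  proof (intro exI conjI)
    show "wf_fm GL (1 + 1 + length []) ?\<phi>" "set [] \<subseteq> dom GN" by simp_all
    show "(\<lambda>x y. sat GN (x @ y @ []) ?\<phi>) = (\<lambda>x y. sat GN (x @ y @ []) ?\<phi>)" ..
    show "\<forall>i. [G i] \<in> tuples (dom GN) 1" using G(1) by (auto simp: tuples_def)
    show "\<forall>i j. i < j \<longrightarrow> sat GN ([G i] @ [G j] @ []) ?\<phi>" using G(2) s by blast
    show "\<not> (\<exists>x. \<forall>i<3. x i \<in> tuples (dom GN) 1 \<and> sat GN (x i @ x (Suc i mod 3) @ []) ?\<phi>)"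
    proof
      assume "\<exists>x. \<forall>i<3. x i \<in> tuples (dom GN) 1 \<and> sat GN (x i @ x (Suc i mod 3) @ []) ?\<phi>"
      then obtain x where x: "\<And>i. i < 3 \<Longrightarrow> x i \<in> tuples (dom GN) 1" "\<And>i. i < 3 \<Longrightarrow> sat GN (x i @ x (Suc i mod 3) @ []) ?\<phi>" by blast
      have "\<exists>u\<in>vs limit. x i = [u]" if "i < 3" for i using x(1)[OF that] by (auto simp: tuples_def length_Suc_conv)
      then obtain a b c where abc: "x 0 = [a]" "x 1 = [b]" "x 2 = [c]" "a \<in> vs limit" "b \<in> vs limit" "c \<in> vs limit" by (metis numeral_3_eq_3 less_Suc_eq numeral_2_eq_2 One_nat_def zero_less_Suc)
      have m: "Suc 0 mod 3 = (1::nat)" "Suc 1 mod 3 = (2::nat)" "Suc 2 mod 3 = (0::nat)" by simp_all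
      have "(a, b) \<in> es limit" "(b, c) \<in> es limit" "(c, a) \<in> es limit"
        using x(2)[of 0] x(2)[of 1] x(2)[of 2] unfolding m abc s by simp_all
      then show False using trifreeD[OF lim_trifree abc(4-6)] by blast
    qed
  qed
qed

section \<open>Conant-independence in the homogeneous digraph\<close>

text \<open>For \<open>a\<close> outside \<open>M\<close> the formula \<open>x = a\<close>
  Conant-divides in any monster model. A Morley sequence with consistent instances would start with
  \<open>a\<close> twice, so its type would contain \<open>x = a\<close> and, by invariance, also
  \<open>x = v\<close> for another realization \<open>v\<close> of the type of \<open>a\<close> over
  \<open>M\<close>.\<close>

lemma (in monster_model) conant_indep_disjoint:
  assumes M: "elementary_submodel L N M" "|M| <o \<kappa>" and A: "A \<subseteq> dom N" and ind: "conant_indep L N M A B"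
  shows "A \<inter> B \<subseteq> M"
proof
  fix a assume aAB: "a \<in> A \<inter> B"
  show "a \<in> M"
  proof (rule ccontr)
    assume aM: "a \<notin> M"
    have Md: "M \<subseteq> dom N" using M by (simp add: elementary_submodel_def)
    have ad: "a \<in> dom N" using aAB A by auto
    let ?\<phi> = "Eq (Var 0) (Var 1) :: ('f, 'r) fm"
    have h: "holds N [x] (?\<phi>, [y]) \<longleftrightarrow> x = y" for x y by (simp add: holds_def)
    have "(?\<phi>, [a]) \<in> tp L N (M \<union> B) [a]" using aAB h by (simp add: tp_def forms_def)
    moreover have "[a] \<in> lists A" using aAB by simp
    ultimately have "\<not> conant_forks L N M (length [a]) (?\<phi>, [a])" using ind unfolding conant_indep_def by blast
    then have "\<not> conant_divides L N M 1 (?\<phi>, [a])" using conant_divides_forks[of L N M 1 "(?\<phi>, [a])"] by auto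
    moreover have "(?\<phi>, [x]) \<in> forms L (dom N) 1" if "x \<in> dom N" for x using that by (simp add: forms_def)
    note ff = this
    ultimately obtain p s where p: "invariant_type L N M 1 p" and s: "morley_sequence L N M 1 p s" and s0: "s 0 = [a]"
      and con: "consistent N 1 {(?\<phi>, s i) |i. True}" using ad unfolding conant_divides_def by auto
    have gp: "global_type L N 1 p" using p by (simp add: invariant_type_def)
    have sd: "s i \<in> tuples (dom N) 1" for i using s by (simp add: morley_sequence_def)
    obtain b where b: "s 1 = [b]" using sd[of 1] by (auto simp: tuples_def length_Suc_conv)
    have "\<exists>x\<in>tuples (dom N) 1. realizes N x {(?\<phi>, s 0), (?\<phi>, s 1)}"
      using con unfolding consistent_def by (rule allE[of _ "{(?\<phi>, s 0), (?\<phi>, s 1)}"]) auto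
    then obtain x where "x \<in> tuples (dom N) 1" "realizes N x {(?\<phi>, s 0), (?\<phi>, s 1)}" by blast
    then have ba: "b = a" using b s0 by (auto simp: realizes_def holds_def tuples_def length_Suc_conv)
    have "realizes N (s 1) (p \<inter> forms L (M \<union> (\<Union>j<1. set (s j))) 1)" using s unfolding morley_sequence_def by blast
    moreover have "(\<Union>j<(1::nat). set (s j)) = {a}" using s0 by auto
    ultimately have rs: "realizes N [a] (p \<inter> forms L (M \<union> {a}) 1)" using b ba by simp
    have Mad: "M \<union> {a} \<subseteq> dom N" using Md ad by simp
    have "(?\<phi>, [a]) \<in> forms L (M \<union> {a}) 1" by (simp add: forms_def)
    from realizes_global_iff[OF gp rs Mad this] have pa: "(?\<phi>, [a]) \<in> p" using h by simp
    \<comment> \<open>Each formula in the type of \<open>a\<close> over \<open>M\<close> has a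
      solution in \<open>M\<close>, which differs from \<open>a\<close>; so the type has a
      realization other than \<open>a\<close>.\<close>
    let ?\<Sigma> = "tp L N M [a] \<union> {(Neg ?\<phi>, [a])}"
    have sub: "?\<Sigma> \<subseteq> forms L (M \<union> {a}) 1"
      using forms_mono[of M "M \<union> {a}" L 1] by (auto simp: tp_def forms_def)
    have "consistent N 1 ?\<Sigma>" unfolding consistent_def
    proof (intro allI impI)
      fix \<Sigma> assume \<Sigma>: "\<Sigma> \<subseteq> ?\<Sigma>" "finite \<Sigma>"
      have "\<Sigma> \<inter> tp L N M [a] \<subseteq> forms L M 1" by (auto simp: tp_def)
      from forms_Conj[OF _ this dom_nonempty] \<Sigma>(2) obtain H where H: "H \<in> forms L M 1"
        "\<And>t. length t = 1 \<Longrightarrow> holds N t H \<longleftrightarrow> (\<forall>F\<in>\<Sigma> \<inter> tp L N M [a]. holds N t F)" by (meson finite_Int)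
      have "holds N [a] H" using H(2)[of "[a]"] by (simp add: tp_def)
      then obtain t where t: "t \<in> tuples M 1" "holds N t H" using elementary_ex[OF M(1) H(1), of "[a]"] ad by (auto simp: tuples_def)
      then obtain v where v: "t = [v]" "v \<in> M" by (auto simp: tuples_def length_Suc_conv)
      have "holds N t F" if "F \<in> \<Sigma>" for F
      proof (cases "F \<in> tp L N M [a]")
        case True
        then show ?thesis using H(2)[of t] t(2) v(1) that by simp
      next
        case False
        then have "F = (Neg ?\<phi>, [a])" using \<Sigma>(1) that by auto
        then show ?thesis using v aM by (auto simp: holds_def)
      qed
      moreover have "t \<in> tuples (dom N) 1" using t(1) Md by (auto simp: tuples_def)
      ultimately show "\<exists>t\<in>tuples (dom N) 1. realizes N t \<Sigma>" unfolding realizes_def by blast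
    qed
    from saturation[OF Mad small_Un_finite[OF M(2)] sub this] obtain t where t: "t \<in> tuples (dom N) 1" "realizes N t ?\<Sigma>" by auto
    then obtain v where v: "t = [v]" "v \<in> dom N" by (auto simp: tuples_def length_Suc_conv)
    have va: "v \<noteq> a" using t(2) v by (auto simp: realizes_def holds_def)
    have "tp L N M [a] = tp L N M [v]"
      by (rule tp_subset_eq) (use t(2) v in \<open>auto simp: tp_def realizes_def\<close>)
    then have "(?\<phi>, [v]) \<in> p" using p pa ad v(2) unfolding invariant_type_def
      by (elim conjE) (drule spec[of _ ?\<phi>], drule spec[of _ "[a]"], drule spec[of _ "[v]"], simp)
    then have "\<exists>y\<in>tuples (dom N) 1. realizes N y {(?\<phi>, [a]), (?\<phi>, [v])}"
      using gp pa unfolding global_type_def consistent_def by simp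
    then show False using va by (auto simp: realizes_def holds_def tuples_def length_Suc_conv)
  qed
qed

section \<open>Free copies over a model and the invariant type they define\<close>

abbreviation edge :: "point \<Rightarrow> point \<Rightarrow> bool" where
  "edge x y \<equiv> (x, y) \<in> es limit"

text \<open>The copy of \<open>H\<close> is joined to \<open>X\<close> only at points of \<open>K\<close>, in the way in which \<open>H\<close> is joined to \<open>\<rho> ` K\<close>.
  No triangle arises because folding the copy back onto \<open>H\<close> and applying \<open>\<rho>\<close> on \<open>X\<close> is a homomorphism.\<close>

lemma adjoin_copy:
  assumes X: "X \<subseteq> vs limit" "|X| \<le>o |UNIV :: nat set set|" and H: "H \<subseteq> vs limit" "finite H"
    and \<rho>: "\<And>x. x \<in> X \<Longrightarrow> \<rho> x \<in> vs limit" "\<And>x y. x \<in> X \<Longrightarrow> y \<in> X \<Longrightarrow> edge x y \<Longrightarrow> edge (\<rho> x) (\<rho> y)"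
  obtains \<tau> where "inj_on \<tau> H" "\<And>y. y \<in> H \<Longrightarrow> \<tau> y \<in> vs limit" "\<And>y. y \<in> H \<Longrightarrow> \<tau> y \<notin> X"
    "\<And>y z. y \<in> H \<Longrightarrow> z \<in> H \<Longrightarrow> edge (\<tau> y) (\<tau> z) \<longleftrightarrow> edge y z"
    "\<And>y x. y \<in> H \<Longrightarrow> x \<in> X \<Longrightarrow> edge (\<tau> y) x \<longleftrightarrow> x \<in> K \<and> edge y (\<rho> x)"
    "\<And>y x. y \<in> H \<Longrightarrow> x \<in> X \<Longrightarrow> edge x (\<tau> y) \<longleftrightarrow> x \<in> K \<and> edge (\<rho> x) y"
proof -
  define C :: "(point + point) set" where "C = Inl ` X \<union> Inr ` H"
  define q where "q = (\<lambda>u v. case u of Inl x \<Rightarrow> (case v of Inl y \<Rightarrow> edge x y | Inr y \<Rightarrow> x \<in> K \<and> edge (\<rho> x) y)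
    | Inr x \<Rightarrow> (case v of Inl y \<Rightarrow> y \<in> K \<and> edge x (\<rho> y) | Inr y \<Rightarrow> edge x y))"
  let ?Q = "{(u, v). q u v}"
  have card: "|C| \<le>o |UNIV :: nat set set|" unfolding C_def
    by (rule cont_Un[OF cont_image[OF X(2)] cont_finite]) (simp add: H(2))
  have tri: "trifree C ?Q"
  proof (rule trifree_hom[OF lim_trifree, of _ "case_sum \<rho> id"])
    show "case_sum \<rho> id u \<in> vs limit" if "u \<in> C" for u using that \<rho>(1) H(1) by (auto simp: C_def)
    show "(case_sum \<rho> id u, case_sum \<rho> id v) \<in> es limit" if "u \<in> C" "v \<in> C" "(u, v) \<in> ?Q" for u v
      using that \<rho>(2) by (auto simp: C_def q_def)
  qed
  have "\<exists>G. inj_on G C \<and> G ` C \<subseteq> vs limit \<and> (\<forall>u\<in>C. \<forall>v\<in>C. (u, v) \<in> ?Q \<longleftrightarrow> (G u, G v) \<in> es limit) \<and> (\<forall>u\<in>Inl ` X. G u = case_sum id undefined u)"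
    by (rule lim_extend[OF card tri]) (use X(1) in \<open>auto simp: C_def q_def inj_on_def\<close>)
  then obtain G where G: "inj_on G C" "G ` C \<subseteq> vs limit" "\<forall>u\<in>C. \<forall>v\<in>C. (u, v) \<in> ?Q \<longleftrightarrow> (G u, G v) \<in> es limit"
    "\<forall>u\<in>Inl ` X. G u = case_sum id undefined u" by (elim exE conjE)
  have GX: "G (Inl x) = x" if "x \<in> X" for x using G(4) that by simp
  have IC: "Inl x \<in> C \<longleftrightarrow> x \<in> X" "Inr y \<in> C \<longleftrightarrow> y \<in> H" for x y by (auto simp: C_def)
  have GQ: "edge (G u) (G v) \<longleftrightarrow> q u v" if "u \<in> C" "v \<in> C" for u v using G(3) that by simp
  show ?thesis
  proof (rule that[of "\<lambda>y. G (Inr y)"])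
    show "inj_on (\<lambda>y. G (Inr y)) H"
    proof (rule inj_onI)
      fix x y assume xy: "x \<in> H" "y \<in> H" and e: "G (Inr x) = G (Inr y)"
      have "Inr x = (Inr y :: point + point)" by (rule inj_onD[OF G(1) e]) (simp_all add: IC xy)
      then show "x = y" by simp
    qed
    fix y assume y: "y \<in> H"
    show "G (Inr y) \<in> vs limit" using G(2) IC y by blast
    show "G (Inr y) \<notin> X"
    proof
      assume g: "G (Inr y) \<in> X"
      have "Inr y = (Inl (G (Inr y)) :: point + point)" by (rule inj_onD[OF G(1)]) (simp_all add: GX IC g y)
      then show False by simp
    qed
    show "edge (G (Inr y)) (G (Inr z)) \<longleftrightarrow> edge y z" if "z \<in> H" for z using GQ[of "Inr y" "Inr z"] IC y that by (simp add: q_def)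
    show "edge (G (Inr y)) x \<longleftrightarrow> x \<in> K \<and> edge y (\<rho> x)" if "x \<in> X" for x
      using GQ[of "Inr y" "Inl x"] GX[OF that] IC y that by (simp add: q_def)
    show "edge x (G (Inr y)) \<longleftrightarrow> x \<in> K \<and> edge (\<rho> x) y" if "x \<in> X" for x
      using GQ[of "Inl x" "Inr y"] GX[OF that] IC y that by (simp add: q_def)
  qed
qed

text \<open>Says that the copy and \<open>M \<union> Y\<close> form the free amalgam of
  \<open>M \<union> H\<close> and \<open>M \<union> Y\<close> over \<open>M\<close>.
  \<open>H\<close> may meet \<open>M\<close>; such points stay fixed.\<close>

definition free_copy :: "point set \<Rightarrow> point set \<Rightarrow> point set \<Rightarrow> (point \<Rightarrow> point) \<Rightarrow> bool" where
  "free_copy M H Y \<tau> \<longleftrightarrow> (\<forall>m\<in>M. \<tau> m = m) \<and> inj_on \<tau> (M \<union> H) \<and> \<tau> ` H \<subseteq> vs limit \<and>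
     (\<forall>y\<in>M \<union> H. \<forall>z\<in>M \<union> H. edge (\<tau> y) (\<tau> z) \<longleftrightarrow> edge y z) \<and>
     (\<forall>y\<in>H - M. \<tau> y \<notin> Y \<and> (\<forall>z\<in>Y - M. \<not> edge (\<tau> y) z \<and> \<not> edge z (\<tau> y)))"

lemma free_copyD:
  assumes "free_copy M H Y \<tau>"
  shows "m \<in> M \<Longrightarrow> \<tau> m = m" "y \<in> M \<union> H \<Longrightarrow> z \<in> M \<union> H \<Longrightarrow> \<tau> y = \<tau> z \<longleftrightarrow> y = z" "y \<in> H \<Longrightarrow> \<tau> y \<in> vs limit"
    "y \<in> M \<union> H \<Longrightarrow> z \<in> M \<union> H \<Longrightarrow> edge (\<tau> y) (\<tau> z) \<longleftrightarrow> edge y z"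
    "y \<in> H \<Longrightarrow> y \<notin> M \<Longrightarrow> \<tau> y \<notin> Y" "y \<in> H \<Longrightarrow> y \<notin> M \<Longrightarrow> z \<in> Y \<Longrightarrow> z \<notin> M \<Longrightarrow> \<not> edge (\<tau> y) z \<and> \<not> edge z (\<tau> y)"
    "y \<in> H \<Longrightarrow> y \<notin> M \<Longrightarrow> \<tau> y \<notin> M"
proof -
  note f = assms[unfolded free_copy_def]
  show 1: "m \<in> M \<Longrightarrow> \<tau> m = m" for m using f by simp
  show 2: "y \<in> M \<union> H \<Longrightarrow> z \<in> M \<union> H \<Longrightarrow> \<tau> y = \<tau> z \<longleftrightarrow> y = z" for y z using f inj_on_eq_iff[of \<tau> "M \<union> H" y z] by simp
  show "y \<in> H \<Longrightarrow> \<tau> y \<in> vs limit" using f by auto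
  show "y \<in> M \<union> H \<Longrightarrow> z \<in> M \<union> H \<Longrightarrow> edge (\<tau> y) (\<tau> z) \<longleftrightarrow> edge y z" using f by simp
  show "y \<in> H \<Longrightarrow> y \<notin> M \<Longrightarrow> \<tau> y \<notin> Y" using f by simp
  show "y \<in> H \<Longrightarrow> y \<notin> M \<Longrightarrow> z \<in> Y \<Longrightarrow> z \<notin> M \<Longrightarrow> \<not> edge (\<tau> y) z \<and> \<not> edge z (\<tau> y)" using f by simp
  show "\<tau> y \<notin> M" if "y \<in> H" "y \<notin> M"
  proof
    assume m: "\<tau> y \<in> M"
    then have "\<tau> (\<tau> y) = \<tau> y" by (rule 1)
    then have "\<tau> y = y" using 2[of "\<tau> y" y] m that(1) by simp
    then show False using m that(2) by simp
  qed
qed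

lemma free_copy_mono:
  assumes "free_copy M H Y \<tau>" "Y' \<subseteq> Y"
  shows "free_copy M H Y' \<tau>"
proof -
  have "\<tau> y \<notin> Y' \<and> (\<forall>z\<in>Y' - M. \<not> edge (\<tau> y) z \<and> \<not> edge z (\<tau> y))" if "y \<in> H - M" for y
    using free_copyD(5,6)[OF assms(1), of y] that assms(2) by auto
  then show ?thesis using assms(1) unfolding free_copy_def by simp
qed

text \<open>The case \<open>K = M\<close> and \<open>\<rho> = id\<close> of
  \<open>adjoin_copy\<close>, for the part of \<open>H\<close> outside \<open>M\<close>.\<close>

lemma free_copy_exists:
  assumes M: "M \<subseteq> vs limit" "|M| \<le>o |UNIV :: nat set set|" and Y: "Y \<subseteq> vs limit" "|Y| \<le>o |UNIV :: nat set set|"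
    and H: "H \<subseteq> vs limit" "finite H"
  shows "\<exists>\<tau>. free_copy M H Y \<tau>"
proof -
  have MY: "M \<union> Y \<subseteq> vs limit" using M Y by simp
  have H': "H - M \<subseteq> vs limit" "finite (H - M)" using H by auto
  obtain \<tau> where t: "inj_on \<tau> (H - M)" "\<And>y. y \<in> H - M \<Longrightarrow> \<tau> y \<in> vs limit" "\<And>y. y \<in> H - M \<Longrightarrow> \<tau> y \<notin> M \<union> Y"
    "\<And>y z. y \<in> H - M \<Longrightarrow> z \<in> H - M \<Longrightarrow> edge (\<tau> y) (\<tau> z) \<longleftrightarrow> edge y z"
    "\<And>y x. y \<in> H - M \<Longrightarrow> x \<in> M \<union> Y \<Longrightarrow> edge (\<tau> y) x \<longleftrightarrow> x \<in> M \<and> edge y (id x)"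
    "\<And>y x. y \<in> H - M \<Longrightarrow> x \<in> M \<union> Y \<Longrightarrow> edge x (\<tau> y) \<longleftrightarrow> x \<in> M \<and> edge (id x) y"
    by (rule adjoin_copy[OF MY cont_Un[OF M(2) Y(2)] H', of id M]) (use MY in auto)
  let ?\<tau> = "\<lambda>y. if y \<in> M then y else \<tau> y"
  have "inj_on ?\<tau> (M \<union> H)"
  proof (rule inj_onI)
    fix x y assume xy: "x \<in> M \<union> H" "y \<in> M \<union> H" and e: "?\<tau> x = ?\<tau> y"
    show "x = y"
    proof (cases "x \<in> M"; cases "y \<in> M")
      assume "x \<in> M" "y \<notin> M"
      then show ?thesis using e xy t(3)[of y] by simp
    next
      assume "x \<notin> M" "y \<in> M"
      then show ?thesis using e xy t(3)[of x] by simp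
    next
      assume n: "x \<notin> M" "y \<notin> M"
      then have "\<tau> x = \<tau> y" using e by simp
      then show ?thesis by (rule inj_onD[OF t(1)]) (use n xy in simp_all)
    qed (use e in simp)
  qed
  moreover have "edge (?\<tau> y) (?\<tau> z) \<longleftrightarrow> edge y z" if "y \<in> M \<union> H" "z \<in> M \<union> H" for y z
    using that t(4)[of y z] t(5)[of y z] t(6)[of z y] by auto
  moreover have "?\<tau> ` H \<subseteq> vs limit" using t(2) M(1) by auto
  ultimately have "free_copy M H Y ?\<tau>" unfolding free_copy_def using t(3,5,6) by auto
  then show ?thesis by blast
qed

lemma tp_edges:
  assumes tp: "tp GL GN M b = tp GL GN M b'" and l: "length b = length b'" and i: "i < length b"
  shows "j < length b \<Longrightarrow> b ! i = b ! j \<longleftrightarrow> b' ! i = b' ! j" "j < length b \<Longrightarrow> edge (b ! i) (b ! j) \<longleftrightarrow> edge (b' ! i) (b' ! j)"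
    "m \<in> M \<Longrightarrow> b ! i = m \<longleftrightarrow> b' ! i = m" "m \<in> M \<Longrightarrow> edge (b ! i) m \<longleftrightarrow> edge (b' ! i) m" "m \<in> M \<Longrightarrow> edge m (b ! i) \<longleftrightarrow> edge m (b' ! i)"
proof -
  have s: "sat GN (b @ c) \<phi> = sat GN (b' @ c) \<phi>" if "set c \<subseteq> M" "wf_fm GL (length b + length c) \<phi>" for c \<phi>
    using tp that unfolding tp_eq_iff[OF l] by (simp add: forms_def)
  show "j < length b \<Longrightarrow> b ! i = b ! j \<longleftrightarrow> b' ! i = b' ! j" using s[of "[]" "Eq (Var i) (Var j)"] i l by simp
  show "j < length b \<Longrightarrow> edge (b ! i) (b ! j) \<longleftrightarrow> edge (b' ! i) (b' ! j)" using s[of "[]" "Rel 0 [Var i, Var j]"] i l by simp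
  show "m \<in> M \<Longrightarrow> b ! i = m \<longleftrightarrow> b' ! i = m" using s[of "[m]" "Eq (Var i) (Var (length b))"] i l by (simp add: nth_append)
  show "m \<in> M \<Longrightarrow> edge (b ! i) m \<longleftrightarrow> edge (b' ! i) m" using s[of "[m]" "Rel 0 [Var i, Var (length b)]"] i l by (simp add: nth_append)
  show "m \<in> M \<Longrightarrow> edge m (b ! i) \<longleftrightarrow> edge m (b' ! i)" using s[of "[m]" "Rel 0 [Var (length b), Var i]"] i l by (simp add: nth_append)
qed

text \<open>Freeness leaves no choice: equalities and edges between the copy and \<open>b\<close>
  are determined by those of \<open>h\<close> and of \<open>b\<close> with \<open>M\<close>, and the
  latter depend only on the type of \<open>b\<close> over \<open>M\<close>.\<close>

lemma free_copy_sat: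
  assumes f: "free_copy M (set h) Y \<tau>" "free_copy M (set h) Y' \<tau>'" and b: "set b \<subseteq> Y" "set b' \<subseteq> Y'"
    and bd: "set b \<subseteq> vs limit" "set b' \<subseteq> vs limit" and tp: "tp GL GN M b = tp GL GN M b'" and l: "length b = length b'"
    and wf: "wf_fm GL (length h + length b) \<phi>"
  shows "sat GN (map \<tau> h @ b) \<phi> \<longleftrightarrow> sat GN (map \<tau>' h @ b') \<phi>"
proof (rule piso_sat)
  have mixed: "(\<tau> y = b ! i \<longleftrightarrow> \<tau>' y = b' ! i) \<and> (edge (\<tau> y) (b ! i) \<longleftrightarrow> edge (\<tau>' y) (b' ! i)) \<and> (edge (b ! i) (\<tau> y) \<longleftrightarrow> edge (b' ! i) (\<tau>' y))"
    if y: "y \<in> set h" and i: "i < length b" for y i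
  proof (cases "y \<in> M")
    case True
    then show ?thesis using free_copyD(1)[OF f(1) True] free_copyD(1)[OF f(2) True] tp_edges(3-5)[OF tp l i True] by auto
  next
    case yM: False
    show ?thesis
    proof (cases "b ! i \<in> M")
      case True
      have e: "b' ! i = b ! i" using tp_edges(3)[OF tp l i True] by simp
      have U: "y \<in> M \<union> set h" "b ! i \<in> M \<union> set h" using y True by auto
      show ?thesis unfolding e
        using free_copyD(2,4)[OF f(1) U] free_copyD(2,4)[OF f(2) U] free_copyD(4)[OF f(1) U(2,1)] free_copyD(4)[OF f(2) U(2,1)]
          free_copyD(1)[OF f(1) True] free_copyD(1)[OF f(2) True] by simp
    next
      case False
      have F: "b' ! i \<notin> M" using tp_edges(3)[OF tp l i, of "b' ! i"] False by auto
      have "b ! i \<in> Y" "b' ! i \<in> Y'" using b i l by auto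
      then show ?thesis using free_copyD(5)[OF f(1) y yM] free_copyD(5)[OF f(2) y yM]
          free_copyD(6)[OF f(1) y yM _ False] free_copyD(6)[OF f(2) y yM _ F] by auto
    qed
  qed
  have z: "set (zip (map \<tau> h @ b) (map \<tau>' h @ b')) = (\<lambda>y. (\<tau> y, \<tau>' y)) ` set h \<union> {(b ! i, b' ! i) |i. i < length b}"
  proof -
    have "set (zip (map \<tau> h @ b) (map \<tau>' h @ b')) = set (zip (map \<tau> h) (map \<tau>' h)) \<union> set (zip b b')"
      by (simp add: zip_append)
    then show ?thesis unfolding set_zip_map using l by (simp add: set_zip)
  qed
  show "piso (es limit) (set (zip (map \<tau> h @ b) (map \<tau>' h @ b')))" unfolding z piso_def
  proof (intro allI impI)
    fix x x' y y'
    assume "(x, x') \<in> (\<lambda>y. (\<tau> y, \<tau>' y)) ` set h \<union> {(b ! i, b' ! i) |i. i < length b}"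
      "(y, y') \<in> (\<lambda>y. (\<tau> y, \<tau>' y)) ` set h \<union> {(b ! i, b' ! i) |i. i < length b}"
    then consider u v where "u \<in> set h" "v \<in> set h" "x = \<tau> u" "x' = \<tau>' u" "y = \<tau> v" "y' = \<tau>' v"
      | u i where "u \<in> set h" "i < length b" "x = \<tau> u" "x' = \<tau>' u" "y = b ! i" "y' = b' ! i"
      | u i where "u \<in> set h" "i < length b" "y = \<tau> u" "y' = \<tau>' u" "x = b ! i" "x' = b' ! i"
      | i j where "i < length b" "j < length b" "x = b ! i" "x' = b' ! i" "y = b ! j" "y' = b' ! j" by auto
    then show "(x = y \<longleftrightarrow> x' = y') \<and> (edge x y \<longleftrightarrow> edge x' y')"
    proof cases
      case 1
      then show ?thesis using free_copyD(2,4)[OF f(1), of u v] free_copyD(2,4)[OF f(2), of u v] by simp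
    next
      case 2 then show ?thesis using mixed by simp
    next
      case 3 then show ?thesis using mixed[OF 3(1,2)] by auto
    next
      case 4 then show ?thesis using tp_edges(1,2)[OF tp l] by simp
    qed
  qed
qed (use l wf bd free_copyD(3)[OF f(1)] free_copyD(3)[OF f(2)] in auto)

text \<open>The free extension of the type of \<open>h\<close> over \<open>M\<close>. A copy of
  points outside \<open>M\<close> cannot be free from the structure in which it lies, so it is taken
  free only from the parameters of the formula; by \<open>free_copy_sat\<close> its choice does not
  matter.\<close>

definition free_type :: "point set \<Rightarrow> point list \<Rightarrow> ((nat, nat) fm \<times> point list) set" where
  "free_type M h = {F \<in> forms GL (vs limit) (length h). \<exists>\<tau>. free_copy M (set h) (set (snd F)) \<tau> \<and> holds GN (map \<tau> h) F}"

lemma free_type_iff: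
  assumes "free_copy M (set h) Y \<tau>" "set b \<subseteq> Y" "(\<phi>, b) \<in> forms GL (vs limit) (length h)"
  shows "(\<phi>, b) \<in> free_type M h \<longleftrightarrow> holds GN (map \<tau> h) (\<phi>, b)"
proof -
  have b: "set b \<subseteq> vs limit" "wf_fm GL (length h + length b) \<phi>" using assms(3) by (simp_all add: forms_def)
  have "sat GN (map \<tau>' h @ b) \<phi> \<longleftrightarrow> sat GN (map \<tau> h @ b) \<phi>" if "free_copy M (set h) (set b) \<tau>'" for \<tau>'
    by (rule free_copy_sat[OF that free_copy_mono[OF assms(1,2)] order_refl order_refl b(1,1) refl refl b(2)])
  then have eq: "holds GN (map \<tau>' h) (\<phi>, b) \<longleftrightarrow> holds GN (map \<tau> h) (\<phi>, b)" if "free_copy M (set h) (set b) \<tau>'" for \<tau>'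
    using that by (simp add: holds_def)
  show ?thesis
  proof
    assume "(\<phi>, b) \<in> free_type M h"
    then obtain \<tau>' where "free_copy M (set h) (set b) \<tau>'" "holds GN (map \<tau>' h) (\<phi>, b)" by (auto simp: free_type_def)
    then show "holds GN (map \<tau> h) (\<phi>, b)" using eq by simp
  next
    assume "holds GN (map \<tau> h) (\<phi>, b)"
    then show "(\<phi>, b) \<in> free_type M h" unfolding free_type_def mem_Collect_eq snd_conv
      by (intro conjI exI[of _ \<tau>] assms(3) free_copy_mono[OF assms(1,2)])
  qed
qed

text \<open>Finitely many formulas have a common free copy, which gives consistency and
  completeness. Invariance is the uniqueness of free copies over parameters of equal type.\<close>

lemma free_type_invariant:
  assumes M: "M \<subseteq> vs limit" "|M| \<le>o |UNIV :: nat set set|" and h: "set h \<subseteq> vs limit"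
  shows "invariant_type GL GN M (length h) (free_type M h)"
proof -
  have ex: "\<exists>\<tau>. free_copy M (set h) Y \<tau>" if "finite Y" "Y \<subseteq> vs limit" for Y
    by (rule free_copy_exists[OF M that(2) cont_finite[OF that(1)] h]) simp
  have glob: "global_type GL GN (length h) (free_type M h)" unfolding global_type_def
  proof (intro conjI)
    show "free_type M h \<subseteq> forms GL (dom GN) (length h)" by (auto simp: free_type_def)
    show "consistent GN (length h) (free_type M h)" unfolding consistent_def
    proof (intro allI impI)
      fix \<Sigma> assume \<Sigma>: "\<Sigma> \<subseteq> free_type M h" "finite \<Sigma>"
      let ?Y = "\<Union>F\<in>\<Sigma>. set (snd F)"
      have "?Y \<subseteq> vs limit" using \<Sigma>(1) by (fastforce simp: free_type_def forms_def)
      then obtain \<tau> where t: "free_copy M (set h) ?Y \<tau>" using ex[of ?Y] \<Sigma>(2) by auto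
      have "holds GN (map \<tau> h) F" if F: "F \<in> \<Sigma>" for F
      proof -
        obtain \<phi> b where Fb: "F = (\<phi>, b)" by (metis surj_pair)
        have ft: "(\<phi>, b) \<in> free_type M h" using F \<Sigma>(1) Fb by blast
        moreover have "(\<phi>, b) \<in> forms GL (vs limit) (length h)" using ft by (simp add: free_type_def)
        moreover have "set b \<subseteq> ?Y" using F Fb by force
        ultimately show ?thesis using free_type_iff[OF t] Fb by simp
      qed
      moreover have "map \<tau> h \<in> tuples (dom GN) (length h)" using free_copyD(3)[OF t] by (auto simp: tuples_def)
      ultimately show "\<exists>a\<in>tuples (dom GN) (length h). realizes GN a \<Sigma>" unfolding realizes_def by blast
    qed
    show "\<forall>(\<phi>, c)\<in>forms GL (dom GN) (length h). (\<phi>, c) \<in> free_type M h \<or> (Neg \<phi>, c) \<in> free_type M h"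
    proof clarify
      fix \<phi> c assume f: "(\<phi>, c) \<in> forms GL (dom GN) (length h)" and n: "(Neg \<phi>, c) \<notin> free_type M h"
      then have f': "(\<phi>, c) \<in> forms GL (vs limit) (length h)" by simp
      then have "set c \<subseteq> vs limit" by (simp add: forms_def)
      then obtain \<tau> where t: "free_copy M (set h) (set c) \<tau>" using ex[of "set c"] by auto
      have "\<not> holds GN (map \<tau> h) (Neg \<phi>, c)" using n free_type_iff[OF t order_refl forms_Neg(1)[OF f']] by simp
      then show "(\<phi>, c) \<in> free_type M h" using free_type_iff[OF t order_refl f'] by (simp add: forms_Neg)
    qed
  qed
  have "(\<phi>, b) \<in> free_type M h \<longleftrightarrow> (\<phi>, b') \<in> free_type M h"
    if b: "set b \<subseteq> dom GN" "set b' \<subseteq> dom GN" "length b = length b'" "tp GL GN M b = tp GL GN M b'" for \<phi> b b'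
  proof (cases "wf_fm GL (length h + length b) \<phi>")
    case True
    have bd: "set b \<subseteq> vs limit" "set b' \<subseteq> vs limit" using b by simp_all
    obtain \<tau> \<tau>' where t: "free_copy M (set h) (set b) \<tau>" "free_copy M (set h) (set b') \<tau>'" using ex[of "set b"] ex[of "set b'"] bd by auto
    have "(\<phi>, b) \<in> forms GL (vs limit) (length h)" "(\<phi>, b') \<in> forms GL (vs limit) (length h)" using True bd b(3) by (simp_all add: forms_def)
    then show ?thesis using free_type_iff[OF t(1) order_refl] free_type_iff[OF t(2) order_refl]
        free_copy_sat[OF t order_refl order_refl bd b(4,3) True] by (simp add: holds_def)
  next
    case False
    then show ?thesis using b(3) by (simp add: free_type_def forms_def)
  qed
  with glob show ?thesis unfolding invariant_type_def by blast
qed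

text \<open>The identity is a free copy with respect to \<open>M\<close> alone, so the sequence can
  start with \<open>H\<close> itself, as a Morley sequence testing Conant-dividing has to.\<close>

lemma free_sequence:
  assumes M: "M \<subseteq> vs limit" "|M| \<le>o |UNIV :: nat set set|" and H: "H \<subseteq> vs limit" "finite H"
  obtains \<tau> :: "nat \<Rightarrow> point \<Rightarrow> point" where "\<tau> 0 = id" "\<And>n. free_copy M H (M \<union> (\<Union>j<n. \<tau> j ` H)) (\<tau> n)"
proof -
  define pick where "pick = (\<lambda>Y. SOME \<tau>. free_copy M H Y \<tau>)"
  define f where "f = (\<lambda>n::nat. \<lambda>Y. if n = 0 then id else pick Y)"
  define Y where "Y = rec_nat M (\<lambda>n Y. Y \<union> f n Y ` H)"
  define \<tau> where "\<tau> = (\<lambda>n. f n (Y n))"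
  have Y0: "Y 0 = M" and YS: "Y (Suc n) = Y n \<union> \<tau> n ` H" for n by (simp_all add: Y_def \<tau>_def)
  have main: "Y n \<subseteq> vs limit \<and> |Y n| \<le>o |UNIV :: nat set set| \<and> Y n = M \<union> (\<Union>j<n. \<tau> j ` H) \<and> free_copy M H (Y n) (\<tau> n)" for n
  proof (induction n)
    case 0
    have "free_copy M H M (\<lambda>a. a)" using H(1) by (auto simp: free_copy_def)
    moreover have "\<tau> 0 = (\<lambda>a. a)" by (simp add: \<tau>_def f_def id_def)
    ultimately show ?case using M unfolding Y0 by simp
  next
    case (Suc n)
    have y: "Y (Suc n) \<subseteq> vs limit" "|Y (Suc n)| \<le>o |UNIV :: nat set set|" "Y (Suc n) = M \<union> (\<Union>j<Suc n. \<tau> j ` H)"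
    proof -
      have "\<tau> n ` H \<subseteq> vs limit" using free_copyD(3)[of M H "Y n" "\<tau> n"] Suc by auto
      then show "Y (Suc n) \<subseteq> vs limit" unfolding YS by (rule Un_least[OF conjunct1[OF Suc]])
      show "|Y (Suc n)| \<le>o |UNIV :: nat set set|" unfolding YS
        by (rule cont_Un[OF conjunct1[OF conjunct2[OF Suc]] cont_finite]) (simp add: H(2))
      show "Y (Suc n) = M \<union> (\<Union>j<Suc n. \<tau> j ` H)" using Suc by (auto simp: YS lessThan_Suc)
    qed
    from free_copy_exists[OF M y(1,2) H] have "free_copy M H (Y (Suc n)) (pick (Y (Suc n)))" unfolding pick_def by (rule someI_ex)
    then show ?case using y by (simp add: \<tau>_def f_def)
  qed
  show ?thesis
  proof (rule that[of \<tau>])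
    show "\<tau> 0 = id" by (simp add: \<tau>_def f_def)
    show "free_copy M H (M \<union> (\<Union>j<n. \<tau> j ` H)) (\<tau> n)" for n using main[of n] by metis
  qed
qed

lemma free_morley:
  fixes \<tau> :: "nat \<Rightarrow> point \<Rightarrow> point"
  assumes M: "M \<subseteq> vs limit" and h: "set h \<subseteq> vs limit"
    and t: "\<And>n. free_copy M (set h) (M \<union> (\<Union>j<n. \<tau> j ` set h)) (\<tau> n)"
  shows "morley_sequence GL GN M (length h) (free_type M h) (\<lambda>n. map (\<tau> n) h)"
  unfolding morley_sequence_def
proof (intro allI conjI)
  fix n
  show "map (\<tau> n) h \<in> tuples (dom GN) (length h)" using free_copyD(3)[OF t] by (auto simp: tuples_def)
  show "realizes GN (map (\<tau> n) h) (free_type M h \<inter> forms GL (M \<union> (\<Union>j<n. set (map (\<tau> j) h))) (length h))"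
    unfolding realizes_def
  proof
    fix F assume F: "F \<in> free_type M h \<inter> forms GL (M \<union> (\<Union>j<n. set (map (\<tau> j) h))) (length h)"
    obtain \<phi> b where Fb: "F = (\<phi>, b)" by (metis surj_pair)
    have ft: "(\<phi>, b) \<in> free_type M h" using F Fb by simp
    have "set b \<subseteq> M \<union> (\<Union>j<n. \<tau> j ` set h)" using F Fb by (simp add: forms_def)
    moreover have "(\<phi>, b) \<in> forms GL (vs limit) (length h)" using ft by (simp add: free_type_def)
    ultimately show "holds GN (map (\<tau> n) h) F" using free_type_iff[OF t] ft Fb by simp
  qed
qed

text \<open>A copy of \<open>a\<close> is joined to all copies of \<open>h\<close> simultaneously as
  \<open>a\<close> is joined to \<open>h\<close>. Triangles are excluded by
  \<open>adjoin_copy\<close>, once folding all copies back onto \<open>h\<close> is known to be a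
  homomorphism.\<close>

lemma free_common_realization:
  fixes \<tau> :: "nat \<Rightarrow> point \<Rightarrow> point"
  assumes M: "M \<subseteq> vs limit" "|M| \<le>o |UNIV :: nat set set|" and h: "set h \<subseteq> vs limit" and a: "set a \<subseteq> vs limit" "set a \<inter> set h \<subseteq> M"
    and t: "\<And>n. free_copy M (set h) (M \<union> (\<Union>j<n. \<tau> j ` set h)) (\<tau> n)"
  shows "\<exists>a'\<in>tuples (vs limit) (length a). \<forall>n \<phi>. wf_fm GL (length a + length h) \<phi> \<longrightarrow> sat GN (a' @ map (\<tau> n) h) \<phi> = sat GN (a @ h) \<phi>"
proof -
  let ?H = "set h"
  let ?X = "M \<union> (\<Union>n. \<tau> n ` ?H)"
  note D = free_copyD[OF t]
  have Xd: "?X \<subseteq> vs limit" using M(1) D(3) by auto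
  have Xc: "|?X| \<le>o |UNIV :: nat set set|"
  proof (rule cont_Un[OF M(2)])
    show "|\<Union>n. \<tau> n ` ?H| \<le>o |UNIV :: nat set set|" by (rule cont_countable_Un, rule cont_finite) simp
  qed
  \<comment> \<open>The folding map: it fixes \<open>M\<close> and sends a point of any copy to its
    original in \<open>h\<close>. The choice is unique because the copies are disjoint outside
    \<open>M\<close>.\<close>
  define \<rho> where "\<rho> = (\<lambda>x. if x \<in> M then x else (SOME y. y \<in> ?H - M \<and> (\<exists>n. x = \<tau> n y)))"
  have uniq: "y = z" if yz: "y \<in> ?H - M" "z \<in> ?H - M" and e: "\<tau> n y = \<tau> m z" for y z n m
  proof -
    consider "n = m" | "n < m" | "m < n" by linarith
    then show ?thesis
    proof cases
      case 1 then show ?thesis using D(2)[of y z n] e yz by simp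
    next
      case 2
      then have "\<tau> n y \<in> M \<union> (\<Union>j<m. \<tau> j ` ?H)" using yz(1) by auto
      then show ?thesis using D(5)[of z m] yz(2) e by simp
    next
      case 3
      then have "\<tau> m z \<in> M \<union> (\<Union>j<n. \<tau> j ` ?H)" using yz(2) by auto
      then show ?thesis using D(5)[of y n] yz(1) e by simp
    qed
  qed
  have \<rho>M: "\<rho> m = m" if "m \<in> M" for m using that by (simp add: \<rho>_def)
  have \<rho>H: "\<rho> (\<tau> n y) = y" if y: "y \<in> ?H" for n y
  proof (cases "y \<in> M")
    case True then show ?thesis using D(1)[of y n] \<rho>M by simp
  next
    case False
    have "\<tau> n y \<notin> M" by (rule D(7)[OF y False])
    then have r: "\<rho> (\<tau> n y) = (SOME z. z \<in> ?H - M \<and> (\<exists>m. \<tau> n y = \<tau> m z))" by (simp add: \<rho>_def)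
    have "y \<in> ?H - M \<and> (\<exists>m. \<tau> n y = \<tau> m y)" using y False by blast
    from someI[of "\<lambda>z. z \<in> ?H - M \<and> (\<exists>m. \<tau> n y = \<tau> m z)", OF this]
    have "\<rho> (\<tau> n y) \<in> ?H - M \<and> (\<exists>m. \<tau> n y = \<tau> m (\<rho> (\<tau> n y)))" unfolding r .
    then show ?thesis using uniq[of y "\<rho> (\<tau> n y)" n] y False by auto
  qed
  have X_cases: "x \<in> M \<or> (\<exists>n. \<exists>y\<in>?H - M. x = \<tau> n y)" if x: "x \<in> ?X" for x
  proof (cases "x \<in> M")
    case False
    then obtain n y where y: "y \<in> ?H" "x = \<tau> n y" using x by auto
    then have "y \<notin> M" using D(1)[of y n] False by auto
    then show ?thesis using y by auto
  qed simp
  have \<rho>d: "\<rho> x \<in> vs limit" if "x \<in> ?X" for x using X_cases[OF that] \<rho>M \<rho>H M(1) h by auto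
  \<comment> \<open>Only edges between different copies could be problematic, and freeness of the
    later copy rules these out outside \<open>M\<close>.\<close>
  have hom: "edge (\<rho> x) (\<rho> y)" if x: "x \<in> ?X" and y: "y \<in> ?X" and e: "edge x y" for x y
  proof -
    from X_cases[OF x] X_cases[OF y] show ?thesis
    proof (elim disjE exE bexE)
      assume "x \<in> M" "y \<in> M"
      then show ?thesis using e \<rho>M by simp
    next
      fix m z assume "x \<in> M" "z \<in> ?H - M" "y = \<tau> m z"
      then show ?thesis using e \<rho>M \<rho>H D(4)[of x z m] D(1)[of x m] by simp
    next
      fix n u assume "u \<in> ?H - M" "x = \<tau> n u" "y \<in> M"
      then show ?thesis using e \<rho>M \<rho>H D(4)[of u y n] D(1)[of y n] by simp
    next
      fix n m u z assume 4: "u \<in> ?H - M" "x = \<tau> n u" "z \<in> ?H - M" "y = \<tau> m z"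
      consider "n = m" | "n < m" | "m < n" by linarith
      then show ?thesis
      proof cases
        case 1 then show ?thesis using 4 e \<rho>H D(4)[of u z n] by simp
      next
        case 2
        then have "\<tau> n u \<in> M \<union> (\<Union>j<m. \<tau> j ` ?H)" "\<tau> n u \<notin> M" using 4(1) D(7)[of u n] by auto
        then show ?thesis using D(6)[of z "\<tau> n u" m] 4 e by simp
      next
        case 3
        then have "\<tau> m z \<in> M \<union> (\<Union>j<n. \<tau> j ` ?H)" "\<tau> m z \<notin> M" using 4(3) D(7)[of z m] by auto
        then show ?thesis using D(6)[of u "\<tau> m z" n] 4 e by simp
      qed
    qed
  qed
  have aM: "set a - M \<subseteq> vs limit" "finite (set a - M)" using a(1) by auto
  obtain \<sigma> where s: "inj_on \<sigma> (set a - M)" "\<And>y. y \<in> set a - M \<Longrightarrow> \<sigma> y \<in> vs limit" "\<And>y. y \<in> set a - M \<Longrightarrow> \<sigma> y \<notin> ?X"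
    "\<And>y z. y \<in> set a - M \<Longrightarrow> z \<in> set a - M \<Longrightarrow> edge (\<sigma> y) (\<sigma> z) \<longleftrightarrow> edge y z"
    "\<And>y x. y \<in> set a - M \<Longrightarrow> x \<in> ?X \<Longrightarrow> edge (\<sigma> y) x \<longleftrightarrow> x \<in> ?X \<and> edge y (\<rho> x)"
    "\<And>y x. y \<in> set a - M \<Longrightarrow> x \<in> ?X \<Longrightarrow> edge x (\<sigma> y) \<longleftrightarrow> x \<in> ?X \<and> edge (\<rho> x) y"
    by (rule adjoin_copy[where K = ?X and \<rho> = \<rho>, OF Xd Xc aM \<rho>d hom]) (auto intro!: that)
  let ?\<sigma> = "\<lambda>u. if u \<in> M then u else \<sigma> u"
  have \<sigma>X: "?\<sigma> u \<in> vs limit" if "u \<in> set a" for u using that s(2) a(1) by auto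
  then have aX: "set (map ?\<sigma> a) \<subseteq> vs limit" unfolding set_map by (rule image_subsetI)
  have "sat GN (map ?\<sigma> a @ map (\<tau> n) h) \<phi> = sat GN (a @ h) \<phi>" if wf: "wf_fm GL (length a + length h) \<phi>" for n \<phi>
  proof (rule piso_sat)
    have aa: "(?\<sigma> u = ?\<sigma> v \<longleftrightarrow> u = v) \<and> (edge (?\<sigma> u) (?\<sigma> v) \<longleftrightarrow> edge u v)" if uv: "u \<in> set a" "v \<in> set a" for u v
    proof (cases "u \<in> M"; cases "v \<in> M")
      assume m: "u \<in> M" "v \<notin> M"
      then show ?thesis using s(3)[of v] s(6)[of v u] uv \<rho>M[of u] by auto
    next
      assume m: "u \<notin> M" "v \<in> M"
      then show ?thesis using s(3)[of u] s(5)[of u v] uv \<rho>M[of v] by auto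
    next
      assume m: "u \<notin> M" "v \<notin> M"
      then show ?thesis using s(4)[of u v] uv inj_on_eq_iff[OF s(1), of u v] by simp
    qed simp
    \<comment> \<open>The new copy of \<open>a\<close> avoids all copies of \<open>h\<close>.
      Equalities are still preserved, since \<open>a\<close> and \<open>h\<close> share points only
      in \<open>M\<close>.\<close>
    have ah: "(?\<sigma> u = \<tau> n y \<longleftrightarrow> u = y) \<and> (edge (?\<sigma> u) (\<tau> n y) \<longleftrightarrow> edge u y) \<and> (edge (\<tau> n y) (?\<sigma> u) \<longleftrightarrow> edge y u)"
      if uy: "u \<in> set a" "y \<in> ?H" for u y
    proof (cases "u \<in> M")
      case True
      then show ?thesis using D(2)[of u y n] D(4)[of u y n] D(4)[of y u n] D(1)[of u n] uy by simp
    next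
      case False
      have "\<tau> n y \<in> ?X" using uy(2) by blast
      moreover have "u \<noteq> y" using a(2) uy False by auto
      ultimately show ?thesis using False s(3)[of u] s(5)[of u "\<tau> n y"] s(6)[of u "\<tau> n y"] uy \<rho>H[OF uy(2)] by auto
    qed
    have hh: "(\<tau> n x = \<tau> n y \<longleftrightarrow> x = y) \<and> (edge (\<tau> n x) (\<tau> n y) \<longleftrightarrow> edge x y)" if "x \<in> ?H" "y \<in> ?H" for x y
      using D(2,4)[of x y n] that by simp
    have z: "set (zip (map ?\<sigma> a @ map (\<tau> n) h) (a @ h)) = (\<lambda>u. (?\<sigma> u, u)) ` set a \<union> (\<lambda>y. (\<tau> n y, y)) ` ?H"
      using set_zip_map[of ?\<sigma> a "\<lambda>u. u"] set_zip_map[of "\<tau> n" h "\<lambda>u. u"] by (simp add: zip_append)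
    show "piso (es limit) (set (zip (map ?\<sigma> a @ map (\<tau> n) h) (a @ h)))" unfolding z piso_def
    proof (intro allI impI)
      fix x x' y y'
      assume "(x, x') \<in> (\<lambda>u. (?\<sigma> u, u)) ` set a \<union> (\<lambda>y. (\<tau> n y, y)) ` ?H"
        "(y, y') \<in> (\<lambda>u. (?\<sigma> u, u)) ` set a \<union> (\<lambda>y. (\<tau> n y, y)) ` ?H"
      then have "x = ?\<sigma> x' \<and> x' \<in> set a \<or> x = \<tau> n x' \<and> x' \<in> ?H" "y = ?\<sigma> y' \<and> y' \<in> set a \<or> y = \<tau> n y' \<and> y' \<in> ?H"
        by blast+
      then show "(x = y \<longleftrightarrow> x' = y') \<and> (edge x y \<longleftrightarrow> edge x' y')"
      proof (elim disjE conjE)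
        assume "x = ?\<sigma> x'" "x' \<in> set a" "y = ?\<sigma> y'" "y' \<in> set a" then show ?thesis using aa[of x' y'] by simp
      next
        assume "x = ?\<sigma> x'" "x' \<in> set a" "y = \<tau> n y'" "y' \<in> ?H" then show ?thesis using ah[of x' y'] by simp
      next
        assume "x = \<tau> n x'" "x' \<in> ?H" "y = ?\<sigma> y'" "y' \<in> set a" then show ?thesis using ah[of y' x'] by (cases "y' \<in> M") auto
      next
        assume "x = \<tau> n x'" "x' \<in> ?H" "y = \<tau> n y'" "y' \<in> ?H" then show ?thesis using hh[of x' y'] by simp
      qed
    qed
    show "set (map ?\<sigma> a @ map (\<tau> n) h) \<subseteq> vs limit" using aX D(3)[of _ n] by (auto simp del: set_map) (auto simp: image_def)
    show "set (a @ h) \<subseteq> vs limit" using a(1) h by simp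
  qed (use wf in simp_all)
  moreover have "map ?\<sigma> a \<in> tuples (vs limit) (length a)" using aX by (simp add: tuples_def)
  ultimately show ?thesis by (intro bexI[of _ "map ?\<sigma> a"]) simp_all
qed

text \<open>The sequence of free copies of \<open>h\<close> is one Morley sequence whose instances
  have a common solution.\<close>

lemma not_conant_divides:
  assumes M: "M \<subseteq> vs limit" "|M| \<le>o |UNIV :: nat set set|" and a: "set a \<subseteq> vs limit" "set a \<inter> set h \<subseteq> M"
    and F: "(\<chi>, h) \<in> forms GL (vs limit) (length a)" and hold: "holds GN a (\<chi>, h)"
  shows "\<not> conant_divides GL GN M (length a) (\<chi>, h)"
proof
  assume d: "conant_divides GL GN M (length a) (\<chi>, h)"
  have h: "set h \<subseteq> vs limit" "wf_fm GL (length a + length h) \<chi>" using F by (simp_all add: forms_def)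
  obtain \<tau> :: "nat \<Rightarrow> point \<Rightarrow> point" where t: "\<tau> 0 = id" "\<And>n. free_copy M (set h) (M \<union> (\<Union>j<n. \<tau> j ` set h)) (\<tau> n)"
    using free_sequence[OF M h(1)] by (metis finite_set)
  let ?s = "\<lambda>n. map (\<tau> n) h"
  have "\<not> consistent GN (length a) {(\<chi>, ?s i) |i. True}"
    using d[unfolded conant_divides_def, THEN conjunct2, rule_format, of "free_type M h" ?s]
      free_type_invariant[OF M h(1)] free_morley[OF M(1) h(1) t(2)] t(1) by simp
  moreover obtain a' where a': "a' \<in> tuples (vs limit) (length a)"
    "\<forall>n \<phi>. wf_fm GL (length a + length h) \<phi> \<longrightarrow> sat GN (a' @ map (\<tau> n) h) \<phi> = sat GN (a @ h) \<phi>"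
    using free_common_realization[OF M h(1) a t(2)] by (elim bexE)
  have "holds GN a' (\<chi>, ?s n)" for n using a'(2) h(2) hold by (simp add: holds_def)
  then have "consistent GN (length a) {(\<chi>, ?s i) |i. True}" unfolding consistent_def realizes_def
    by (intro allI impI bexI[of _ a']) (use a'(1) in auto)
  ultimately show False by blast
qed

text \<open>The dividing formulas that cover \<open>F\<close> may have parameters among the points
  of \<open>a\<close>, where \<open>not_conant_divides\<close> says nothing. So \<open>a\<close> is
  first replaced by a tuple that still satisfies \<open>F\<close> but meets these parameters only in
  \<open>M\<close>.\<close>

lemma disjoint_conant_indep:
  assumes M: "M \<subseteq> vs limit" "|M| \<le>o |UNIV :: nat set set|" and AB: "A \<subseteq> vs limit" "B \<subseteq> vs limit" "A \<inter> B \<subseteq> M"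
  shows "conant_indep GL GN M A B"
  unfolding conant_indep_def
proof (intro ballI notI)
  fix a F assume a: "a \<in> lists A" and F: "F \<in> tp GL GN (M \<union> B) a" and f: "conant_forks GL GN M (length a) F"
  obtain \<phi> c where Fc: "F = (\<phi>, c)" by (metis surj_pair)
  have c: "set c \<subseteq> M \<union> B" "wf_fm GL (length a + length c) \<phi>" "sat GN (a @ c) \<phi>" using F Fc by (simp_all add: tp_def forms_def holds_def)
  have ad: "set a \<subseteq> vs limit" "set a \<subseteq> A" using a AB(1) by auto
  have cd: "set c \<subseteq> vs limit" using c(1) M(1) AB(2) by auto
  obtain D where D: "finite D" "\<forall>G\<in>D. conant_divides GL GN M (length a) G"
    "\<forall>a'\<in>tuples (dom GN) (length a). holds GN a' F \<longrightarrow> (\<exists>G\<in>D. holds GN a' G)" using f unfolding conant_forks_def by (elim conjE exE)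
  have Df: "G \<in> forms GL (vs limit) (length a)" if "G \<in> D" for G using bspec[OF D(2) that] by (simp add: conant_divides_def)
  let ?E = "\<Union>G\<in>D. set (snd G)"
  have Ed: "?E \<subseteq> vs limit" using Df by (fastforce simp: forms_def)
  let ?X = "M \<union> (set c \<union> ?E)"
  have Xd: "?X \<subseteq> vs limit" using M(1) cd Ed by simp
  have Xc: "|?X| \<le>o |UNIV :: nat set set|" by (rule cont_Un[OF M(2) cont_finite]) (use D(1) in simp)
  have aM: "set a - M \<subseteq> vs limit" "finite (set a - M)" using ad(1) by auto
  \<comment> \<open>With \<open>\<rho> = id\<close> and \<open>K\<close> the whole set, the copy has
    the same edges to all these points as \<open>a\<close> has, but outside \<open>M\<close> it is
    disjoint from them.\<close>
  obtain \<sigma> where s: "inj_on \<sigma> (set a - M)" "\<And>y. y \<in> set a - M \<Longrightarrow> \<sigma> y \<in> vs limit" "\<And>y. y \<in> set a - M \<Longrightarrow> \<sigma> y \<notin> ?X"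
    "\<And>y z. y \<in> set a - M \<Longrightarrow> z \<in> set a - M \<Longrightarrow> edge (\<sigma> y) (\<sigma> z) \<longleftrightarrow> edge y z"
    "\<And>y x. y \<in> set a - M \<Longrightarrow> x \<in> ?X \<Longrightarrow> edge (\<sigma> y) x \<longleftrightarrow> x \<in> ?X \<and> edge y (id x)"
    "\<And>y x. y \<in> set a - M \<Longrightarrow> x \<in> ?X \<Longrightarrow> edge x (\<sigma> y) \<longleftrightarrow> x \<in> ?X \<and> edge (id x) y"
    by (rule adjoin_copy[OF Xd Xc aM, of id ?X]) (use Xd in auto)
  let ?\<sigma> = "\<lambda>u. if u \<in> M then u else \<sigma> u"
  let ?a = "map ?\<sigma> a"
  have \<sigma>d: "?\<sigma> u \<in> vs limit" if "u \<in> set a" for u using that s(2) ad(1) by auto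
  have as: "set ?a \<subseteq> vs limit" unfolding set_map by (rule image_subsetI) (rule \<sigma>d)
  then have at: "?a \<in> tuples (vs limit) (length a)" by (simp add: tuples_def)
  have "sat GN (?a @ c) \<phi> = sat GN (a @ c) \<phi>"
  proof (rule piso_sat)
    have aa: "(?\<sigma> u = ?\<sigma> v \<longleftrightarrow> u = v) \<and> (edge (?\<sigma> u) (?\<sigma> v) \<longleftrightarrow> edge u v)" if uv: "u \<in> set a" "v \<in> set a" for u v
    proof (cases "u \<in> M"; cases "v \<in> M")
      assume m: "u \<in> M" "v \<notin> M"
      then show ?thesis using s(3)[of v] s(6)[of v u] uv by auto
    next
      assume m: "u \<notin> M" "v \<in> M"
      then show ?thesis using s(3)[of u] s(5)[of u v] uv by auto
    next
      assume m: "u \<notin> M" "v \<notin> M"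
      then show ?thesis using s(4)[of u v] uv inj_on_eq_iff[OF s(1), of u v] by simp
    qed simp
    \<comment> \<open>That \<open>A\<close> and \<open>B\<close> meet only in \<open>M\<close> is
      used here: \<open>a\<close> and \<open>c\<close> share no point outside \<open>M\<close>, so
      moving \<open>a\<close> off \<open>c\<close> destroys no equality.\<close>
    have ac: "(?\<sigma> u = x \<longleftrightarrow> u = x) \<and> (edge (?\<sigma> u) x \<longleftrightarrow> edge u x) \<and> (edge x (?\<sigma> u) \<longleftrightarrow> edge x u)"
      if ux: "u \<in> set a" "x \<in> set c" for u x
    proof (cases "u \<in> M")
      case False
      have X: "x \<in> ?X" using ux(2) by simp
      have "u \<noteq> x" using False ux c(1) ad(2) AB(3) by auto
      moreover have "\<sigma> u \<noteq> x" using s(3)[of u] X ux(1) False by auto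
      ultimately show ?thesis using False s(5)[OF _ X, of u] s(6)[OF _ X, of u] ux(1) X by simp
    qed simp
    have z: "set (zip (?a @ c) (a @ c)) = (\<lambda>u. (?\<sigma> u, u)) ` set a \<union> (\<lambda>x. (x, x)) ` set c"
      using set_zip_map[of ?\<sigma> a "\<lambda>u. u"] set_zip_map[of "\<lambda>u. u" c "\<lambda>u. u"] by (simp add: zip_append)
    show "piso (es limit) (set (zip (?a @ c) (a @ c)))" unfolding z piso_def
    proof (intro allI impI)
      fix x x' y y'
      assume "(x, x') \<in> (\<lambda>u. (?\<sigma> u, u)) ` set a \<union> (\<lambda>x. (x, x)) ` set c" "(y, y') \<in> (\<lambda>u. (?\<sigma> u, u)) ` set a \<union> (\<lambda>x. (x, x)) ` set c"
      then have "x = ?\<sigma> x' \<and> x' \<in> set a \<or> x = x' \<and> x' \<in> set c" "y = ?\<sigma> y' \<and> y' \<in> set a \<or> y = y' \<and> y' \<in> set c" by blast+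
      then show "(x = y \<longleftrightarrow> x' = y') \<and> (edge x y \<longleftrightarrow> edge x' y')"
      proof (elim disjE conjE)
        assume "x = ?\<sigma> x'" "x' \<in> set a" "y = ?\<sigma> y'" "y' \<in> set a" then show ?thesis using aa[of x' y'] by simp
      next
        assume "x = ?\<sigma> x'" "x' \<in> set a" "y = y'" "y' \<in> set c" then show ?thesis using ac[of x' y'] by simp
      next
        assume "x = x'" "x' \<in> set c" "y = ?\<sigma> y'" "y' \<in> set a" then show ?thesis using ac[of y' x'] by (cases "y' \<in> M") auto
      next
        assume "x = x'" "x' \<in> set c" "y = y'" "y' \<in> set c" then show ?thesis by simp
      qed
    qed
    show "set (?a @ c) \<subseteq> vs limit" using as cd by (simp del: set_map)
  qed (use ad(1) cd c(2) in simp_all)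
  then have "holds GN ?a F" using c(3) Fc by (simp add: holds_def)
  then obtain G where G: "G \<in> D" "holds GN ?a G" using D(3) at by auto
  have "\<not> conant_divides GL GN M (length ?a) (fst G, snd G)"
  proof (rule not_conant_divides[OF M])
    show "set ?a \<subseteq> vs limit" by (rule as)
    show "set ?a \<inter> set (snd G) \<subseteq> M"
    proof
      fix v assume v: "v \<in> set ?a \<inter> set (snd G)"
      then obtain u where u: "u \<in> set a" "v = ?\<sigma> u" by auto
      have "v \<in> ?X" using v G(1) by auto
      then show "v \<in> M" using u s(3)[of u] by (cases "u \<in> M") auto
    qed
    show "(fst G, snd G) \<in> forms GL (vs limit) (length ?a)" using Df[OF G(1)] by simp
    show "holds GN ?a (fst G, snd G)" using G(2) by simp
  qed
  then show False using bspec[OF D(2) G(1)] by simp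
qed

lemma GN_symmetric: "conant_symmetric GL stage_order GN"
  unfolding conant_symmetric_def
proof (intro allI impI)
  fix M A B
  assume *: "elementary_submodel GL GN M \<and> |M| <o stage_order \<and> A \<subseteq> dom GN \<and> |A| <o stage_order \<and> B \<subseteq> dom GN \<and> |B| <o stage_order"
  interpret monster_model GL GT stage_order GN by unfold_locales (rule GN_monster)
  have M: "M \<subseteq> vs limit" "|M| \<le>o |UNIV :: nat set set|" using * by (auto simp: elementary_submodel_def small_iff)
  have "conant_indep GL GN M A B \<longleftrightarrow> A \<inter> B \<subseteq> M" if "A \<subseteq> vs limit" "B \<subseteq> vs limit" for A B
    using conant_indep_disjoint[of M A B] disjoint_conant_indep[OF M that] * that by auto
  from this[of A B] this[of B A] show "conant_indep GL GN M A B \<longleftrightarrow> conant_indep GL GN M B A" using * by (simp add: Int_commute)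
qed

theorem theorem6p2:
  shows "(\<forall>(L :: ('f, 'r) language) T (\<kappa> :: 'k rel) (N :: ('m, 'f, 'r) struct).
            complete_theory L T \<and> monster L T \<kappa> N \<and> conant_symmetric L \<kappa> N \<longrightarrow> NSOP L N 4) \<and>
         (\<exists>(L :: (nat, nat) language) T (\<kappa> :: nat set set rel) (N :: (nat set set, nat, nat) struct).
            complete_theory L T \<and> monster L T \<kappa> N \<and> conant_symmetric L \<kappa> N \<and> strictly_NSOP L N 4) \<and>
         (\<forall>(L :: ('f, 'r) language) T (\<kappa> :: 'k rel) (N :: ('m, 'f, 'r) struct) n.
            complete_theory L T \<and> monster L T \<kappa> N \<and> conant_symmetric L \<kappa> N \<and> strictly_NSOP L N n
              \<longrightarrow> n \<le> 4)"
proof (intro conjI)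
  show "\<forall>(L :: ('f, 'r) language) T (\<kappa> :: 'k rel) (N :: ('m, 'f, 'r) struct).
      complete_theory L T \<and> monster L T \<kappa> N \<and> conant_symmetric L \<kappa> N \<longrightarrow> NSOP L N 4"
    using monster_model.symmetric_imp_NSOP4 monster_model.intro by metis
  have "NSOP GL GN 4"
    using monster_model.symmetric_imp_NSOP4[OF monster_model.intro[OF GN_monster] GN_symmetric] .
  then have "strictly_NSOP GL GN 4" using GN_SOP3 by (simp add: strictly_NSOP_def)
  then show "\<exists>(L :: (nat, nat) language) T (\<kappa> :: nat set set rel) (N :: (nat set set, nat, nat) struct).
      complete_theory L T \<and> monster L T \<kappa> N \<and> conant_symmetric L \<kappa> N \<and> strictly_NSOP L N 4"
    using GT_complete GN_monster GN_symmetric by blast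
  show "\<forall>(L :: ('f, 'r) language) T (\<kappa> :: 'k rel) (N :: ('m, 'f, 'r) struct) n.
      complete_theory L T \<and> monster L T \<kappa> N \<and> conant_symmetric L \<kappa> N \<and> strictly_NSOP L N n \<longrightarrow> n \<le> 4"
    using symmetric_imp_strictly_NSOP_le by blast
qed

end
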